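(* Let $\Omega\subset\mathbb R^2$ be a compact convex set with nonempty interior, and let $\mathcal D_n=(G_n,p_n)$, $n\ge1$, be a sequence of straight-line drawings with $|V(G_n)|=n$ which is uniform in $\Omega$, with $|E(G_n)|/n^2=e+o(1)$ as $n\to\infty$. Then \[ \operatorname{cr}(\mathcal D_n)\ \ge\ \frac{8n^4}{9\pi^2}e^3-o(n^4). \]
   Context: A drawing of a simple graph $G$ represents vertices by distinct points and edges by simple curves joining their endpoints; it is good if no edge contains a vertex in its relative interior, no two edges are tangent or meet in infinitely many points, and no three edges share an interior point. A crossing is an intersection point of two edges that is not a vertex; $\operatorname{cr}(\mathcal D)$ is the number of crossings of $\mathcal D$. A straight-line drawing $\mathcal D=(G,p)$ is a good drawing given by an injective map $p:V(G)\to\mathbb R^2$ with each edge drawn as the line segment between the images of its endpoints. With $\lambda$ the uniform probability measure on $\Omega$ (normalized Lebesgue measure), the sequence is uniform in $\Omega$ if $\frac1n\sum_{v\in V(G_n)}\delta_{p_n(v)}$ converges weakly to $\lambda$, i.e. averages of every continuous test function on $\Omega$ over the drawn vertices converge to its $\lambda$-integral. *)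

theory Defs
  imports "HOL-Analysis.Analysis" "HOL-Library.Landau_Symbols"
begin

definition simple_graph :: "'a set \<Rightarrow> 'a set set \<Rightarrow> bool" where
  "simple_graph V E \<longleftrightarrow> finite V \<and> (\<forall>e\<in>E. e \<subseteq> V \<and> card e = 2)"

(* A drawing of (V, E) is given by the vertex positions p and a map c sending each edge to the
   curve representing it, regarded as a point set (edges are not oriented). *)
definition drawing ::
  "'a set \<Rightarrow> 'a set set \<Rightarrow> ('a \<Rightarrow> real^2) \<Rightarrow> ('a set \<Rightarrow> (real^2) set) \<Rightarrow> bool" where
  "drawing V E p c \<longleftrightarrow> simple_graph V E \<and> inj_on p V \<and>
     (\<forall>e\<in>E. \<exists>g. arc g \<and> path_image g = c e \<and> {pathstart g, pathfinish g} = p ` e)"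

definition edge_interior :: "('a \<Rightarrow> real^2) \<Rightarrow> ('a set \<Rightarrow> (real^2) set) \<Rightarrow> 'a set \<Rightarrow> (real^2) set" where
  "edge_interior p c e = c e - p ` e"

(* A and B pass through each other at x: some homeomorphism from a neighbourhood of x onto the
   open unit disc straightens A and B to the two coordinate axes.  Curves with a common
   relative interior point at which this fails are regarded as tangent (touching) there. *)
definition cross_at :: "(real^2) set \<Rightarrow> (real^2) set \<Rightarrow> real^2 \<Rightarrow> bool" where
  "cross_at A B x \<longleftrightarrow>
     (\<exists>U (h :: real^2 \<Rightarrow> real^2) k. open U \<and> x \<in> U \<and> homeomorphism U (ball 0 1) h k \<and> h x = 0 \<and>
        h ` (A \<inter> U) = {y \<in> ball 0 1. y $ 2 = 0} \<and>
        h ` (B \<inter> U) = {y \<in> ball 0 1. y $ 1 = 0})"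

definition good_drawing ::
  "'a set \<Rightarrow> 'a set set \<Rightarrow> ('a \<Rightarrow> real^2) \<Rightarrow> ('a set \<Rightarrow> (real^2) set) \<Rightarrow> bool" where
  "good_drawing V E p c \<longleftrightarrow> drawing V E p c \<and>
     (\<forall>e\<in>E. \<forall>v\<in>V. p v \<notin> edge_interior p c e) \<and>
     (\<forall>e\<in>E. \<forall>f\<in>E. e \<noteq> f \<longrightarrow>
        finite (c e \<inter> c f) \<and>
        (\<forall>x \<in> edge_interior p c e \<inter> edge_interior p c f. cross_at (c e) (c f) x)) \<and>
     (\<forall>e\<in>E. \<forall>f\<in>E. \<forall>g\<in>E. e \<noteq> f \<and> e \<noteq> g \<and> f \<noteq> g \<longrightarrow>
        edge_interior p c e \<inter> edge_interior p c f \<inter> edge_interior p c g = {})"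

definition crossings ::
  "'a set \<Rightarrow> 'a set set \<Rightarrow> ('a \<Rightarrow> real^2) \<Rightarrow> ('a set \<Rightarrow> (real^2) set) \<Rightarrow> (real^2) set" where
  "crossings V E p c = {x. x \<notin> p ` V \<and> (\<exists>e\<in>E. \<exists>f\<in>E. e \<noteq> f \<and> x \<in> c e \<inter> c f)}"

definition cr ::
  "'a set \<Rightarrow> 'a set set \<Rightarrow> ('a \<Rightarrow> real^2) \<Rightarrow> ('a set \<Rightarrow> (real^2) set) \<Rightarrow> nat" where
  "cr V E p c = card (crossings V E p c)"

(* For e = {u, v} this is closed_segment (p u) (p v), see segment_convex_hull. *)
definition line_segments :: "('a \<Rightarrow> real^2) \<Rightarrow> 'a set \<Rightarrow> (real^2) set" where
  "line_segments p e = convex hull (p ` e)"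

definition straight_line_drawing :: "'a set \<Rightarrow> 'a set set \<Rightarrow> ('a \<Rightarrow> real^2) \<Rightarrow> bool" where
  "straight_line_drawing V E p \<longleftrightarrow> good_drawing V E p (line_segments p)"

(* Weak convergence, as measures on the plane, of the empirical measures of the drawn vertices
   to the uniform probability measure on \<Omega>.  Vertices outside \<Omega> are not excluded; if all of
   them lie in the compact set \<Omega>, then testing against continuous functions on \<Omega> is the same,
   by Tietze extension. *)
definition uniform_in :: "(real^2) set \<Rightarrow> (nat \<Rightarrow> 'a set) \<Rightarrow> (nat \<Rightarrow> 'a \<Rightarrow> real^2) \<Rightarrow> bool" where
  "uniform_in \<Omega> V p \<longleftrightarrow>
     (\<forall>f :: real^2 \<Rightarrow> real. continuous_on UNIV f \<and> bounded (range f) \<longrightarrow>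
        (\<lambda>n. (\<Sum>v\<in>V n. f (p n v)) / real n) \<longlonglongrightarrow> (\<integral>x. f x \<partial>uniform_measure lborel \<Omega>))"

end

(* Smear every vertex of the drawing at a small scale \<delta>.  By uniformity the edges become a density w
   on pairs of points, bounded by about 1 / |\<Omega>|^2, of mass 2e, and supported near \<Omega>.  Up to
   pairs of edges with three nearly collinear end points, 8 cr / n^4 is at least the integral of
   w(x, x') w(y, y') over those quadruples for which the segments xx' and yy' cross.

   Fix the displacements u = x' - x and v = y' - y.  The segments cross iff y - x = su - tv with
   s, t in [0, 1], and this linear change of variables has determinant det(u, v).  The integral is
   therefore that of g(z, u) g(z, v) |det(u, v)| over z, u, v, where z is the crossing point
   and g(z, u) = integral of w(z - su, z - su + u) over s in [0, 1] takes its values in the same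
   range as w.

   For fixed z the inequality of Busemann (for densities 0 <= g <= 1) bounds the integral over u, v
   below by 8 / (9 pi^2) times the cube of the mass of g(z, .); Jensen's inequality in z finishes.
   Busemann's inequality in slope coordinates u = (a, ax) becomes a statement about
   h(x) = integral of a^2 g(a, ax) and the kernel |x - y| on the line.  In terms of the primitive H of
   h, of total mass M, the double integral of h(x) h(y) |x - y| is 2 times the integral of H (M - H),
   and the bound follows from Young's inequality against h / sqrt(H (M - H)), whose integral is pi. *)

theory Submission
  imports Defs "HOL-Probability.Distribution_Functions"
begin

section \<open>Pushing a measure forward by its distribution function\<close>

text \<open>Weak convergence gives no density, so the edges are smeared at a fixed scale \<delta>; n
  goes to infinity first and \<delta> to 0 afterwards. At fixed \<delta> the smeared vertex density
  must be bounded at all points at once, which a finite net and a Lipschitz mollifier provide. The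
  edge set being arbitrary, the pair density is compared with that of the complete graph, hence the
  square of 1 / |\<Omega>|. Smearing can create crossings, but only where an orientation determinant
  of three end points is of order \<delta>, and such triples have vanishing measure. Constants: if w
  is at most C and supported in K x K, its energy is at least 8 / (9 pi^2) mass^3 / (|K|^2 C), and
  |K|^2 C tends to 1, so the area of \<Omega> drops out. The cube of 2e contributes a factor 8; a
  crossing is counted up to 8 times, by the order of its two edges and the orientation of each.
  These cancel. The value 8 / (9 pi^2) is that of the centred unit disc in Busemann's inequality:
  the integral of |det| over two copies is 1/9 times 2 pi times 4, and the mass cubed is
  pi^3.\<close>

lemma (in finite_borel_measure) emeasure_cdf_atMost_vimage:
  assumes atomless: "\<And>x. measure M {x} = 0" and c: "0 < c" "c < measure M (space M)"
  shows "emeasure M {t. cdf M t \<le> c} = ennreal c"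
proof -
  have cont: "continuous_on UNIV (cdf M)"
    using atomless by (simp add: continuous_on_eq_continuous_at isCont_cdf)
  obtain a where a: "cdf M a < c"
    using order_tendstoD(2)[OF cdf_lim_at_bot c(1)] by (auto simp: eventually_at_bot_linorder)
  obtain b where b: "c < cdf M b"
    using order_tendstoD(1)[OF cdf_lim_at_top c(2)] by (auto simp: eventually_at_top_linorder)
  have "a \<le> b"
    using a b cdf_nondecreasing[of b a] by linarith
  then obtain t0 where t0: "cdf M t0 = c"
    using IVT'[of "cdf M" a c b] a b continuous_on_subset[OF cont] by auto
  define T where "T = {t. cdf M t \<le> c}"
  have closed: "closed T"
    unfolding T_def by (intro closed_Collect_le cont continuous_intros)
  have bdd: "bdd_above T"
  proof (rule bdd_aboveI)
    fix t assume "t \<in> T"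
    then have "cdf M t < cdf M b"
      using b by (simp add: T_def)
    then show "t \<le> b"
      using cdf_nondecreasing[of b t] by linarith
  qed
  have "t0 \<in> T"
    using t0 by (simp add: T_def)
  then have ST: "Sup T \<in> T"
    using closed bdd by (intro closed_contains_Sup) auto
  have "T = {..Sup T}"
    using ST cSup_upper[OF _ bdd] cdf_nondecreasing by (auto simp: T_def intro: order_trans)
  \<comment> \<open>The sublevel set is the half-line up to its supremum. The value there is at most
    \<open>c\<close> because the supremum belongs to the set, and at least \<open>c\<close> by
    monotonicity from \<open>t0\<close>.\<close>
  moreover have "cdf M (Sup T) = c"
    using ST cdf_nondecreasing[OF cSup_upper[OF \<open>t0 \<in> T\<close> bdd]] t0 by (simp add: T_def)
  ultimately have "emeasure M T = ennreal c"
    by (metis cdf_def2 emeasure_eq_measure)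
  then show ?thesis
    by (simp add: T_def)
qed

text \<open>The probability integral transform. Finite values on the half-lines
  \<open>{c<..}\<close> determine a measure, and for \<open>c\<close> strictly between 0 and the
  total mass the previous lemma evaluates the complement.\<close>

lemma (in finite_borel_measure) distr_cdf:
  assumes atomless: "\<And>x. measure M {x} = 0"
  shows "distr M borel (cdf M) = density lborel (indicator {0<..<measure M (space M)})"
    (is "?L = ?R")
proof (rule measure_eqI_lessThan)
  let ?m = "measure M (space M)"
  have meas [measurable]: "cdf M \<in> borel_measurable M"
  proof -
    have "mono (cdf M)"
      by (simp add: monoI cdf_nondecreasing)
    then have "cdf M \<in> borel_measurable borel"
      by (rule borel_measurable_mono)
    then show ?thesis
      using measurable_cong_sets[OF M_is_borel refl] by blast
  qed
  have S [simp]: "{t. cdf M t \<le> c} \<in> sets M" "{t. c < cdf M t} \<in> sets M" for c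
  proof -
    have [measurable]: "cdf M \<in> borel_measurable borel"
      by (intro borel_measurable_mono monoI cdf_nondecreasing)
    show "{t. cdf M t \<le> c} \<in> sets M" "{t. c < cdf M t} \<in> sets M"
      unfolding M_is_borel by measurable
  qed
  have UNIV_eq: "space M = UNIV"
    using sets_eq_imp_space_eq[OF M_is_borel] by simp
  have L: "emeasure ?L {c<..} = emeasure M {t. c < cdf M t}" for c
    by (subst emeasure_distr) (auto simp: UNIV_eq intro!: arg_cong[where f = "emeasure M"])
  show "emeasure ?L {c<..} < \<infinity>" for c
    unfolding L using emeasure_finite by (simp add: less_top[symmetric])
  show "emeasure ?L {c<..} = emeasure ?R {c<..}" for c
  proof -
    have R: "emeasure ?R {c<..} = ennreal (max 0 (?m - max c 0))"
    proof -
      have "emeasure ?R {c<..} = (\<integral>\<^sup>+x. indicator {0<..<?m} x * indicator {c<..} x \<partial>lborel)"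
        by (rule emeasure_density) auto
      also have "\<dots> = (\<integral>\<^sup>+x. indicator ({0<..<?m} \<inter> {c<..}) x \<partial>lborel)"
        by (simp only: indicator_inter_arith)
      also have "\<dots> = emeasure lborel ({0<..<?m} \<inter> {c<..})"
        by (rule nn_integral_indicator) auto
      also have "{0<..<?m} \<inter> {c<..} = {max c 0<..<?m}"
        by auto
      also have "emeasure lborel \<dots> = ennreal (max 0 (?m - max c 0))"
        by (cases "max c 0 \<le> ?m") auto
      finally show ?thesis .
    qed
    consider "c < 0" | "c \<ge> ?m" | "0 < c" "c < ?m" | "c = 0" "0 < ?m"
      using measure_nonneg[of M "space M"] by linarith
    then show ?thesis
    proof cases
      case 1
      then have "{t. c < cdf M t} = space M"
        using cdf_nonneg by (auto simp: UNIV_eq intro: less_le_trans)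
      then show ?thesis
        using 1 by (simp add: L R emeasure_eq_measure max_def)
    next
      case 2
      then have "{t. c < cdf M t} = {}"
        using cdf_bounded by (auto simp: not_less intro: order_trans)
      then show ?thesis
        using 2 by (auto simp: L R max_def intro: antisym[OF order_trans measure_nonneg])
    next
      case 3
      have "emeasure M (space M - {t. cdf M t \<le> c}) = emeasure M (space M) - emeasure M {t. cdf M t \<le> c}"
        by (rule emeasure_compl) auto
      moreover have "space M - {t. cdf M t \<le> c} = {t. c < cdf M t}"
        by (auto simp: UNIV_eq)
      ultimately show ?thesis
        using 3 emeasure_cdf_atMost_vimage[OF atomless 3]
        by (simp add: L R emeasure_eq_measure ennreal_minus max_def)
    next
      case 4
      \<comment> \<open>At \<open>c = 0\<close> the sublevel set can be empty, so the previous lemma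
        does not extend to it; the mass is approached through small positive levels
        \<open>d\<close>.\<close>
      have *: "ennreal (measure M {t. 0 < cdf M t}) \<ge> ennreal (?m - d)" if "0 < d" "d < ?m" for d
      proof -
        have "{t. d < cdf M t} \<subseteq> {t. 0 < cdf M t}"
          using that by auto
        then have "emeasure M {t. d < cdf M t} \<le> emeasure M {t. 0 < cdf M t}"
          by (intro emeasure_mono) auto
        moreover have "emeasure M (space M - {t. cdf M t \<le> d}) = emeasure M (space M) - emeasure M {t. cdf M t \<le> d}"
          by (rule emeasure_compl) auto
        moreover have "space M - {t. cdf M t \<le> d} = {t. d < cdf M t}"
          by (auto simp: UNIV_eq)
        ultimately show ?thesis
          using that emeasure_cdf_atMost_vimage[OF atomless that]
          by (simp add: emeasure_eq_measure ennreal_minus)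
      qed
      have "?m \<le> measure M {t. 0 < cdf M t}"
      proof (rule field_le_epsilon)
        fix d :: real assume "0 < d"
        define d' where "d' = min d (?m/2)"
        have "0 < d'" "d' < ?m" "d' \<le> d"
          using \<open>0 < d\<close> 4 by (auto simp: d'_def)
        from *[OF this(1,2)] show "?m \<le> measure M {t. 0 < cdf M t} + d"
          using \<open>d' \<le> d\<close> by simp
      qed
      moreover have "measure M {t. 0 < cdf M t} \<le> ?m"
        by (rule bounded_measure)
      ultimately have "measure M {t. 0 < cdf M t} = ?m"
        by simp
      then show ?thesis
        unfolding L R emeasure_eq_measure using 4 by simp
    qed
  qed
qed auto

text \<open>The antiderivative \<open>M * arcsin (2 * r / M - 1)\<close> runs from
  \<open>- M * pi / 2\<close> to \<open>M * pi / 2\<close>. The integrand is unbounded at both ends,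
  so the fundamental theorem is used in its improper form, with one-sided limits.\<close>

lemma nn_integral_arcsine:
  assumes "M > 0"
  shows "(\<integral>\<^sup>+r. indicator {0<..<M} r / ennreal (sqrt (r / M * (1 - r / M))) \<partial>lborel) = ennreal (M * pi)"
proof -
  define f where "f r = 1 / sqrt (r / M * (1 - r / M))" for r
  define F where "F r = M * arcsin (2 * r / M - 1)" for r
  have DF: "DERIV F r :> f r" if "0 < r" "r < M" for r
  proof -
    have rng: "-1 < 2 * r / M - 1" "2 * r / M - 1 < 1"
      using that assms by (auto simp: field_simps)
    have "1 - (2 * r / M - 1)\<^sup>2 = 4 * (r / M * (1 - r / M))"
      by (simp add: power2_eq_square algebra_simps add_divide_distrib diff_divide_distrib)
    then have "sqrt (1 - (2 * r / M - 1)\<^sup>2) = 2 * sqrt (r / M * (1 - r / M))"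
      by (simp only: real_sqrt_mult) simp
    then show ?thesis
      unfolding F_def f_def using assms rng
      by (auto intro!: derivative_eq_intros simp: field_simps)
  qed
  have cF: "continuous_on {0..M} F"
    unfolding F_def using assms
    by (intro continuous_intros) (auto simp: field_simps)
  have pos: "0 < r / M * (1 - r / M)" if "0 < r" "r < M" for r
    using that assms by (auto intro!: mult_pos_pos)
  have int: "set_integrable lborel (einterval 0 (ereal M)) f" and
       val: "(LBINT r=0..ereal M. f r) = F M - F 0"
  proof -
    have A: "((F \<circ> real_of_ereal) \<longlongrightarrow> F 0) (at_right 0)"
    proof -
      have "(F \<longlongrightarrow> F 0) (at_right 0)"
        using cF assms by (auto simp: continuous_on_Icc_at_rightD)
      then show ?thesis
        by (simp add: zero_ereal_def ereal_tendsto_simps1)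
    qed
    have B: "((F \<circ> real_of_ereal) \<longlongrightarrow> F M) (at_left (ereal M))"
    proof -
      have "(F \<longlongrightarrow> F M) (at_left M)"
        using cF assms by (auto simp: continuous_on_Icc_at_leftD)
      then show ?thesis
        by (simp add: ereal_tendsto_simps1)
    qed
    have cont: "isCont f r" if "0 < r" "r < M" for r
      unfolding f_def using pos[OF that] assms by (intro continuous_intros) auto
    have "0 \<le> f r" if "0 < r" "r < M" for r
      unfolding f_def using pos[OF that] by simp
    with interval_integral_FTC_nonneg[of 0 "ereal M" F f "F 0" "F M"] DF cont A B assms
    show "set_integrable lborel (einterval 0 (ereal M)) f" "(LBINT r=0..ereal M. f r) = F M - F 0"
      by (auto simp: zero_ereal_def)
  qed
  have ei: "einterval 0 (ereal M) = {0<..<M}"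
    by (auto simp: einterval_def zero_ereal_def)
  have "(\<integral>\<^sup>+r. indicator {0<..<M} r / ennreal (sqrt (r / M * (1 - r / M))) \<partial>lborel)
      = (\<integral>\<^sup>+r. ennreal (indicator {0<..<M} r *\<^sub>R f r) \<partial>lborel)"
  proof (rule nn_integral_cong)
    fix r
    show "indicator {0<..<M} r / ennreal (sqrt (r / M * (1 - r / M))) = ennreal (indicator {0<..<M} r *\<^sub>R f r)"
    proof (cases "r \<in> {0<..<M}")
      case True
      then have "0 < r / M * (1 - r / M)"
        using pos by auto
      then show ?thesis
        using True unfolding f_def
        by (simp add: divide_ennreal[symmetric] del: times_divide_eq_left times_divide_eq_right mult_eq_0_iff)
    qed auto
  qed
  also have "\<dots> = ennreal (\<integral>r. indicator {0<..<M} r *\<^sub>R f r \<partial>lborel)"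
    using int pos unfolding ei set_integrable_def f_def
    by (intro nn_integral_eq_integral) (auto simp: indicator_def less_imp_le)
  also have "(\<integral>r. indicator {0<..<M} r *\<^sub>R f r \<partial>lborel) = F M - F 0"
    using val assms ei by (simp add: interval_lebesgue_integral_def set_lebesgue_integral_def zero_ereal_def)
  also have "F M - F 0 = M * pi"
    using assms by (simp add: F_def algebra_simps)
  finally show ?thesis .
qed

section \<open>A reverse Hardy-Littlewood-Sobolev inequality on the line\<close>

definition det2 :: "real \<times> real \<Rightarrow> real \<times> real \<Rightarrow> real" where
  "det2 u v = fst u * snd v - snd u * fst v"

lemma measurable_fst_snd_borel [measurable]:
  "fst \<in> borel_measurable (borel :: (real \<times> real) measure)"
  "snd \<in> borel_measurable (borel :: (real \<times> real) measure)"
  by (intro borel_measurable_continuous_onI continuous_intros)+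

lemma measurable_det2 [measurable (raw)]:
  assumes [measurable]: "f \<in> borel_measurable M" "g \<in> borel_measurable M"
  shows "(\<lambda>x. det2 (f x) (g x)) \<in> borel_measurable M"
  unfolding det2_def by measurable

text \<open>The distance is the length of the set of thresholds \<open>t\<close> that separate
  \<open>x\<close> from \<open>y\<close>. The half-open convention matches \<open>{..t}\<close> and
  \<open>{t<..}\<close>, which later become the primitive and its complement.\<close>

lemma ennreal_abs_diff_eq_nn_integral:
  "ennreal \<bar>x - y\<bar> = (\<integral>\<^sup>+t. (if x \<le> t then 1 else 0) * (if t < y then 1 else 0)
      + (if y \<le> t then 1 else 0) * (if t < x then 1 else 0) \<partial>lborel)"
proof -
  have "(\<integral>\<^sup>+t. (if x \<le> t then 1 else 0) * (if t < y then 1 else 0)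
      + (if y \<le> t then 1 else 0) * (if t < x then 1 else 0) \<partial>lborel)
      = (\<integral>\<^sup>+t. indicator {min x y..<max x y} t \<partial>lborel)"
    by (intro nn_integral_cong) (auto simp: indicator_def)
  also have "\<dots> = emeasure lborel {min x y..<max x y}"
    by (rule nn_integral_indicator) auto
  also have "\<dots> = ennreal \<bar>x - y\<bar>"
    by (cases "x \<le> y") (auto simp: min_def max_def)
  finally show ?thesis ..
qed

text \<open>Once the distance is an integral over thresholds, Fubini puts \<open>t\<close> outermost
  and the other two integrals factor; the two orders of \<open>x\<close> and \<open>y\<close> give
  the 2.\<close>

lemma nn_integral_abs_diff:
  fixes h :: "real \<Rightarrow> ennreal"
  assumes [measurable]: "h \<in> borel_measurable borel"
  shows "(\<integral>\<^sup>+x. \<integral>\<^sup>+y. h x * h y * ennreal \<bar>x - y\<bar> \<partial>lborel \<partial>lborel)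
    = 2 * (\<integral>\<^sup>+t. (\<integral>\<^sup>+x. h x * indicator {..t} x \<partial>lborel) * (\<integral>\<^sup>+x. h x * indicator {t<..} x \<partial>lborel) \<partial>lborel)"
proof -
  define p where "p x t = (if x \<le> t then 1 else 0 :: ennreal)" for x t :: real
  define q where "q y t = (if t < y then 1 else 0 :: ennreal)" for y t :: real
  have [measurable]: "case_prod p \<in> borel_measurable (borel \<Otimes>\<^sub>M borel)"
    "case_prod q \<in> borel_measurable (borel \<Otimes>\<^sub>M borel)"
    unfolding p_def q_def by measurable
  define P where "P t = (\<integral>\<^sup>+x. h x * p x t \<partial>lborel)" for t
  define Q where "Q t = (\<integral>\<^sup>+x. h x * q x t \<partial>lborel)" for t
  have [measurable]: "P \<in> borel_measurable borel" "Q \<in> borel_measurable borel"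
    unfolding P_def Q_def by measurable
  have "(\<integral>\<^sup>+x. \<integral>\<^sup>+y. h x * h y * ennreal \<bar>x - y\<bar> \<partial>lborel \<partial>lborel)
     = (\<integral>\<^sup>+x. \<integral>\<^sup>+y. \<integral>\<^sup>+t. h x * h y * (p x t * q y t + p y t * q x t) \<partial>lborel \<partial>lborel \<partial>lborel)"
    by (simp add: ennreal_abs_diff_eq_nn_integral p_def q_def nn_integral_cmult)
  also have "\<dots> = (\<integral>\<^sup>+x. \<integral>\<^sup>+t. \<integral>\<^sup>+y. h x * h y * (p x t * q y t + p y t * q x t) \<partial>lborel \<partial>lborel \<partial>lborel)"
    by (intro nn_integral_cong lborel_pair.Fubini') measurable
  also have "\<dots> = (\<integral>\<^sup>+t. \<integral>\<^sup>+x. \<integral>\<^sup>+y. h x * h y * (p x t * q y t + p y t * q x t) \<partial>lborel \<partial>lborel \<partial>lborel)"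
    by (intro lborel_pair.Fubini') measurable
  also have "\<dots> = (\<integral>\<^sup>+t. \<integral>\<^sup>+x. \<integral>\<^sup>+y. (h x * p x t) * (h y * q y t) + (h x * q x t) * (h y * p y t) \<partial>lborel \<partial>lborel \<partial>lborel)"
    by (simp add: algebra_simps)
  also have "\<dots> = (\<integral>\<^sup>+t. P t * Q t + Q t * P t \<partial>lborel)"
    by (simp add: nn_integral_add nn_integral_cmult nn_integral_multc flip: P_def Q_def)
  also have "\<dots> = 2 * (\<integral>\<^sup>+t. P t * Q t \<partial>lborel)"
    by (simp add: nn_integral_add mult.commute[of "Q _"] mult_2)
  also have "(\<integral>\<^sup>+t. P t * Q t \<partial>lborel) = (\<integral>\<^sup>+t. (\<integral>\<^sup>+x. h x * indicator {..t} x \<partial>lborel) * (\<integral>\<^sup>+x. h x * indicator {t<..} x \<partial>lborel) \<partial>lborel)"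
    unfolding P_def Q_def p_def q_def
    by (intro nn_integral_cong arg_cong2[where f = "(*)"]) (auto simp: indicator_def)
  finally show ?thesis .
qed

text \<open>The optimal choice is \<open>b\<^sup>3 = 3 a / (2 l)\<close>.\<close>

lemma le_of_weighted_bounds:
  fixes m a l :: real
  assumes "m \<ge> 0" "a > 0" "l \<ge> 0" and bound: "\<And>b. b > 0 \<Longrightarrow> m \<le> a / b + b\<^sup>2 * l / 3"
  shows "m ^ 3 \<le> 9 / 4 * a\<^sup>2 * l"
proof (cases "l = 0")
  case True
  \<comment> \<open>For \<open>l = 0\<close> one lets \<open>b\<close> grow;
    \<open>b = 2 * a / m\<close> already yields \<open>m \<le> m / 2\<close>.\<close>
  have "m = 0"
  proof (rule ccontr)
    assume "m \<noteq> 0"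
    with assms have "m > 0" by simp
    with bound[of "2 * a / m"] True \<open>a > 0\<close> show False
      by simp
  qed
  then show ?thesis using True by simp
next
  case False
  define b where "b = root 3 (3 * a / (2 * l))"
  have b: "b > 0" "b ^ 3 = 3 * a / (2 * l)"
    using False assms by (auto simp: b_def real_root_gt_zero)
  have "b\<^sup>2 * l / 3 = b ^ 3 * l / (3 * b)"
    using b(1) by (simp add: field_simps power3_eq_cube power2_eq_square)
  also have "\<dots> = a / (2 * b)"
    using b False by (simp add: field_simps)
  finally have "m \<le> 3 * a / (2 * b)"
    using bound[OF b(1)] b(1) by (simp add: field_simps)
  then have "m ^ 3 \<le> (3 * a / (2 * b)) ^ 3"
    using assms by (intro power_mono) auto
  also have "\<dots> = 27 * a ^ 3 / (8 * b ^ 3)"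
    by (simp add: power_divide power_mult_distrib)
  also have "\<dots> = 9 / 4 * a\<^sup>2 * l"
    unfolding b(2) using assms False by (simp add: field_simps power3_eq_cube power2_eq_square)
  finally show ?thesis .
qed

text \<open>The hypothesis relating \<open>h\<close> and \<open>k\<close> is the bound \<open>h \<ge> (2/3) k\<close> to the power \<open>3/2\<close>,
  linearised: equality is approached at \<open>R\<^sup>2 = k\<close>. It is used with \<open>R\<close> proportional to
  \<open>sqrt (s (1 - s))\<close>, where \<open>s\<close> is the normalised primitive of \<open>h\<close>, because
  \<open>h / sqrt (s (1 - s))\<close> then integrates to an arcsine integral and \<open>s (1 - s)\<close> to a
  multiple of the right-hand side.\<close>

lemma reverse_HLS_line:
  fixes h k :: "real \<Rightarrow> ennreal"
  assumes [measurable]: "h \<in> borel_measurable borel" "k \<in> borel_measurable borel"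
    and hk: "\<And>x R. R > 0 \<Longrightarrow> ennreal R * k x \<le> h x + ennreal (R ^ 3 / 3)"
    and fin: "(\<integral>\<^sup>+x. h x \<partial>lborel) < \<infinity>"
  shows "ennreal (8 / (9 * pi\<^sup>2)) * (\<integral>\<^sup>+x. k x \<partial>lborel) ^ 3
    \<le> (\<integral>\<^sup>+x. \<integral>\<^sup>+y. h x * h y * ennreal \<bar>x - y\<bar> \<partial>lborel \<partial>lborel)" (is "_ \<le> ?J")
proof -
  \<comment> \<open>Dividing the hypothesis by \<open>R\<close> and letting \<open>R\<close> tend to
    0 forces this. It is needed where the quotient of \<open>h\<close> by \<open>\<sigma>\<close>
    below is 0 / 0, which counts as 0.\<close>
  have k0: "k x = 0" if "h x = 0" for x
  proof (rule ccontr)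
    assume "k x \<noteq> 0"
    have le: "ennreal R * k x \<le> ennreal (R ^ 3 / 3)" if "R > 0" for R
      using hk[OF that, of x] \<open>h x = 0\<close> by simp
    from le[of 1] obtain r where r: "k x = ennreal r" "r \<ge> 0"
      by (cases "k x") (auto simp: top_unique)
    with \<open>k x \<noteq> 0\<close> have "r > 0"
      by (cases "r = 0") auto
    define R where "R = min 1 r"
    have R: "R > 0" "R \<le> 1" "R \<le> r"
      using \<open>r > 0\<close> by (auto simp: R_def)
    from le[OF R(1)] r R have "R * r \<le> R ^ 3 / 3"
      by (simp add: ennreal_mult[symmetric] ennreal_le_iff)
    then have "r \<le> R\<^sup>2 / 3"
      using R by (simp add: power3_eq_cube power2_eq_square field_simps)
    moreover have "R\<^sup>2 \<le> R"
      using R by (simp add: power2_eq_square mult_left_le)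
    ultimately show False
      using R by linarith
  qed
  define N where "N = density lborel h"
  have sN: "sets N = sets borel" "space N = UNIV"
    by (auto simp: N_def)
  have eN: "emeasure N A = (\<integral>\<^sup>+x. h x * indicator A x \<partial>lborel)" if "A \<in> sets borel" for A
    using that by (simp add: N_def emeasure_density)
  interpret N: finite_borel_measure N
  proof (intro finite_borel_measure.intro finite_measureI finite_borel_measure_axioms.intro)
    show "emeasure N (space N) \<noteq> \<infinity>"
      using fin by (simp add: sN eN)
  qed (simp add: sN)
  define M where "M = measure N UNIV"
  have M: "(\<integral>\<^sup>+x. h x \<partial>lborel) = ennreal M"
    using eN[of UNIV] by (simp add: M_def N.emeasure_eq_measure)
  have "M \<ge> 0" by (simp add: M_def)
  have atomless: "measure N {x} = 0" for x
  proof -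
    have "emeasure N {x} = 0"
      unfolding N_def by (subst emeasure_density) (auto intro!: nn_integral_0_iff_AE[THEN iffD2] AE_mp[OF AE_lborel_singleton[of x]])
    then show ?thesis by (simp add: measure_def)
  qed
  show ?thesis
  proof (cases "M = 0")
    case True
    then have "AE x in lborel. h x = 0"
      using M nn_integral_0_iff_AE[of h lborel] by simp
    then have "AE x in lborel. k x = 0"
      using k0 by auto
    then have "(\<integral>\<^sup>+x. k x \<partial>lborel) = 0"
      by (simp add: nn_integral_0_iff_AE)
    then show ?thesis by simp
  next
    case False
    with \<open>M \<ge> 0\<close> have "M > 0" by simp
    define H where "H = cdf N"
    have H: "0 \<le> H t" "H t \<le> M" for t
      using N.cdf_nonneg N.cdf_bounded by (auto simp: H_def M_def sN)
    have [measurable]: "H \<in> borel_measurable borel"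
      by (rule borel_measurable_mono) (simp add: H_def monoI N.cdf_nondecreasing)
    have H1: "(\<integral>\<^sup>+x. h x * indicator {..t} x \<partial>lborel) = ennreal (H t)" for t
      using eN[of "{..t}"] by (simp add: H_def cdf_def N.emeasure_eq_measure)
    have H2: "(\<integral>\<^sup>+x. h x * indicator {t<..} x \<partial>lborel) = ennreal (M - H t)" for t
    proof -
      have "measure N (UNIV - {..t}) = M - H t"
        using N.finite_measure_compl[of "{..t}"] by (simp add: sN H_def cdf_def M_def)
      moreover have "UNIV - {..t} = {t<..}" by auto
      ultimately show ?thesis
        using eN[of "{t<..}"] by (simp add: N.emeasure_eq_measure)
    qed
    have J: "?J = 2 * (\<integral>\<^sup>+t. ennreal (H t * (M - H t)) \<partial>lborel)"
      using H by (simp add: nn_integral_abs_diff H1 H2 ennreal_mult)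
    define \<sigma> where "\<sigma> t = sqrt (H t / M * (1 - H t / M))" for t
    have [measurable]: "\<sigma> \<in> borel_measurable borel"
      unfolding \<sigma>_def by measurable
    have arg0: "0 \<le> H t / M * (1 - H t / M)" for t
      using H[of t] \<open>M > 0\<close> by (intro mult_nonneg_nonneg) auto
    have \<sigma>0: "\<sigma> t \<ge> 0" and \<sigma>2: "(\<sigma> t)\<^sup>2 = H t * (M - H t) / M\<^sup>2" for t
      using arg0[of t] \<open>M > 0\<close> by (auto simp: \<sigma>_def power2_eq_square field_simps)
    define l where "l = (\<integral>\<^sup>+t. ennreal ((\<sigma> t)\<^sup>2) \<partial>lborel)"
    have Jl: "?J = ennreal (2 * M\<^sup>2) * l"
    proof -
      have "(\<integral>\<^sup>+t. ennreal (H t * (M - H t)) \<partial>lborel) = (\<integral>\<^sup>+t. ennreal (M\<^sup>2) * ennreal ((\<sigma> t)\<^sup>2) \<partial>lborel)"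
        using \<open>M > 0\<close> H by (intro nn_integral_cong) (simp add: \<sigma>2 ennreal_mult[symmetric])
      also have "\<dots> = ennreal (M\<^sup>2) * l"
        by (simp add: l_def nn_integral_cmult)
      finally show ?thesis
        unfolding J by (simp add: ennreal_mult mult.assoc)
    qed
    \<comment> \<open>Under the measure with density \<open>h\<close> the integrand is a function of
      \<open>H\<close> alone, and \<open>H\<close> carries that measure to Lebesgue measure on the
      interval from 0 to \<open>M\<close>: the arcsine integral appears.\<close>
    have hs: "(\<integral>\<^sup>+t. h t / ennreal (\<sigma> t) \<partial>lborel) = ennreal (M * pi)"
    proof -
      have [measurable]: "H \<in> measurable N borel"
        by (simp add: N_def)
      have "(\<integral>\<^sup>+t. h t / ennreal (\<sigma> t) \<partial>lborel) = (\<integral>\<^sup>+t. 1 / ennreal (\<sigma> t) \<partial>N)"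
        unfolding N_def by (subst nn_integral_density) (auto simp: ennreal_times_divide)
      also have "\<dots> = (\<integral>\<^sup>+r. 1 / ennreal (sqrt (r / M * (1 - r / M))) \<partial>distr N borel H)"
        by (subst nn_integral_distr) (auto simp: \<sigma>_def)
      also have "distr N borel H = density lborel (indicator {0<..<M})"
        using N.distr_cdf[OF atomless] by (simp add: H_def M_def sN)
      also have "(\<integral>\<^sup>+r. 1 / ennreal (sqrt (r / M * (1 - r / M))) \<partial>\<dots>) = (\<integral>\<^sup>+r. indicator {0<..<M} r / ennreal (sqrt (r / M * (1 - r / M))) \<partial>lborel)"
        by (subst nn_integral_density) (auto simp: ennreal_times_divide)
      also have "\<dots> = ennreal (M * pi)"
        by (rule nn_integral_arcsine) fact
      finally show ?thesis .
    qed
    have bound: "(\<integral>\<^sup>+x. k x \<partial>lborel) \<le> ennreal (M * pi / b) + ennreal (b\<^sup>2 / 3) * l" if "b > 0" for b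
    proof -
      have pt: "k t \<le> ennreal (1 / b) * (h t / ennreal (\<sigma> t)) + ennreal (b\<^sup>2 / 3) * ennreal ((\<sigma> t)\<^sup>2)" for t
      \<comment> \<open>If \<open>\<sigma> t = 0\<close> and \<open>h t > 0\<close>, the quotient is
        infinite and the bound is trivial; if \<open>h t = 0\<close>, then
        \<open>k t = 0\<close>.\<close>
      proof (cases "\<sigma> t = 0")
        case True
        then show ?thesis
          using k0[of t] \<open>b > 0\<close> by (cases "h t = 0") (auto simp: ennreal_mult_eq_top_iff ennreal_divide_zero)
      next
        case False
        with \<sigma>0 have s: "\<sigma> t > 0" by (simp add: less_le)
        define R where "R = b * \<sigma> t"
        have R: "R > 0" using s \<open>b > 0\<close> by (simp add: R_def)
        have "k t = ennreal (1 / R) * (ennreal R * k t)"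
          using R by (simp add: ennreal_mult[symmetric] mult.assoc[symmetric])
        also have "\<dots> \<le> ennreal (1 / R) * (h t + ennreal (R ^ 3 / 3))"
          by (intro mult_left_mono hk R) auto
        also have "\<dots> = ennreal (1 / R) * h t + ennreal (R\<^sup>2 / 3)"
          using R by (simp add: distrib_left ennreal_mult[symmetric] power3_eq_cube power2_eq_square)
        also have "ennreal (1 / R) * h t = ennreal (1 / b) * (h t / ennreal (\<sigma> t))"
        proof -
          have "ennreal (1 / R) = ennreal (1 / b) * ennreal (inverse (\<sigma> t))"
            using s \<open>b > 0\<close> by (simp add: R_def divide_inverse flip: ennreal_mult)
          then show ?thesis
            using s by (simp only: divide_ennreal_def inverse_ennreal mult_ac)
        qed
        also have "ennreal (R\<^sup>2 / 3) = ennreal (b\<^sup>2 / 3) * ennreal ((\<sigma> t)\<^sup>2)"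
          by (simp add: R_def power_mult_distrib ennreal_mult[symmetric])
        finally show ?thesis .
      qed
      have "(\<integral>\<^sup>+x. k x \<partial>lborel) \<le> (\<integral>\<^sup>+t. ennreal (1 / b) * (h t / ennreal (\<sigma> t)) + ennreal (b\<^sup>2 / 3) * ennreal ((\<sigma> t)\<^sup>2) \<partial>lborel)"
        by (intro nn_integral_mono pt)
      also have "\<dots> = ennreal (1 / b) * ennreal (M * pi) + ennreal (b\<^sup>2 / 3) * l"
        by (simp add: nn_integral_add nn_integral_cmult hs l_def)
      also have "ennreal (1 / b) * ennreal (M * pi) = ennreal (M * pi / b)"
        using \<open>b > 0\<close> \<open>M > 0\<close> by (simp add: ennreal_mult[symmetric])
      finally show ?thesis .
    qed
    show ?thesis
    proof (cases "l = \<infinity>")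
      case True
      then have "?J = \<infinity>"
        using \<open>M > 0\<close> by (simp add: Jl ennreal_mult_eq_top_iff)
      then show ?thesis by simp
    next
      case False
      then obtain lr where lr: "l = ennreal lr" "lr \<ge> 0"
        by (cases l) auto
      have bound': "(\<integral>\<^sup>+x. k x \<partial>lborel) \<le> ennreal (M * pi / b + b\<^sup>2 * lr / 3)" if "b > 0" for b
        using bound[OF that] that lr \<open>M > 0\<close> by (simp add: ennreal_mult[symmetric] ennreal_plus[symmetric] del: ennreal_plus)
      obtain m where m: "(\<integral>\<^sup>+x. k x \<partial>lborel) = ennreal m" "m \<ge> 0"
        using bound'[of 1] by (cases "\<integral>\<^sup>+x. k x \<partial>lborel") (auto simp: top_unique)
      have "m ^ 3 \<le> 9 / 4 * (M * pi)\<^sup>2 * lr"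
      proof (rule le_of_weighted_bounds)
        show "m \<le> M * pi / b + b\<^sup>2 * lr / 3" if "b > 0" for b
          using bound'[OF that] that lr \<open>M > 0\<close> unfolding m(1) by (subst (asm) ennreal_le_iff) auto
      qed (use m lr \<open>M > 0\<close> in auto)
      \<comment> \<open>Origin of the constant: \<open>?J\<close> equals
        \<open>2 * M\<^sup>2 * lr\<close>, and 2 divided by \<open>9 / 4 * pi\<^sup>2\<close> is
        \<open>8 / (9 * pi\<^sup>2)\<close>.\<close>
      then have "8 / (9 * pi\<^sup>2) * m ^ 3 \<le> 2 * M\<^sup>2 * lr"
        by (simp add: field_simps power_mult_distrib)
      then show ?thesis
        using m lr by (simp add: Jl ennreal_mult[symmetric] ennreal_power ennreal_le_iff)
    qed
  qed
qed

section \<open>Busemann's inequality in the plane\<close>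

text \<open>The coordinates \<open>(a, a * x)\<close> have Jacobian \<open>\<bar>a\<bar>\<close>;
  the line \<open>a = 0\<close>, where they break down, is null.\<close>

lemma nn_integral_slope:
  fixes f :: "real \<times> real \<Rightarrow> ennreal"
  assumes [measurable]: "f \<in> borel_measurable borel"
  shows "(\<integral>\<^sup>+u. f u \<partial>lborel) = (\<integral>\<^sup>+x. \<integral>\<^sup>+a. ennreal \<bar>a\<bar> * f (a, a * x) \<partial>lborel \<partial>lborel)"
proof -
  have "(\<integral>\<^sup>+u. f u \<partial>lborel) = (\<integral>\<^sup>+u. f u \<partial>(lborel \<Otimes>\<^sub>M lborel))"
    by (simp add: lborel_prod)
  also have "\<dots> = (\<integral>\<^sup>+a. \<integral>\<^sup>+b. f (a, b) \<partial>lborel \<partial>lborel)"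
    by (rule lborel.nn_integral_fst[symmetric]) (simp add: lborel_prod)
  also have "\<dots> = (\<integral>\<^sup>+a. \<integral>\<^sup>+x. ennreal \<bar>a\<bar> * f (a, a * x) \<partial>lborel \<partial>lborel)"
  proof (rule nn_integral_cong_AE)
    show "AE a in lborel. (\<integral>\<^sup>+b. f (a, b) \<partial>lborel) = (\<integral>\<^sup>+x. ennreal \<bar>a\<bar> * f (a, a * x) \<partial>lborel)"
      using AE_lborel_singleton[of 0]
    proof eventually_elim
      case (elim a)
      then show ?case
        by (subst nn_integral_real_affine[where c = a and t = 0]) (auto simp: nn_integral_cmult)
    qed
  qed
  also have "\<dots> = (\<integral>\<^sup>+x. \<integral>\<^sup>+a. ennreal \<bar>a\<bar> * f (a, a * x) \<partial>lborel \<partial>lborel)"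
    by (rule lborel_pair.Fubini') measurable
  finally show ?thesis .
qed

text \<open>\<open>ennreal\<close> sends negative reals to 0, so this integrates the positive part
  of the parabola, which lives on \<open>\<bar>a\<bar> \<le> R\<close> and contributes
  \<open>R ^ 3 / 6\<close> on each side.\<close>

lemma nn_integral_parabola:
  assumes "R > 0"
  shows "(\<integral>\<^sup>+a. ennreal (R * \<bar>a\<bar> - a\<^sup>2) \<partial>lborel) = ennreal (R ^ 3 / 3)"
proof -
  have 1: "(\<integral>\<^sup>+a. ennreal (R * a - a\<^sup>2) * indicator {0..R} a \<partial>lborel) = ennreal (R ^ 3 / 6)"
  proof -
    have "(\<integral>\<^sup>+a. ennreal (R * a - a\<^sup>2) * indicator {0..R} a \<partial>lborel)
        = ennreal ((R * R\<^sup>2 / 2 - R ^ 3 / 3) - (R * 0\<^sup>2 / 2 - 0 ^ 3 / 3))"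
      using assms
      by (intro nn_integral_FTC_Icc)
        (auto intro!: derivative_eq_intros simp: power2_eq_square mult_right_mono)
    then show ?thesis by (simp add: power3_eq_cube power2_eq_square field_simps)
  qed
  have 2: "(\<integral>\<^sup>+a. ennreal (R * \<bar>a\<bar> - a\<^sup>2) * indicator {..<0} a \<partial>lborel)
      = (\<integral>\<^sup>+a. ennreal (R * a - a\<^sup>2) * indicator {0..R} a \<partial>lborel)"
  proof -
    have "(\<integral>\<^sup>+a. ennreal (R * \<bar>a\<bar> - a\<^sup>2) * indicator {..<0} a \<partial>lborel)
      = (\<integral>\<^sup>+a. ennreal (R * \<bar>a\<bar> - a\<^sup>2) * indicator {..<0} (- a) \<partial>lborel)"
      by (subst nn_integral_real_affine[where c = "-1" and t = 0]) auto
    also have "\<dots> = (\<integral>\<^sup>+a. ennreal (R * a - a\<^sup>2) * indicator {0..R} a \<partial>lborel)"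
    proof (rule nn_integral_cong)
      fix a :: real
      have "R * a - a\<^sup>2 \<le> 0" if "a > R"
        using that assms by (simp add: power2_eq_square mult_right_mono)
      then show "ennreal (R * \<bar>a\<bar> - a\<^sup>2) * indicator {..<0} (- a) = ennreal (R * a - a\<^sup>2) * indicator {0..R} a"
        by (cases "a = 0") (auto simp: indicator_def ennreal_neg)
    qed
    finally show ?thesis .
  qed
  have 3: "(\<integral>\<^sup>+a. ennreal (R * \<bar>a\<bar> - a\<^sup>2) * indicator {0..} a \<partial>lborel)
      = (\<integral>\<^sup>+a. ennreal (R * a - a\<^sup>2) * indicator {0..R} a \<partial>lborel)"
  proof (rule nn_integral_cong)
    fix a :: real
    have "R * a - a\<^sup>2 \<le> 0" if "a > R"
      using that assms by (simp add: power2_eq_square mult_right_mono)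
    then show "ennreal (R * \<bar>a\<bar> - a\<^sup>2) * indicator {0..} a = ennreal (R * a - a\<^sup>2) * indicator {0..R} a"
      by (auto simp: indicator_def ennreal_neg)
  qed
  have "(\<integral>\<^sup>+a. ennreal (R * \<bar>a\<bar> - a\<^sup>2) \<partial>lborel)
    = (\<integral>\<^sup>+a. ennreal (R * \<bar>a\<bar> - a\<^sup>2) * indicator {..<0} a + ennreal (R * \<bar>a\<bar> - a\<^sup>2) * indicator {0..} a \<partial>lborel)"
    by (intro nn_integral_cong) (auto simp: indicator_def)
  also have "\<dots> = ennreal (R ^ 3 / 6) + ennreal (R ^ 3 / 6)"
    by (subst nn_integral_add) (auto simp: 1 2 3)
  also have "\<dots> = ennreal (R ^ 3 / 3)"
    using assms by (simp flip: ennreal_plus)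
  finally show ?thesis .
qed

lemma busemann_planar:
  fixes g :: "real \<times> real \<Rightarrow> ennreal"
  assumes [measurable]: "g \<in> borel_measurable borel" and g1: "\<And>u. g u \<le> 1"
    and fin: "(\<integral>\<^sup>+u. g u * ennreal \<bar>fst u\<bar> \<partial>lborel) < \<infinity>"
  shows "ennreal (8 / (9 * pi\<^sup>2)) * (\<integral>\<^sup>+u. g u \<partial>lborel) ^ 3
    \<le> (\<integral>\<^sup>+u. \<integral>\<^sup>+v. g u * g v * ennreal \<bar>det2 u v\<bar> \<partial>lborel \<partial>lborel)"
proof -
  define h where "h x = (\<integral>\<^sup>+a. ennreal (a\<^sup>2) * g (a, a * x) \<partial>lborel)" for x
  define k where "k x = (\<integral>\<^sup>+a. ennreal \<bar>a\<bar> * g (a, a * x) \<partial>lborel)" for x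
  have [measurable]: "h \<in> borel_measurable borel" "k \<in> borel_measurable borel"
    unfolding h_def k_def by measurable
  have k: "(\<integral>\<^sup>+u. g u \<partial>lborel) = (\<integral>\<^sup>+x. k x \<partial>lborel)"
    by (simp add: nn_integral_slope k_def)
  \<comment> \<open>The first-moment hypothesis is the finiteness of the total mass of
    \<open>h\<close>: the weight \<open>\<bar>fst u\<bar>\<close> raises the Jacobian
    \<open>\<bar>a\<bar>\<close> to \<open>a\<^sup>2\<close>.\<close>
  have "(\<integral>\<^sup>+x. h x \<partial>lborel) = (\<integral>\<^sup>+u. g u * ennreal \<bar>fst u\<bar> \<partial>lborel)"
  proof -
    have "ennreal (a\<^sup>2) = ennreal \<bar>a\<bar> * ennreal \<bar>a\<bar>" for a
      by (simp add: power2_eq_square flip: ennreal_mult)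
    then show ?thesis
      by (subst nn_integral_slope) (auto simp: h_def mult_ac intro!: nn_integral_cong)
  qed
  with fin have hfin: "(\<integral>\<^sup>+x. h x \<partial>lborel) < \<infinity>" by simp
  \<comment> \<open>Bathtub principle: \<open>R * k x - h x\<close> is the integral of
    \<open>R * \<bar>a\<bar> - a\<^sup>2\<close> against a weight between 0 and 1, and is largest
    when the weight is 1 exactly where that factor is positive.\<close>
  have hk: "ennreal R * k x \<le> h x + ennreal (R ^ 3 / 3)" if "R > 0" for x R
  proof -
    have pt: "ennreal R * (ennreal \<bar>a\<bar> * g (a, a * x))
        \<le> ennreal (a\<^sup>2) * g (a, a * x) + ennreal (R * \<bar>a\<bar> - a\<^sup>2)" for a
    proof -
      obtain r where r: "g (a, a * x) = ennreal r" "0 \<le> r" "r \<le> 1"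
        using g1[of "(a, a * x)"] by (cases "g (a, a * x)") (auto simp: top_unique)
      have "(R * \<bar>a\<bar> - a\<^sup>2) * r \<le> max 0 (R * \<bar>a\<bar> - a\<^sup>2)"
        using r by (auto simp: max_def intro: mult_left_le mult_nonpos_nonneg)
      then have "R * (\<bar>a\<bar> * r) \<le> a\<^sup>2 * r + max 0 (R * \<bar>a\<bar> - a\<^sup>2)"
        by (simp add: algebra_simps)
      then have "ennreal (R * (\<bar>a\<bar> * r)) \<le> ennreal (a\<^sup>2 * r + max 0 (R * \<bar>a\<bar> - a\<^sup>2))"
        by (rule ennreal_leI)
      also have "\<dots> = ennreal (a\<^sup>2 * r) + ennreal (R * \<bar>a\<bar> - a\<^sup>2)"
        using r by (subst ennreal_plus) (auto simp: ennreal_max_0)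
      finally show ?thesis
        using r that by (simp add: ennreal_mult)
    qed
    have "ennreal R * k x = (\<integral>\<^sup>+a. ennreal R * (ennreal \<bar>a\<bar> * g (a, a * x)) \<partial>lborel)"
      by (simp add: k_def nn_integral_cmult)
    also have "\<dots> \<le> (\<integral>\<^sup>+a. ennreal (a\<^sup>2) * g (a, a * x) + ennreal (R * \<bar>a\<bar> - a\<^sup>2) \<partial>lborel)"
      by (intro nn_integral_mono pt)
    also have "\<dots> = h x + ennreal (R ^ 3 / 3)"
      by (subst nn_integral_add) (auto simp: h_def nn_integral_parabola[OF that])
    finally show ?thesis .
  qed
  have "(\<integral>\<^sup>+u. \<integral>\<^sup>+v. g u * g v * ennreal \<bar>det2 u v\<bar> \<partial>lborel \<partial>lborel)
      = (\<integral>\<^sup>+x. \<integral>\<^sup>+a. ennreal \<bar>a\<bar> * (\<integral>\<^sup>+y. \<integral>\<^sup>+b. ennreal \<bar>b\<bar> *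
          (g (a, a * x) * g (b, b * y) * ennreal \<bar>det2 (a, a * x) (b, b * y)\<bar>) \<partial>lborel \<partial>lborel) \<partial>lborel \<partial>lborel)"
    by (subst nn_integral_slope, measurable) (subst nn_integral_slope, auto)
  also have "\<dots> = (\<integral>\<^sup>+x. \<integral>\<^sup>+a. \<integral>\<^sup>+y. (ennreal (a\<^sup>2) * g (a, a * x)) * (h y * ennreal \<bar>x - y\<bar>) \<partial>lborel \<partial>lborel \<partial>lborel)"
  proof (intro nn_integral_cong)
    fix x a :: real
    have pt: "ennreal \<bar>a\<bar> * (ennreal \<bar>b\<bar> * (g (a, a * x) * g (b, b * y) * ennreal \<bar>det2 (a, a * x) (b, b * y)\<bar>))
       = (ennreal (a\<^sup>2) * g (a, a * x) * ennreal \<bar>x - y\<bar>) * (ennreal (b\<^sup>2) * g (b, b * y))" for y b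
    proof -
      \<comment> \<open>One factor \<open>\<bar>a\<bar> * \<bar>b\<bar>\<close> is the Jacobian of
        the slope coordinates, a second one comes out of the determinant; together they form the
        squares in \<open>h\<close>.\<close>
      have "\<bar>a\<bar> * (\<bar>b\<bar> * \<bar>det2 (a, a * x) (b, b * y)\<bar>) = a\<^sup>2 * \<bar>x - y\<bar> * b\<^sup>2"
      proof -
        have "det2 (a, a * x) (b, b * y) = a * b * (y - x)"
          by (simp add: det2_def algebra_simps)
        then have "\<bar>a\<bar> * (\<bar>b\<bar> * \<bar>det2 (a, a * x) (b, b * y)\<bar>) = \<bar>a\<bar> * (\<bar>b\<bar> * (\<bar>a\<bar> * \<bar>b\<bar> * \<bar>y - x\<bar>))"
          by (simp only: abs_mult)
        also have "\<dots> = (\<bar>a\<bar> * \<bar>a\<bar>) * \<bar>x - y\<bar> * (\<bar>b\<bar> * \<bar>b\<bar>)"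
          by (simp only: abs_minus_commute mult_ac)
        finally show ?thesis
          by (simp add: power2_eq_square)
      qed
      then have "ennreal \<bar>a\<bar> * (ennreal \<bar>b\<bar> * ennreal \<bar>det2 (a, a * x) (b, b * y)\<bar>) = ennreal (a\<^sup>2) * ennreal \<bar>x - y\<bar> * ennreal (b\<^sup>2)"
        by (simp flip: ennreal_mult)
      moreover have "ennreal \<bar>a\<bar> * (ennreal \<bar>b\<bar> * (g (a, a * x) * g (b, b * y) * ennreal \<bar>det2 (a, a * x) (b, b * y)\<bar>))
          = ennreal \<bar>a\<bar> * (ennreal \<bar>b\<bar> * ennreal \<bar>det2 (a, a * x) (b, b * y)\<bar>) * (g (a, a * x) * g (b, b * y))"
        by (simp only: mult_ac)
      ultimately show ?thesis
        by (simp only: mult_ac)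
    qed
    have "ennreal \<bar>a\<bar> * (\<integral>\<^sup>+y. \<integral>\<^sup>+b. ennreal \<bar>b\<bar> *
          (g (a, a * x) * g (b, b * y) * ennreal \<bar>det2 (a, a * x) (b, b * y)\<bar>) \<partial>lborel \<partial>lborel)
        = (\<integral>\<^sup>+y. \<integral>\<^sup>+b. ennreal \<bar>a\<bar> * (ennreal \<bar>b\<bar> *
          (g (a, a * x) * g (b, b * y) * ennreal \<bar>det2 (a, a * x) (b, b * y)\<bar>)) \<partial>lborel \<partial>lborel)"
      by (simp add: nn_integral_cmult)
    also have "\<dots> = (\<integral>\<^sup>+y. (ennreal (a\<^sup>2) * g (a, a * x) * ennreal \<bar>x - y\<bar>) * h y \<partial>lborel)"
      unfolding pt h_def by (intro nn_integral_cong nn_integral_cmult) measurable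
    also have "\<dots> = (\<integral>\<^sup>+y. (ennreal (a\<^sup>2) * g (a, a * x)) * (h y * ennreal \<bar>x - y\<bar>) \<partial>lborel)"
      by (simp only: mult_ac)
    finally show "ennreal \<bar>a\<bar> * (\<integral>\<^sup>+y. \<integral>\<^sup>+b. ennreal \<bar>b\<bar> *
          (g (a, a * x) * g (b, b * y) * ennreal \<bar>det2 (a, a * x) (b, b * y)\<bar>) \<partial>lborel \<partial>lborel)
        = (\<integral>\<^sup>+y. (ennreal (a\<^sup>2) * g (a, a * x)) * (h y * ennreal \<bar>x - y\<bar>) \<partial>lborel)" .
  qed
  also have "\<dots> = (\<integral>\<^sup>+x. \<integral>\<^sup>+y. h x * h y * ennreal \<bar>x - y\<bar> \<partial>lborel \<partial>lborel)"
  proof (rule nn_integral_cong)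
    fix x :: real
    have "(\<integral>\<^sup>+a. \<integral>\<^sup>+y. (ennreal (a\<^sup>2) * g (a, a * x)) * (h y * ennreal \<bar>x - y\<bar>) \<partial>lborel \<partial>lborel)
       = h x * (\<integral>\<^sup>+y. h y * ennreal \<bar>x - y\<bar> \<partial>lborel)"
      by (simp add: nn_integral_cmult nn_integral_multc h_def)
    also have "\<dots> = (\<integral>\<^sup>+y. h x * h y * ennreal \<bar>x - y\<bar> \<partial>lborel)"
      by (simp add: nn_integral_cmult[symmetric] mult_ac)
    finally show "(\<integral>\<^sup>+a. \<integral>\<^sup>+y. (ennreal (a\<^sup>2) * g (a, a * x)) * (h y * ennreal \<bar>x - y\<bar>) \<partial>lborel \<partial>lborel)
       = (\<integral>\<^sup>+y. h x * h y * ennreal \<bar>x - y\<bar> \<partial>lborel)" .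
  qed
  finally show ?thesis
    using reverse_HLS_line[of h k] hk hfin by (simp add: k)
qed

section \<open>The crossing energy of a density on pairs of points\<close>

lemma nn_integral_translate:
  fixes f :: "real \<times> real \<Rightarrow> ennreal"
  assumes [measurable]: "f \<in> borel_measurable borel"
  shows "(\<integral>\<^sup>+x. f (c + x) \<partial>lborel) = (\<integral>\<^sup>+x. f x \<partial>lborel)"
proof -
  have "(\<integral>\<^sup>+x. f x \<partial>lborel) = (\<integral>\<^sup>+x. f x \<partial>distr lborel borel ((+) c))"
    by (simp add: lborel_distr_plus)
  also have "\<dots> = (\<integral>\<^sup>+x. f (c + x) \<partial>lborel)"
    by (subst nn_integral_distr) auto
  finally show ?thesis ..
qed

text \<open>Two one-dimensional substitutions: the second coordinate becomes
  \<open>p * b / a + k * t\<close> with \<open>k = det2 u v / a\<close>, then the first becomes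
  \<open>t * c + a * s\<close>. The Jacobians \<open>\<bar>k\<bar>\<close> and
  \<open>\<bar>a\<bar>\<close> multiply to the determinant, and \<open>fst u \<noteq> 0\<close>
  allows the division by \<open>a\<close>.\<close>

lemma nn_integral_linear_aux:
  fixes f :: "real \<times> real \<Rightarrow> ennreal"
  assumes [measurable]: "f \<in> borel_measurable borel" and det: "det2 u v \<noteq> 0" and u: "fst u \<noteq> 0"
  shows "(\<integral>\<^sup>+q. f q \<partial>lborel) = ennreal \<bar>det2 u v\<bar> * (\<integral>\<^sup>+s. \<integral>\<^sup>+t. f (s *\<^sub>R u + t *\<^sub>R v) \<partial>lborel \<partial>lborel)"
proof -
  obtain a b where ab: "u = (a, b)" by (cases u)
  obtain c d where cd: "v = (c, d)" by (cases v)
  have "a \<noteq> 0" using u ab by simp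
  define k where "k = d - c * b / a"
  have k: "k \<noteq> 0" "\<bar>k\<bar> * \<bar>a\<bar> = \<bar>det2 u v\<bar>"
    using det \<open>a \<noteq> 0\<close> by (auto simp: k_def ab cd det2_def abs_mult[symmetric] field_simps)
  have "(\<integral>\<^sup>+q. f q \<partial>lborel) = (\<integral>\<^sup>+q. f q \<partial>(lborel \<Otimes>\<^sub>M lborel))"
    by (simp add: lborel_prod)
  also have "\<dots> = (\<integral>\<^sup>+p. \<integral>\<^sup>+q. f (p, q) \<partial>lborel \<partial>lborel)"
    by (rule lborel.nn_integral_fst[symmetric]) (simp add: lborel_prod)
  also have "\<dots> = (\<integral>\<^sup>+p. ennreal \<bar>k\<bar> * (\<integral>\<^sup>+t. f (p, p * b / a + k * t) \<partial>lborel) \<partial>lborel)"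
    using k by (intro nn_integral_cong nn_integral_real_affine) auto
  also have "\<dots> = ennreal \<bar>k\<bar> * (\<integral>\<^sup>+p. \<integral>\<^sup>+t. f (p, p * b / a + k * t) \<partial>lborel \<partial>lborel)"
    by (simp add: nn_integral_cmult)
  also have "(\<integral>\<^sup>+p. \<integral>\<^sup>+t. f (p, p * b / a + k * t) \<partial>lborel \<partial>lborel)
      = (\<integral>\<^sup>+t. \<integral>\<^sup>+p. f (p, p * b / a + k * t) \<partial>lborel \<partial>lborel)"
    by (rule lborel_pair.Fubini') measurable
  also have "\<dots> = (\<integral>\<^sup>+t. ennreal \<bar>a\<bar> * (\<integral>\<^sup>+s. f (t * c + a * s, (t * c + a * s) * b / a + k * t) \<partial>lborel) \<partial>lborel)"
    using \<open>a \<noteq> 0\<close> by (intro nn_integral_cong nn_integral_real_affine) auto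
  also have "\<dots> = ennreal \<bar>a\<bar> * (\<integral>\<^sup>+t. \<integral>\<^sup>+s. f (t * c + a * s, (t * c + a * s) * b / a + k * t) \<partial>lborel \<partial>lborel)"
    by (simp add: nn_integral_cmult)
  also have "(\<integral>\<^sup>+t. \<integral>\<^sup>+s. f (t * c + a * s, (t * c + a * s) * b / a + k * t) \<partial>lborel \<partial>lborel)
      = (\<integral>\<^sup>+t. \<integral>\<^sup>+s. f (s *\<^sub>R u + t *\<^sub>R v) \<partial>lborel \<partial>lborel)"
    using \<open>a \<noteq> 0\<close>
    by (intro nn_integral_cong arg_cong[where f = f]) (auto simp: ab cd k_def field_simps)
  also have "\<dots> = (\<integral>\<^sup>+s. \<integral>\<^sup>+t. f (s *\<^sub>R u + t *\<^sub>R v) \<partial>lborel \<partial>lborel)"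
    by (rule lborel_pair.Fubini') measurable
  finally show ?thesis
    by (simp add: k(2)[symmetric] ennreal_mult mult.assoc)
qed

lemma nn_integral_linear:
  fixes f :: "real \<times> real \<Rightarrow> ennreal"
  assumes [measurable]: "f \<in> borel_measurable borel" and det: "det2 u v \<noteq> 0"
  shows "(\<integral>\<^sup>+q. f q \<partial>lborel) = ennreal \<bar>det2 u v\<bar> * (\<integral>\<^sup>+s. \<integral>\<^sup>+t. f (s *\<^sub>R u + t *\<^sub>R v) \<partial>lborel \<partial>lborel)"
proof (cases "fst u = 0")
  case False
  then show ?thesis using nn_integral_linear_aux assms by blast
next
  case True
  \<comment> \<open>A nonzero determinant leaves one of the two vectors usable, so the roles of
    \<open>u\<close> and \<open>v\<close> are exchanged.\<close>
  then have "fst v \<noteq> 0" and "det2 v u \<noteq> 0" and abs: "\<bar>det2 v u\<bar> = \<bar>det2 u v\<bar>"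
    using det by (auto simp: det2_def abs_minus_commute mult.commute)
  then have "(\<integral>\<^sup>+q. f q \<partial>lborel) = ennreal \<bar>det2 v u\<bar> * (\<integral>\<^sup>+t. \<integral>\<^sup>+s. f (t *\<^sub>R v + s *\<^sub>R u) \<partial>lborel \<partial>lborel)"
    by (intro nn_integral_linear_aux) auto
  also have "(\<integral>\<^sup>+t. \<integral>\<^sup>+s. f (t *\<^sub>R v + s *\<^sub>R u) \<partial>lborel \<partial>lborel)
      = (\<integral>\<^sup>+s. \<integral>\<^sup>+t. f (t *\<^sub>R v + s *\<^sub>R u) \<partial>lborel \<partial>lborel)"
    by (rule lborel_pair.Fubini') measurable
  finally show ?thesis
    by (simp add: abs add.commute)
qed

text \<open>Cramer's rule: \<open>x + s u = y + t v\<close> is solved by \<open>s = det2 (y - x) v / det2 u v\<close> and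
  \<open>t = det2 (y - x) u / det2 u v\<close>.\<close>

definition seg_cross :: "real \<times> real \<Rightarrow> real \<times> real \<Rightarrow> real \<times> real \<Rightarrow> real \<times> real \<Rightarrow> bool" where
  "seg_cross x u y v \<longleftrightarrow> det2 u v \<noteq> 0 \<and>
     0 \<le> det2 (y - x) v / det2 u v \<and> det2 (y - x) v / det2 u v \<le> 1 \<and>
     0 \<le> det2 (y - x) u / det2 u v \<and> det2 (y - x) u / det2 u v \<le> 1"

lemma measurable_seg_cross [measurable (raw)]:
  assumes [measurable]: "a \<in> borel_measurable M" "b \<in> borel_measurable M"
    "c \<in> borel_measurable M" "d \<in> borel_measurable M"
  shows "Measurable.pred M (\<lambda>x. seg_cross (a x) (b x) (c x) (d x))"
  unfolding seg_cross_def by measurable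

lemma seg_cross_param:
  assumes "det2 u v \<noteq> 0"
  shows "seg_cross x u (x + (s *\<^sub>R u - t *\<^sub>R v)) v \<longleftrightarrow> s \<in> {0..1} \<and> t \<in> {0..1}"
proof -
  have "det2 (s *\<^sub>R u - t *\<^sub>R v) v = s * det2 u v" "det2 (s *\<^sub>R u - t *\<^sub>R v) u = t * det2 u v"
    by (simp_all add: det2_def algebra_simps)
  then show ?thesis
    using assms by (simp add: seg_cross_def)
qed

lemma crossing_fixed_directions:
  fixes F G :: "real \<times> real \<Rightarrow> ennreal"
  assumes [measurable]: "F \<in> borel_measurable borel" "G \<in> borel_measurable borel"
    and det: "det2 u v \<noteq> 0"
  shows "(\<integral>\<^sup>+x. \<integral>\<^sup>+y. F x * G y * (if seg_cross x u y v then 1 else 0) \<partial>lborel \<partial>lborel)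
    = ennreal \<bar>det2 u v\<bar> * (\<integral>\<^sup>+z. (\<integral>\<^sup>+s. indicator {0..1} s * F (z - s *\<^sub>R u) \<partial>lborel) *
        (\<integral>\<^sup>+t. indicator {0..1} t * G (z - t *\<^sub>R v) \<partial>lborel) \<partial>lborel)"
proof -
  define I where "I = (indicator {0..1} :: real \<Rightarrow> ennreal)"
  have [measurable]: "I \<in> borel_measurable borel"
    by (simp add: I_def)
  have inner: "(\<integral>\<^sup>+y. G y * (if seg_cross x u y v then 1 else 0) \<partial>lborel)
      = ennreal \<bar>det2 u v\<bar> * (\<integral>\<^sup>+s. \<integral>\<^sup>+t. I s * I t * G (x + (s *\<^sub>R u - t *\<^sub>R v)) \<partial>lborel \<partial>lborel)" for x
  proof -
    have det': "det2 u (- v) \<noteq> 0" "\<bar>det2 u (- v)\<bar> = \<bar>det2 u v\<bar>"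
      using det by (auto simp: det2_def abs_minus_commute)
    have "(\<integral>\<^sup>+y. G y * (if seg_cross x u y v then 1 else 0) \<partial>lborel)
        = (\<integral>\<^sup>+q. G (x + q) * (if seg_cross x u (x + q) v then 1 else 0) \<partial>lborel)"
      by (rule nn_integral_translate[symmetric]) measurable
    also have "\<dots> = ennreal \<bar>det2 u (- v)\<bar> * (\<integral>\<^sup>+s. \<integral>\<^sup>+t. G (x + (s *\<^sub>R u + t *\<^sub>R - v)) *
        (if seg_cross x u (x + (s *\<^sub>R u + t *\<^sub>R - v)) v then 1 else 0) \<partial>lborel \<partial>lborel)"
      by (rule nn_integral_linear) (use det' in measurable)
    also have "\<dots> = ennreal \<bar>det2 u v\<bar> * (\<integral>\<^sup>+s. \<integral>\<^sup>+t. I s * I t * G (x + (s *\<^sub>R u - t *\<^sub>R v)) \<partial>lborel \<partial>lborel)"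
      unfolding det'(2)
      by (intro arg_cong[where f = "\<lambda>r. ennreal \<bar>det2 u v\<bar> * r"] nn_integral_cong)
        (auto simp: seg_cross_param[OF det] I_def indicator_def)
    finally show ?thesis .
  qed
  have "(\<integral>\<^sup>+x. \<integral>\<^sup>+y. F x * G y * (if seg_cross x u y v then 1 else 0) \<partial>lborel \<partial>lborel)
    = (\<integral>\<^sup>+x. F x * (ennreal \<bar>det2 u v\<bar> * (\<integral>\<^sup>+s. \<integral>\<^sup>+t. I s * I t * G (x + (s *\<^sub>R u - t *\<^sub>R v)) \<partial>lborel \<partial>lborel)) \<partial>lborel)"
    unfolding inner[symmetric] by (simp add: mult.assoc nn_integral_cmult)
  also have "\<dots> = ennreal \<bar>det2 u v\<bar> * (\<integral>\<^sup>+x. F x * (\<integral>\<^sup>+s. \<integral>\<^sup>+t. I s * I t * G (x + (s *\<^sub>R u - t *\<^sub>R v)) \<partial>lborel \<partial>lborel) \<partial>lborel)"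
    by (simp add: nn_integral_cmult[symmetric] mult.left_commute)
  also have "(\<integral>\<^sup>+x. F x * (\<integral>\<^sup>+s. \<integral>\<^sup>+t. I s * I t * G (x + (s *\<^sub>R u - t *\<^sub>R v)) \<partial>lborel \<partial>lborel) \<partial>lborel)
     = (\<integral>\<^sup>+x. \<integral>\<^sup>+s. \<integral>\<^sup>+t. F x * (I s * I t * G (x + (s *\<^sub>R u - t *\<^sub>R v))) \<partial>lborel \<partial>lborel \<partial>lborel)"
    by (simp add: nn_integral_cmult)
  also have "\<dots> = (\<integral>\<^sup>+s. \<integral>\<^sup>+x. \<integral>\<^sup>+t. F x * (I s * I t * G (x + (s *\<^sub>R u - t *\<^sub>R v))) \<partial>lborel \<partial>lborel \<partial>lborel)"
    by (rule lborel_pair.Fubini') measurable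
  also have "\<dots> = (\<integral>\<^sup>+s. \<integral>\<^sup>+t. \<integral>\<^sup>+x. F x * (I s * I t * G (x + (s *\<^sub>R u - t *\<^sub>R v))) \<partial>lborel \<partial>lborel \<partial>lborel)"
    by (intro nn_integral_cong lborel_pair.Fubini') measurable
  \<comment> \<open>After recentring at the meeting point \<open>z = x + s u = y + t v\<close>, the
    factor with \<open>F\<close> involves only \<open>s\<close> and the one with \<open>G\<close>
    only \<open>t\<close>, so the integral over the parameters splits.\<close>
  also have "\<dots> = (\<integral>\<^sup>+s. \<integral>\<^sup>+t. \<integral>\<^sup>+z. (I s * F (z - s *\<^sub>R u)) * (I t * G (z - t *\<^sub>R v)) \<partial>lborel \<partial>lborel \<partial>lborel)"
  proof (rule nn_integral_cong, rule nn_integral_cong)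
    fix s t :: real
    have "(\<integral>\<^sup>+z. (I s * F (z - s *\<^sub>R u)) * (I t * G (z - t *\<^sub>R v)) \<partial>lborel)
       = (\<integral>\<^sup>+x. (I s * F (s *\<^sub>R u + x - s *\<^sub>R u)) * (I t * G (s *\<^sub>R u + x - t *\<^sub>R v)) \<partial>lborel)"
      by (rule nn_integral_translate[symmetric]) measurable
    also have "\<dots> = (\<integral>\<^sup>+x. F x * (I s * I t * G (x + (s *\<^sub>R u - t *\<^sub>R v))) \<partial>lborel)"
      by (intro nn_integral_cong) (simp add: mult_ac add.commute add_diff_eq)
    finally show "(\<integral>\<^sup>+x. F x * (I s * I t * G (x + (s *\<^sub>R u - t *\<^sub>R v))) \<partial>lborel)
      = (\<integral>\<^sup>+z. (I s * F (z - s *\<^sub>R u)) * (I t * G (z - t *\<^sub>R v)) \<partial>lborel)" ..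
  qed
  also have "\<dots> = (\<integral>\<^sup>+s. \<integral>\<^sup>+z. \<integral>\<^sup>+t. (I s * F (z - s *\<^sub>R u)) * (I t * G (z - t *\<^sub>R v)) \<partial>lborel \<partial>lborel \<partial>lborel)"
    by (intro nn_integral_cong lborel_pair.Fubini') measurable
  also have "\<dots> = (\<integral>\<^sup>+z. \<integral>\<^sup>+s. \<integral>\<^sup>+t. (I s * F (z - s *\<^sub>R u)) * (I t * G (z - t *\<^sub>R v)) \<partial>lborel \<partial>lborel \<partial>lborel)"
    by (rule lborel_pair.Fubini') measurable
  also have "\<dots> = (\<integral>\<^sup>+z. (\<integral>\<^sup>+s. I s * F (z - s *\<^sub>R u) \<partial>lborel) * (\<integral>\<^sup>+t. I t * G (z - t *\<^sub>R v) \<partial>lborel) \<partial>lborel)"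
    by (simp add: nn_integral_cmult nn_integral_multc)
  finally show ?thesis
    unfolding I_def .
qed


text \<open>The cube lies above its tangent at \<open>t\<close>: the difference is the nonnegative
  product \<open>(m - t)^2 (m + 2 t)\<close>.\<close>

lemma power3_tangent:
  fixes m :: ennreal and t :: real
  assumes "t \<ge> 0"
  shows "ennreal (3 * t\<^sup>2) * m \<le> m ^ 3 + ennreal (2 * t ^ 3)"
proof (cases m)
  case (real r)
  have "0 \<le> (r - t)\<^sup>2 * (r + 2 * t)"
    using real assms by (intro mult_nonneg_nonneg) auto
  then have "3 * t\<^sup>2 * r \<le> r ^ 3 + 2 * t ^ 3"
    by (simp add: power2_eq_square power3_eq_cube algebra_simps)
  then have "ennreal (3 * t\<^sup>2 * r) \<le> ennreal (r ^ 3 + 2 * t ^ 3)"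
    by (rule ennreal_leI)
  then show ?thesis
    using real assms by (simp add: ennreal_mult ennreal_power)
qed simp

lemma jensen_cube:
  fixes m :: "'a \<Rightarrow> ennreal"
  assumes [measurable]: "m \<in> borel_measurable M" "K \<in> sets M"
    and K: "emeasure M K = ennreal A" "A > 0"
    and supp: "\<And>z. z \<notin> K \<Longrightarrow> m z = 0" and fin: "(\<integral>\<^sup>+z. m z \<partial>M) < \<infinity>"
  shows "(\<integral>\<^sup>+z. m z \<partial>M) ^ 3 \<le> ennreal (A\<^sup>2) * (\<integral>\<^sup>+z. m z ^ 3 \<partial>M)"
proof (cases "\<integral>\<^sup>+z. m z ^ 3 \<partial>M")
  case (real r)
  obtain i where i: "(\<integral>\<^sup>+z. m z \<partial>M) = ennreal i" "i \<ge> 0"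
    using fin by (cases "\<integral>\<^sup>+z. m z \<partial>M") auto
  \<comment> \<open>The mean of \<open>m\<close> over \<open>K\<close>; integrating the tangent
    inequality at the mean is Jensen's inequality. The constant term is charged on \<open>K\<close>
    only, since \<open>m\<close> vanishes elsewhere.\<close>
  define t where "t = i / A"
  have t: "t \<ge> 0" using i K by (simp add: t_def)
  have "ennreal (3 * t\<^sup>2) * (\<integral>\<^sup>+z. m z \<partial>M) = (\<integral>\<^sup>+z. ennreal (3 * t\<^sup>2) * m z \<partial>M)"
    by (simp add: nn_integral_cmult)
  also have "\<dots> \<le> (\<integral>\<^sup>+z. m z ^ 3 + ennreal (2 * t ^ 3) * indicator K z \<partial>M)"
  proof (rule nn_integral_mono)
    fix z
    show "ennreal (3 * t\<^sup>2) * m z \<le> m z ^ 3 + ennreal (2 * t ^ 3) * indicator K z"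
      using power3_tangent[OF t, of "m z"] supp[of z] by (cases "z \<in> K") auto
  qed
  also have "\<dots> = ennreal r + ennreal (2 * t ^ 3) * ennreal A"
    using K by (simp add: nn_integral_add nn_integral_cmult_indicator real)
  finally have "3 * t\<^sup>2 * i \<le> r + 2 * t ^ 3 * A"
    using i t K real by (simp add: ennreal_mult[symmetric] ennreal_plus[symmetric] ennreal_le_iff del: ennreal_plus)
  moreover have "3 * t\<^sup>2 * i = 3 * (i ^ 3 / A\<^sup>2)" "2 * t ^ 3 * A = 2 * (i ^ 3 / A\<^sup>2)"
    using K by (auto simp: t_def field_simps power2_eq_square power3_eq_cube)
  ultimately have "i ^ 3 / A\<^sup>2 \<le> r"
    by linarith
  then have "i ^ 3 \<le> A\<^sup>2 * r"
    using K by (simp add: field_simps)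
  then show ?thesis
    using i real by (simp add: ennreal_mult[symmetric] ennreal_power ennreal_le_iff)
next
  case top
  then show ?thesis using K by (simp add: ennreal_mult_top)
qed

definition crossing_energy :: "(real \<times> real \<Rightarrow> real \<times> real \<Rightarrow> ennreal) \<Rightarrow> ennreal" where
  "crossing_energy w = (\<integral>\<^sup>+x. \<integral>\<^sup>+x'. \<integral>\<^sup>+y. \<integral>\<^sup>+y'. w x x' * w y y' *
     (if seg_cross x (x' - x) y (y' - y) then 1 else 0) \<partial>lborel \<partial>lborel \<partial>lborel \<partial>lborel)"

text \<open>The mass of the segments with displacement \<open>u\<close> that pass through \<open>z\<close>; the variable
  \<open>s\<close> is the position of \<open>z\<close> on the segment.\<close>

definition through :: "(real \<times> real \<Rightarrow> real \<times> real \<Rightarrow> ennreal) \<Rightarrow> real \<times> real \<Rightarrow> real \<times> real \<Rightarrow> ennreal" where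
  "through w z u = (\<integral>\<^sup>+s. indicator {0..1} s * w (z - s *\<^sub>R u) (z - s *\<^sub>R u + u) \<partial>lborel)"

context
  fixes w :: "real \<times> real \<Rightarrow> real \<times> real \<Rightarrow> ennreal"
  assumes w_meas [measurable]: "case_prod w \<in> borel_measurable (borel \<Otimes>\<^sub>M borel)"
begin

lemma measurable_through [measurable (raw)]:
  assumes [measurable]: "a \<in> borel_measurable M" "b \<in> borel_measurable M"
  shows "(\<lambda>x. through w (a x) (b x)) \<in> borel_measurable M"
  unfolding through_def by measurable

lemma crossing_energy_eq:
  "crossing_energy w = (\<integral>\<^sup>+u. \<integral>\<^sup>+v. \<integral>\<^sup>+x. \<integral>\<^sup>+y. w x (x + u) * w y (y + v) *
     (if seg_cross x u y v then 1 else 0) \<partial>lborel \<partial>lborel \<partial>lborel \<partial>lborel)"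
proof -
  define f where "f x u y v = w x (x + u) * w y (y + v) * (if seg_cross x u y v then 1 else 0)" for x u y v
  have f_meas [measurable (raw)]: "(\<lambda>i. f (a i) (b i) (c i) (d i)) \<in> borel_measurable M"
    if [measurable]: "a \<in> borel_measurable M" "b \<in> borel_measurable M"
      "c \<in> borel_measurable M" "d \<in> borel_measurable M" for a b c d and M :: "'c measure"
    unfolding f_def by measurable
  have "crossing_energy w = (\<integral>\<^sup>+x. \<integral>\<^sup>+x'. \<integral>\<^sup>+y. \<integral>\<^sup>+y'. f x (x' - x) y (y' - y) \<partial>lborel \<partial>lborel \<partial>lborel \<partial>lborel)"
    by (simp add: crossing_energy_def f_def)
  also have "\<dots> = (\<integral>\<^sup>+x. \<integral>\<^sup>+u. \<integral>\<^sup>+y. \<integral>\<^sup>+v. f x u y v \<partial>lborel \<partial>lborel \<partial>lborel \<partial>lborel)"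
  proof (rule nn_integral_cong)
    fix x
    have "(\<integral>\<^sup>+x'. \<integral>\<^sup>+y. \<integral>\<^sup>+y'. f x (x' - x) y (y' - y) \<partial>lborel \<partial>lborel \<partial>lborel)
       = (\<integral>\<^sup>+u. \<integral>\<^sup>+y. \<integral>\<^sup>+y'. f x (x + u - x) y (y' - y) \<partial>lborel \<partial>lborel \<partial>lborel)"
      by (rule nn_integral_translate[symmetric]) measurable
    also have "\<dots> = (\<integral>\<^sup>+u. \<integral>\<^sup>+y. \<integral>\<^sup>+v. f x u y v \<partial>lborel \<partial>lborel \<partial>lborel)"
    proof (rule nn_integral_cong, rule nn_integral_cong)
      fix u y
      have "(\<integral>\<^sup>+y'. f x (x + u - x) y (y' - y) \<partial>lborel) = (\<integral>\<^sup>+v. f x (x + u - x) y (y + v - y) \<partial>lborel)"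
        by (rule nn_integral_translate[symmetric]) measurable
      then show "(\<integral>\<^sup>+y'. f x (x + u - x) y (y' - y) \<partial>lborel) = (\<integral>\<^sup>+v. f x u y v \<partial>lborel)"
        by simp
    qed
    finally show "(\<integral>\<^sup>+x'. \<integral>\<^sup>+y. \<integral>\<^sup>+y'. f x (x' - x) y (y' - y) \<partial>lborel \<partial>lborel \<partial>lborel)
       = (\<integral>\<^sup>+u. \<integral>\<^sup>+y. \<integral>\<^sup>+v. f x u y v \<partial>lborel \<partial>lborel \<partial>lborel)" .
  qed
  also have "\<dots> = (\<integral>\<^sup>+u. \<integral>\<^sup>+x. \<integral>\<^sup>+y. \<integral>\<^sup>+v. f x u y v \<partial>lborel \<partial>lborel \<partial>lborel \<partial>lborel)"
    by (rule lborel_pair.Fubini') measurable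
  also have "\<dots> = (\<integral>\<^sup>+u. \<integral>\<^sup>+x. \<integral>\<^sup>+v. \<integral>\<^sup>+y. f x u y v \<partial>lborel \<partial>lborel \<partial>lborel \<partial>lborel)"
    by (intro nn_integral_cong lborel_pair.Fubini') measurable
  also have "\<dots> = (\<integral>\<^sup>+u. \<integral>\<^sup>+v. \<integral>\<^sup>+x. \<integral>\<^sup>+y. f x u y v \<partial>lborel \<partial>lborel \<partial>lborel \<partial>lborel)"
    by (intro nn_integral_cong lborel_pair.Fubini') measurable
  finally show ?thesis
    by (simp add: f_def)
qed

text \<open>For displacements with nonzero determinant the two sides agree by
  \<open>crossing_fixed_directions\<close>, applied to the slices of \<open>w\<close> along
  \<open>u\<close> and \<open>v\<close>; for parallel displacements the left side vanishes.\<close>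

lemma crossing_energy_ge:
  "(\<integral>\<^sup>+z. \<integral>\<^sup>+u. \<integral>\<^sup>+v. through w z u * through w z v * ennreal \<bar>det2 u v\<bar> \<partial>lborel \<partial>lborel \<partial>lborel)
    \<le> crossing_energy w"
proof -
  have "(\<integral>\<^sup>+z. \<integral>\<^sup>+u. \<integral>\<^sup>+v. through w z u * through w z v * ennreal \<bar>det2 u v\<bar> \<partial>lborel \<partial>lborel \<partial>lborel)
     = (\<integral>\<^sup>+u. \<integral>\<^sup>+z. \<integral>\<^sup>+v. through w z u * through w z v * ennreal \<bar>det2 u v\<bar> \<partial>lborel \<partial>lborel \<partial>lborel)"
    by (rule lborel_pair.Fubini') measurable
  also have "\<dots> = (\<integral>\<^sup>+u. \<integral>\<^sup>+v. \<integral>\<^sup>+z. through w z u * through w z v * ennreal \<bar>det2 u v\<bar> \<partial>lborel \<partial>lborel \<partial>lborel)"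
    by (intro nn_integral_cong lborel_pair.Fubini') measurable
  also have "\<dots> \<le> crossing_energy w"
    unfolding crossing_energy_eq
  proof (rule nn_integral_mono, rule nn_integral_mono)
    fix u v
    show "(\<integral>\<^sup>+z. through w z u * through w z v * ennreal \<bar>det2 u v\<bar> \<partial>lborel)
      \<le> (\<integral>\<^sup>+x. \<integral>\<^sup>+y. w x (x + u) * w y (y + v) * (if seg_cross x u y v then 1 else 0) \<partial>lborel \<partial>lborel)"
    proof (cases "det2 u v = 0")
      case False
      have "(\<integral>\<^sup>+x. \<integral>\<^sup>+y. w x (x + u) * w y (y + v) * (if seg_cross x u y v then 1 else 0) \<partial>lborel \<partial>lborel)
        = ennreal \<bar>det2 u v\<bar> * (\<integral>\<^sup>+z. through w z u * through w z v \<partial>lborel)"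
        unfolding through_def by (rule crossing_fixed_directions) (use False in measurable)
      then show ?thesis
        by (subst nn_integral_multc) (auto simp: mult.commute)
    qed simp
  qed
  finally show ?thesis .
qed

text \<open>Each segment spreads its mass uniformly over the positions \<open>s\<close> from 0 to 1,
  a set of length 1, so the total is unchanged.\<close>

lemma nn_integral_through:
  "(\<integral>\<^sup>+z. \<integral>\<^sup>+u. through w z u \<partial>lborel \<partial>lborel) = (\<integral>\<^sup>+x. \<integral>\<^sup>+y. w x y \<partial>lborel \<partial>lborel)"
proof -
  define I where "I = (indicator {0..1} :: real \<Rightarrow> ennreal)"
  have [measurable]: "I \<in> borel_measurable borel"
    by (simp add: I_def)
  have I1: "(\<integral>\<^sup>+s. I s \<partial>lborel) = 1"
    by (simp add: I_def)
  have "(\<integral>\<^sup>+z. \<integral>\<^sup>+u. through w z u \<partial>lborel \<partial>lborel)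
      = (\<integral>\<^sup>+u. \<integral>\<^sup>+z. \<integral>\<^sup>+s. I s * w (z - s *\<^sub>R u) (z - s *\<^sub>R u + u) \<partial>lborel \<partial>lborel \<partial>lborel)"
    unfolding through_def I_def[symmetric] by (rule lborel_pair.Fubini') measurable
  also have "\<dots> = (\<integral>\<^sup>+u. \<integral>\<^sup>+s. \<integral>\<^sup>+z. I s * w (z - s *\<^sub>R u) (z - s *\<^sub>R u + u) \<partial>lborel \<partial>lborel \<partial>lborel)"
    by (intro nn_integral_cong lborel_pair.Fubini') measurable
  also have "\<dots> = (\<integral>\<^sup>+u. \<integral>\<^sup>+s. I s * (\<integral>\<^sup>+x. w x (x + u) \<partial>lborel) \<partial>lborel \<partial>lborel)"
  proof (intro nn_integral_cong)
    fix u :: "real \<times> real" and s :: real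
    have "(\<integral>\<^sup>+z. w (z - s *\<^sub>R u) (z - s *\<^sub>R u + u) \<partial>lborel)
       = (\<integral>\<^sup>+x. w (s *\<^sub>R u + x - s *\<^sub>R u) (s *\<^sub>R u + x - s *\<^sub>R u + u) \<partial>lborel)"
      by (rule nn_integral_translate[symmetric]) measurable
    then show "(\<integral>\<^sup>+z. I s * w (z - s *\<^sub>R u) (z - s *\<^sub>R u + u) \<partial>lborel) = I s * (\<integral>\<^sup>+x. w x (x + u) \<partial>lborel)"
      by (simp add: nn_integral_cmult)
  qed
  also have "\<dots> = (\<integral>\<^sup>+u. \<integral>\<^sup>+x. w x (x + u) \<partial>lborel \<partial>lborel)"
    by (simp add: nn_integral_multc I1)
  also have "\<dots> = (\<integral>\<^sup>+x. \<integral>\<^sup>+u. w x (x + u) \<partial>lborel \<partial>lborel)"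
    by (rule lborel_pair.Fubini') measurable
  also have "\<dots> = (\<integral>\<^sup>+x. \<integral>\<^sup>+y. w x y \<partial>lborel \<partial>lborel)"
    by (intro nn_integral_cong nn_integral_translate) measurable
  finally show ?thesis .
qed

text \<open>Convexity of \<open>K\<close> puts the crossing point in \<open>K\<close>, which gives
  Jensen's inequality a set of measure \<open>A\<close>; boundedness of \<open>K\<close> bounds the
  displacements and so makes the moments in Busemann's inequality finite.\<close>

lemma crossing_energy_lower_bound:
  assumes K: "convex K" "K \<in> sets borel" "bounded K" "emeasure lborel K = ennreal A" "A > 0"
    and w1: "\<And>x y. w x y \<le> 1" and supp: "\<And>x y. w x y \<noteq> 0 \<Longrightarrow> x \<in> K \<and> y \<in> K"
  shows "ennreal (8 / (9 * pi\<^sup>2)) * (\<integral>\<^sup>+x. \<integral>\<^sup>+y. w x y \<partial>lborel \<partial>lborel) ^ 3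
    \<le> ennreal (A\<^sup>2) * crossing_energy w"
proof -
  define g where "g = through w"
  have [measurable]: "(\<lambda>x. g (a x) (b x)) \<in> borel_measurable M"
    if [measurable]: "a \<in> borel_measurable M" "b \<in> borel_measurable M" for a b and M :: "'c measure"
    unfolding g_def by measurable
  have g1: "g z u \<le> 1" for z u
  proof -
    have "g z u \<le> (\<integral>\<^sup>+s. indicator {0..1::real} s \<partial>lborel)"
      unfolding g_def through_def
      by (intro nn_integral_mono) (auto simp: indicator_def w1)
    then show ?thesis by simp
  qed
  have g_K: "g z u = 0" if "z \<notin> K" for z u
  proof -
    have 0: "indicator {0..1} s * w (z - s *\<^sub>R u) (z - s *\<^sub>R u + u) = 0" for s
    proof (rule ccontr)
      assume *: "indicator {0..1} s * w (z - s *\<^sub>R u) (z - s *\<^sub>R u + u) \<noteq> 0"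
      then have s: "0 \<le> s" "s \<le> 1" by (auto simp: indicator_def split: if_splits)
      from * have "z - s *\<^sub>R u \<in> K" "z - s *\<^sub>R u + u \<in> K"
        using supp by fastforce+
      then have "(1 - s) *\<^sub>R (z - s *\<^sub>R u) + s *\<^sub>R (z - s *\<^sub>R u + u) \<in> K"
        using K(1) s by (intro convexD) auto
      then show False
        using that by (simp add: algebra_simps)
    qed
    show ?thesis
      unfolding g_def through_def 0 by simp
  qed
  obtain B where B: "\<And>x. x \<in> K \<Longrightarrow> norm x \<le> B"
    using K(3) by (auto simp: bounded_iff)
  have g_B: "g z u = 0" if "norm u > 2 * B" for z u
  proof -
    have "w (z - s *\<^sub>R u) (z - s *\<^sub>R u + u) = 0" for s
    proof (rule ccontr)
      assume "w (z - s *\<^sub>R u) (z - s *\<^sub>R u + u) \<noteq> 0"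
      then have "norm (z - s *\<^sub>R u + u) \<le> B" "norm (z - s *\<^sub>R u) \<le> B"
        using supp B by blast+
      then show False
        using that norm_triangle_ineq4[of "z - s *\<^sub>R u + u" "z - s *\<^sub>R u"] by simp
    qed
    then show ?thesis
      by (simp add: g_def through_def)
  qed
  have ball: "emeasure lborel (cball (0 :: real \<times> real) (2 * B)) < \<infinity>"
    by (rule emeasure_compact_finite) simp
  define m where "m z = (\<integral>\<^sup>+u. g z u \<partial>lborel)" for z
  have [measurable]: "m \<in> borel_measurable borel"
    unfolding m_def by measurable
  have g_le: "g z u \<le> indicator (cball 0 (2 * B)) u" for z u
    using g1[of z u] g_B[of u z] by (auto simp: indicator_def)
  have m_K: "m z = 0" if "z \<notin> K" for z
    by (simp add: m_def g_K[OF that])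
  have m_fin: "m z \<le> emeasure lborel (cball (0 :: real \<times> real) (2 * B))" for z
  proof -
    have "m z \<le> (\<integral>\<^sup>+u. indicator (cball (0 :: real \<times> real) (2 * B)) u \<partial>lborel)"
      unfolding m_def by (intro nn_integral_mono g_le)
    then show ?thesis by simp
  qed
  have fin: "(\<integral>\<^sup>+z. m z \<partial>lborel) < \<infinity>"
  proof -
    have "(\<integral>\<^sup>+z. m z \<partial>lborel) \<le> (\<integral>\<^sup>+z. emeasure lborel (cball (0 :: real \<times> real) (2 * B)) * indicator K z \<partial>lborel)"
      using m_fin m_K by (intro nn_integral_mono) (auto simp: indicator_def)
    also have "\<dots> = emeasure lborel (cball (0 :: real \<times> real) (2 * B)) * ennreal A"
      using K by (simp add: nn_integral_cmult_indicator)
    also have "\<dots> < \<infinity>"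
      using ball by (simp add: ennreal_mult_less_top)
    finally show ?thesis .
  qed
  have "ennreal (8 / (9 * pi\<^sup>2)) * (\<integral>\<^sup>+z. m z \<partial>lborel) ^ 3
      \<le> ennreal (8 / (9 * pi\<^sup>2)) * (ennreal (A\<^sup>2) * (\<integral>\<^sup>+z. m z ^ 3 \<partial>lborel))"
    using K fin m_K by (intro mult_left_mono jensen_cube[of m lborel K A]) auto
  also have "\<dots> = ennreal (A\<^sup>2) * (\<integral>\<^sup>+z. ennreal (8 / (9 * pi\<^sup>2)) * m z ^ 3 \<partial>lborel)"
    by (simp add: nn_integral_cmult mult.left_commute)
  also have "\<dots> \<le> ennreal (A\<^sup>2) * (\<integral>\<^sup>+z. \<integral>\<^sup>+u. \<integral>\<^sup>+v. g z u * g z v * ennreal \<bar>det2 u v\<bar> \<partial>lborel \<partial>lborel \<partial>lborel)"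
  proof (intro mult_left_mono nn_integral_mono)
    fix z
    have "(\<integral>\<^sup>+u. g z u * ennreal \<bar>fst u\<bar> \<partial>lborel) < \<infinity>"
    proof -
      have "g z u * ennreal \<bar>fst u\<bar> \<le> ennreal (2 * B) * indicator (cball 0 (2 * B)) u" for u
      proof (cases "norm u \<le> 2 * B")
        case True
        have "\<bar>fst u\<bar> \<le> norm u"
          using norm_fst_le[of "fst u" "snd u"] by simp
        then have "ennreal \<bar>fst u\<bar> \<le> ennreal (2 * B)"
          using True by (intro ennreal_leI) linarith
        then show ?thesis
          using True mult_mono[OF g1[of z u], of "ennreal \<bar>fst u\<bar>" "ennreal (2 * B)"] by simp
      next
        case False
        then show ?thesis using g_B[of u z] by simp
      qed
      then have "(\<integral>\<^sup>+u. g z u * ennreal \<bar>fst u\<bar> \<partial>lborel)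
          \<le> (\<integral>\<^sup>+u. ennreal (2 * B) * indicator (cball (0 :: real \<times> real) (2 * B)) u \<partial>lborel)"
        by (simp add: nn_integral_mono)
      also have "\<dots> = ennreal (2 * B) * emeasure lborel (cball (0 :: real \<times> real) (2 * B))"
        by (rule nn_integral_cmult_indicator) simp
      also have "\<dots> < \<infinity>"
        using ball by (simp add: ennreal_mult_less_top)
      finally show ?thesis .
    qed
    then show "ennreal (8 / (9 * pi\<^sup>2)) * m z ^ 3
      \<le> (\<integral>\<^sup>+u. \<integral>\<^sup>+v. g z u * g z v * ennreal \<bar>det2 u v\<bar> \<partial>lborel \<partial>lborel)"
      unfolding m_def by (intro busemann_planar g1) measurable
  qed simp
  also have "\<dots> \<le> ennreal (A\<^sup>2) * crossing_energy w"
    unfolding g_def by (intro mult_left_mono crossing_energy_ge) simp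
  finally show ?thesis
    by (simp add: m_def g_def nn_integral_through)
qed

end

section \<open>Mollified drawings\<close>

text \<open>Homogeneity: after scaling \<open>w\<close> by \<open>1 / C\<close> the cubed mass loses
  \<open>C ^ 3\<close> and the quadratic energy only \<open>C\<^sup>2\<close>, so one factor
  \<open>C\<close> remains on the right.\<close>

lemma crossing_energy_lower_bound_scaled:
  fixes w :: "real \<times> real \<Rightarrow> real \<times> real \<Rightarrow> ennreal"
  assumes [measurable]: "case_prod w \<in> borel_measurable (borel \<Otimes>\<^sub>M borel)"
    and K: "convex K" "K \<in> sets borel" "bounded K" "emeasure lborel K = ennreal A" "A > 0"
    and wC: "\<And>x y. w x y \<le> ennreal C" and "C > 0" and supp: "\<And>x y. w x y \<noteq> 0 \<Longrightarrow> x \<in> K \<and> y \<in> K"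
  shows "ennreal (8 / (9 * pi\<^sup>2)) * (\<integral>\<^sup>+x. \<integral>\<^sup>+y. w x y \<partial>lborel \<partial>lborel) ^ 3
    \<le> ennreal (A\<^sup>2 * C) * crossing_energy w"
proof -
  define c where "c = ennreal (1 / C)"
  define k where "k = c * c"
  let ?m = "\<integral>\<^sup>+x. \<integral>\<^sup>+y. w x y \<partial>lborel \<partial>lborel"
  define w' where "w' x y = c * w x y" for x y
  have Cc: "ennreal C * c = 1"
    using \<open>C > 0\<close> by (simp add: c_def flip: ennreal_mult)
  have meas [measurable]: "case_prod w' \<in> borel_measurable (borel \<Otimes>\<^sub>M borel)"
    unfolding w'_def by measurable
  have "w' x y \<le> 1" for x y
    using mult_left_mono[OF wC[of x y], of c] Cc by (simp add: w'_def mult.commute)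
  then have "ennreal (8 / (9 * pi\<^sup>2)) * (\<integral>\<^sup>+x. \<integral>\<^sup>+y. w' x y \<partial>lborel \<partial>lborel) ^ 3
    \<le> ennreal (A\<^sup>2) * crossing_energy w'"
    using supp by (intro crossing_energy_lower_bound[OF meas K]) (auto simp: w'_def)
  also have "(\<integral>\<^sup>+x. \<integral>\<^sup>+y. w' x y \<partial>lborel \<partial>lborel) = c * ?m"
    by (simp add: w'_def nn_integral_cmult)
  also have "crossing_energy w' = k * crossing_energy w"
  proof -
    have "crossing_energy w' = (\<integral>\<^sup>+x. \<integral>\<^sup>+x'. \<integral>\<^sup>+y. \<integral>\<^sup>+y'. k * (w x x' * w y y' *
       (if seg_cross x (x' - x) y (y' - y) then 1 else 0)) \<partial>lborel \<partial>lborel \<partial>lborel \<partial>lborel)"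
      unfolding crossing_energy_def w'_def k_def by (simp only: mult_ac)
    also have "\<dots> = k * crossing_energy w"
      unfolding crossing_energy_def by (simp add: nn_integral_cmult)
    finally show ?thesis .
  qed
  finally have "ennreal C ^ 3 * (ennreal (8 / (9 * pi\<^sup>2)) * (c * ?m) ^ 3)
      \<le> ennreal C ^ 3 * (ennreal (A\<^sup>2) * (c * c * crossing_energy w))"
    unfolding k_def by (rule mult_left_mono) simp
  also have "ennreal C ^ 3 * (ennreal (8 / (9 * pi\<^sup>2)) * (c * ?m) ^ 3)
     = (ennreal C * c) ^ 3 * (ennreal (8 / (9 * pi\<^sup>2)) * ?m ^ 3)"
    by (simp only: power_mult_distrib mult_ac)
  also have "ennreal C ^ 3 * (ennreal (A\<^sup>2) * (c * c * crossing_energy w))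
     = (ennreal C * c) * (ennreal C * c) * (ennreal (A\<^sup>2) * ennreal C * crossing_energy w)"
    by (simp only: power3_eq_cube mult_ac)
  finally show ?thesis
    using \<open>C > 0\<close> by (simp add: Cc ennreal_mult)
qed

section \<open>Orientation tests for crossings and their stability\<close>

definition orient :: "real \<times> real \<Rightarrow> real \<times> real \<Rightarrow> real \<times> real \<Rightarrow> real" where
  "orient a b c = det2 (b - a) (c - a)"

lemma measurable_orient [measurable (raw)]:
  assumes [measurable]: "a \<in> borel_measurable M" "b \<in> borel_measurable M" "c \<in> borel_measurable M"
  shows "(\<lambda>x. orient (a x) (b x) (c x)) \<in> borel_measurable M"
  unfolding orient_def by measurable

text \<open>As \<open>orient\<close> is twice a signed triangle area, each segment has its end
  points strictly on opposite sides of the line through the other. Strictness excludes shared end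
  points.\<close>

definition strict_cross :: "real \<times> real \<Rightarrow> real \<times> real \<Rightarrow> real \<times> real \<Rightarrow> real \<times> real \<Rightarrow> bool" where
  "strict_cross a a' b b' \<longleftrightarrow>
     orient a a' b * orient a a' b' < 0 \<and> orient b b' a * orient b b' a' < 0"

lemma abs_det2_le: "\<bar>det2 u v\<bar> \<le> 2 * norm u * norm v"
proof -
  have "\<bar>fst u\<bar> \<le> norm u" "\<bar>snd u\<bar> \<le> norm u" "\<bar>fst v\<bar> \<le> norm v" "\<bar>snd v\<bar> \<le> norm v"
    using norm_fst_le[of "fst u" "snd u"] norm_snd_le[of "snd u" "fst u"]
      norm_fst_le[of "fst v" "snd v"] norm_snd_le[of "snd v" "fst v"] by auto
  then have "\<bar>fst u\<bar> * \<bar>snd v\<bar> \<le> norm u * norm v" "\<bar>snd u\<bar> * \<bar>fst v\<bar> \<le> norm u * norm v"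
    by (auto intro!: mult_mono)
  then have "\<bar>fst u * snd v\<bar> \<le> norm u * norm v" "\<bar>snd u * fst v\<bar> \<le> norm u * norm v"
    by (simp_all add: abs_mult)
  then show ?thesis
    unfolding det2_def by linarith
qed

lemma abs_det2_le_mult: "norm u \<le> p \<Longrightarrow> norm v \<le> q \<Longrightarrow> \<bar>det2 u v\<bar> \<le> 2 * p * q"
  by (rule order_trans[OF abs_det2_le]) (auto intro!: mult_mono intro: order_trans[OF norm_ge_zero])

text \<open>By bilinearity, changing the two difference vectors one at a time produces two terms,
  each at most \<open>2 * (2 * \<delta>) * (2 * R)\<close>.\<close>

lemma orient_perturb:
  assumes "norm (a - a') \<le> \<delta>" "norm (b - b') \<le> \<delta>" "norm (c - c') \<le> \<delta>"
    and "norm a \<le> R" "norm c \<le> R" "norm a' \<le> R" "norm b' \<le> R"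
  shows "\<bar>orient a b c - orient a' b' c'\<bar> \<le> 16 * R * \<delta>"
proof -
  have 1: "norm ((b - a) - (b' - a')) \<le> 2 * \<delta>"
    using assms norm_triangle_ineq4[of "b - b'" "a - a'"] by (simp add: algebra_simps)
  have 2: "norm ((c - a) - (c' - a')) \<le> 2 * \<delta>"
    using assms norm_triangle_ineq4[of "c - c'" "a - a'"] by (simp add: algebra_simps)
  have 3: "norm (c - a) \<le> 2 * R" "norm (b' - a') \<le> 2 * R"
    using assms norm_triangle_ineq4[of c a] norm_triangle_ineq4[of b' a'] by auto
  have "orient a b c - orient a' b' c'
      = det2 ((b - a) - (b' - a')) (c - a) + det2 (b' - a') ((c - a) - (c' - a'))"
    by (simp add: orient_def det2_def algebra_simps)
  then have "\<bar>orient a b c - orient a' b' c'\<bar>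
      \<le> \<bar>det2 ((b - a) - (b' - a')) (c - a)\<bar> + \<bar>det2 (b' - a') ((c - a) - (c' - a'))\<bar>"
    by simp
  also have "\<dots> \<le> 2 * (2 * \<delta>) * (2 * R) + 2 * (2 * R) * (2 * \<delta>)"
    by (intro add_mono abs_det2_le_mult 1 2 3)
  finally show ?thesis by simp
qed

text \<open>In terms of the crossing parameters the two products are \<open>- t (1 - t) d^2\<close>
  and \<open>- s (1 - s) d^2\<close>, with \<open>d\<close> the determinant of the
  displacements.\<close>

lemma seg_cross_orient:
  assumes "seg_cross x (x' - x) y (y' - y)"
  shows "orient x x' y * orient x x' y' \<le> 0" "orient y y' x * orient y y' x' \<le> 0"
proof -
  define d where "d = det2 (x' - x) (y' - y)"
  define s where "s = det2 (y - x) (y' - y) / d"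
  define t where "t = det2 (y - x) (x' - x) / d"
  have d: "d \<noteq> 0" and s: "0 \<le> s" "s \<le> 1" and t: "0 \<le> t" "t \<le> 1"
    using assms by (auto simp: seg_cross_def d_def s_def t_def)
  have sd: "det2 (y - x) (y' - y) = s * d" and td: "det2 (y - x) (x' - x) = t * d"
    using d by (auto simp: s_def t_def)
  have o: "orient x x' y = - det2 (y - x) (x' - x)" "orient x x' y' = d - det2 (y - x) (x' - x)"
    by (auto simp: orient_def d_def det2_def algebra_simps)
  have "orient x x' y * orient x x' y' = - (t * (1 - t) * d\<^sup>2)"
    unfolding o td by (simp add: algebra_simps power2_eq_square)
  also have "\<dots> \<le> 0"
    using t by (auto intro!: mult_nonneg_nonneg)
  finally show "orient x x' y * orient x x' y' \<le> 0" .
  have o: "orient y y' x = det2 (y - x) (y' - y)" "orient y y' x' = det2 (y - x) (y' - y) - d"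
    by (auto simp: orient_def d_def det2_def algebra_simps)
  have "orient y y' x * orient y y' x' = - (s * (1 - s) * d\<^sup>2)"
    unfolding o sd by (simp add: algebra_simps power2_eq_square)
  also have "\<dots> \<le> 0"
    using s by (auto intro!: mult_nonneg_nonneg)
  finally show "orient y y' x * orient y y' x' \<le> 0" .
qed

lemma mult_neg_perturb:
  fixes a b a' b' \<epsilon> :: real
  assumes "a' * b' \<le> 0" "\<bar>a - a'\<bar> \<le> \<epsilon>" "\<bar>b - b'\<bar> \<le> \<epsilon>" "\<epsilon> < \<bar>a'\<bar>" "\<epsilon> < \<bar>b'\<bar>"
  shows "a * b < 0"
proof -
  have "\<epsilon> \<ge> 0" using assms by linarith
  consider "a' > 0" "b' < 0" | "a' < 0" "b' > 0"
    using assms \<open>\<epsilon> \<ge> 0\<close> by (auto simp: mult_le_0_iff abs_if split: if_splits)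
  then show ?thesis
  proof cases
    case 1
    then have "a > 0" "b < 0" using assms by (auto simp: abs_if split: if_splits)
    then show ?thesis by (rule mult_pos_neg)
  next
    case 2
    then have "a < 0" "b > 0" using assms by (auto simp: abs_if split: if_splits)
    then show ?thesis by (rule mult_neg_pos)
  qed
qed

text \<open>Here \<open>a, a', b, b'\<close> play the vertices and \<open>x, x', y, y'\<close> the
  smeared points. An orientation moves by at most \<open>16 * R * \<delta>\<close>, so one that
  exceeds this threshold keeps its sign.\<close>

lemma strict_cross_of_perturbed:
  assumes cross: "seg_cross x (x' - x) y (y' - y)"
    and d: "norm (a - x) \<le> \<delta>" "norm (a' - x') \<le> \<delta>" "norm (b - y) \<le> \<delta>" "norm (b' - y') \<le> \<delta>"
    and R: "norm a \<le> R" "norm a' \<le> R" "norm b \<le> R" "norm b' \<le> R"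
      "norm x \<le> R" "norm x' \<le> R" "norm y \<le> R" "norm y' \<le> R"
    and nd: "16 * R * \<delta> < \<bar>orient x x' y\<bar>" "16 * R * \<delta> < \<bar>orient x x' y'\<bar>"
      "16 * R * \<delta> < \<bar>orient y y' x\<bar>" "16 * R * \<delta> < \<bar>orient y y' x'\<bar>"
  shows "strict_cross a a' b b'"
  unfolding strict_cross_def
proof
  show "orient a a' b * orient a a' b' < 0"
    by (rule mult_neg_perturb[OF seg_cross_orient(1)[OF cross] _ _ nd(1,2)])
      (intro orient_perturb d R)+
  show "orient b b' a * orient b b' a' < 0"
    by (rule mult_neg_perturb[OF seg_cross_orient(2)[OF cross] _ _ nd(3,4)])
      (intro orient_perturb d R)+
qed

text \<open>Along the segment from \<open>a\<close> to \<open>a'\<close> the function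
  \<open>orient b b'\<close> is affine and changes sign, so it vanishes at the fraction
  \<open>s\<close>; likewise for \<open>t\<close>. The common denominator \<open>d\<close> is a
  difference of numbers of opposite sign, hence nonzero.\<close>

lemma strict_cross_imp_segments_meet:
  assumes "strict_cross a a' b b'"
  shows "closed_segment a a' \<inter> closed_segment b b' \<noteq> {}"
proof -
  define d where "d = orient a a' b' - orient a a' b"
  define s where "s = orient b b' a / d"
  define t where "t = - orient a a' b / d"
  have "d \<noteq> 0"
    using assms by (auto simp: strict_cross_def d_def mult_less_0_iff)
  have d': "d = orient b b' a - orient b b' a'"
    by (simp add: d_def orient_def det2_def algebra_simps)
  have t: "0 \<le> t" "t \<le> 1"
    using assms by (auto simp: strict_cross_def d_def t_def mult_less_0_iff field_simps)
  have s: "0 \<le> s" "s \<le> 1"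
    using assms unfolding s_def d' by (auto simp: strict_cross_def mult_less_0_iff field_simps)
  have "d *\<^sub>R (a + s *\<^sub>R (a' - a)) = d *\<^sub>R (b + t *\<^sub>R (b' - b))"
  proof -
    have "d *\<^sub>R a + orient b b' a *\<^sub>R (a' - a) = d *\<^sub>R b - orient a a' b *\<^sub>R (b' - b)"
      by (simp add: prod_eq_iff d_def orient_def det2_def algebra_simps)
    then show ?thesis
      using \<open>d \<noteq> 0\<close> by (simp add: s_def t_def scaleR_add_right scaleR_diff_right)
  qed
  then have "a + s *\<^sub>R (a' - a) = b + t *\<^sub>R (b' - b)"
    using \<open>d \<noteq> 0\<close> by simp
  moreover have "a + s *\<^sub>R (a' - a) \<in> closed_segment a a'"
    using s by (auto simp: in_segment algebra_simps intro!: exI[of _ s])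
  moreover have "b + t *\<^sub>R (b' - b) \<in> closed_segment b b'"
    using t by (auto simp: in_segment algebra_simps intro!: exI[of _ t])
  ultimately show ?thesis by auto
qed

section \<open>Near-collinear triples and the energy of a smeared drawing\<close>

definition near_collinear :: "(real \<times> real) set \<Rightarrow> real \<Rightarrow> real \<times> real \<Rightarrow> real \<times> real \<Rightarrow> real \<times> real \<Rightarrow> ennreal" where
  "near_collinear K \<epsilon> x y z = (if x \<in> K \<and> y \<in> K \<and> z \<in> K \<and> \<bar>orient x y z\<bar> \<le> \<epsilon> then 1 else 0)"

definition near_collinear_mass :: "(real \<times> real) set \<Rightarrow> real \<Rightarrow> ennreal" where
  "near_collinear_mass K \<epsilon> = (\<integral>\<^sup>+x. \<integral>\<^sup>+y. \<integral>\<^sup>+z. near_collinear K \<epsilon> x y z \<partial>lborel \<partial>lborel \<partial>lborel)"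

lemma measurable_near_collinear [measurable (raw)]:
  assumes [measurable]: "a \<in> borel_measurable M" "b \<in> borel_measurable M" "c \<in> borel_measurable M"
    "K \<in> sets borel"
  shows "(\<lambda>x. near_collinear K \<epsilon> (a x) (b x) (c x)) \<in> borel_measurable M"
  unfolding near_collinear_def by measurable

text \<open>Each summand constrains three of the four points and leaves the fourth free in
  \<open>K\<close>; relabelling reduces all four to the same triple integral.\<close>

lemma near_collinear_quadruple_mass:
  assumes [measurable]: "K \<in> sets borel"
  shows "(\<integral>\<^sup>+x. \<integral>\<^sup>+x'. \<integral>\<^sup>+y. \<integral>\<^sup>+y'.
      near_collinear K \<epsilon> x x' y * indicator K y' + near_collinear K \<epsilon> x x' y' * indicator K y +
      near_collinear K \<epsilon> y y' x * indicator K x' + near_collinear K \<epsilon> y y' x' * indicator K x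
      \<partial>lborel \<partial>lborel \<partial>lborel \<partial>lborel) = 4 * (near_collinear_mass K \<epsilon> * emeasure lborel K)"
proof -
  let ?D = "near_collinear K \<epsilon>" and ?A = "emeasure lborel K" and ?T = "near_collinear_mass K \<epsilon>"
  have A: "(\<integral>\<^sup>+x. indicator K x \<partial>lborel) = ?A"
    by simp
  have 1: "(\<integral>\<^sup>+x. \<integral>\<^sup>+x'. \<integral>\<^sup>+y. \<integral>\<^sup>+y'. ?D x x' y * indicator K y' \<partial>lborel \<partial>lborel \<partial>lborel \<partial>lborel) = ?T * ?A"
    by (simp add: nn_integral_cmult nn_integral_multc near_collinear_mass_def)
  have 2: "(\<integral>\<^sup>+x. \<integral>\<^sup>+x'. \<integral>\<^sup>+y. \<integral>\<^sup>+y'. ?D x x' y' * indicator K y \<partial>lborel \<partial>lborel \<partial>lborel \<partial>lborel) = ?T * ?A"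
    by (simp add: nn_integral_cmult nn_integral_multc near_collinear_mass_def)
  have rot: "(\<integral>\<^sup>+x. \<integral>\<^sup>+y. \<integral>\<^sup>+y'. ?D y y' x \<partial>lborel \<partial>lborel \<partial>lborel) = ?T"
  proof -
    have "(\<integral>\<^sup>+x. \<integral>\<^sup>+y. \<integral>\<^sup>+y'. ?D y y' x \<partial>lborel \<partial>lborel \<partial>lborel) = (\<integral>\<^sup>+y. \<integral>\<^sup>+x. \<integral>\<^sup>+y'. ?D y y' x \<partial>lborel \<partial>lborel \<partial>lborel)"
      by (rule lborel_pair.Fubini') measurable
    also have "\<dots> = ?T"
      unfolding near_collinear_mass_def by (intro nn_integral_cong lborel_pair.Fubini') measurable
    finally show ?thesis .
  qed
  have 3: "(\<integral>\<^sup>+x. \<integral>\<^sup>+x'. \<integral>\<^sup>+y. \<integral>\<^sup>+y'. ?D y y' x * indicator K x' \<partial>lborel \<partial>lborel \<partial>lborel \<partial>lborel) = ?T * ?A"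
    by (simp add: nn_integral_cmult nn_integral_multc rot)
  have 4: "(\<integral>\<^sup>+x. \<integral>\<^sup>+x'. \<integral>\<^sup>+y. \<integral>\<^sup>+y'. ?D y y' x' * indicator K x \<partial>lborel \<partial>lborel \<partial>lborel \<partial>lborel) = ?T * ?A"
    by (simp add: nn_integral_cmult nn_integral_multc rot)
  have "4 * c = c + c + c + c" for c :: ennreal
    by (simp only: numeral_Bit0 numeral_One distrib_right mult_1_left add.assoc)
  then show ?thesis
    by (simp add: nn_integral_add 1 2 3 4)
qed


text \<open>The estimate for one finite drawing at a fixed scale. An ordered edge in
  \<open>D\<close> becomes a product of two bumps of mass 1 at its end points, weighted by
  \<open>1 / N\<^sup>2\<close>, so the strictly crossing pairs integrate to their exact count.
  Crossings created by the smearing are charged to near-collinear triples.\<close>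

lemma mollified_energy:
  fixes q :: "'a \<Rightarrow> real \<times> real" and \<eta> :: "real \<times> real \<Rightarrow> ennreal" and N C A R \<delta> :: real
  assumes fin: "finite D" and N: "N > 0"
    and \<eta>_meas [measurable]: "\<eta> \<in> borel_measurable borel"
    and \<eta>_int: "(\<integral>\<^sup>+x. \<eta> x \<partial>lborel) = 1" and \<eta>_supp: "\<And>x. \<eta> x \<noteq> 0 \<Longrightarrow> norm x \<le> \<delta>"
    and K: "convex K" "K \<in> sets borel" "\<And>x. x \<in> K \<Longrightarrow> norm x \<le> R"
      "emeasure lborel K = ennreal A" "A > 0"
    and D_K: "\<And>a b. (a, b) \<in> D \<Longrightarrow> cball (q a) \<delta> \<subseteq> K \<and> cball (q b) \<delta> \<subseteq> K" and "\<delta> \<ge> 0"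
    and C: "C > 0"
      "\<And>x y. ennreal (1 / N\<^sup>2) * (\<Sum>(a, b)\<in>D. \<eta> (x - q a) * \<eta> (y - q b)) \<le> ennreal C"
  shows "ennreal (8 / (9 * pi\<^sup>2) * (card D / N\<^sup>2) ^ 3) \<le> ennreal (A\<^sup>2 * C) *
    (ennreal (card {((a, a'), (b, b')). (a, a') \<in> D \<and> (b, b') \<in> D \<and> strict_cross (q a) (q a') (q b) (q b')} / N ^ 4)
      + ennreal (C\<^sup>2) * (4 * (near_collinear_mass K (16 * R * \<delta>) * ennreal A)))"
proof -
  note [measurable] = K(2)
  define h where "h p x y = \<eta> (x - q (fst p)) * \<eta> (y - q (snd p))" for p x y
  define w where "w x y = ennreal (1 / N\<^sup>2) * (\<Sum>p\<in>D. h p x y)" for x y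
  define S where "S p r \<longleftrightarrow> strict_cross (q (fst p)) (q (snd p)) (q (fst r)) (q (snd r))" for p r
  define B where "B x x' y y' = near_collinear K (16 * R * \<delta>) x x' y * indicator K y' +
    near_collinear K (16 * R * \<delta>) x x' y' * indicator K y +
    near_collinear K (16 * R * \<delta>) y y' x * indicator K x' +
    near_collinear K (16 * R * \<delta>) y y' x' * indicator K x" for x x' y y'
  have [measurable (raw)]: "(\<lambda>i. h p (f i) (g i)) \<in> borel_measurable M"
    if [measurable]: "f \<in> borel_measurable M" "g \<in> borel_measurable M" for f g p and M :: "'c measure"
    unfolding h_def by measurable
  have w_meas [measurable]: "case_prod w \<in> borel_measurable (borel \<Otimes>\<^sub>M borel)"
    unfolding w_def by measurable
  have [measurable (raw)]: "(\<lambda>i. B (f i) (g i) (f' i) (g' i)) \<in> borel_measurable M"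
    if [measurable]: "f \<in> borel_measurable M" "g \<in> borel_measurable M"
      "f' \<in> borel_measurable M" "g' \<in> borel_measurable M" for f g f' g' and M :: "'c measure"
    unfolding B_def by measurable
  have \<eta>_shift: "(\<integral>\<^sup>+x. \<eta> (x - c) \<partial>lborel) = 1" for c
    using nn_integral_translate[of \<eta> "- c"] \<eta>_int by simp
  have h_int: "(\<integral>\<^sup>+x. \<integral>\<^sup>+y. h p x y \<partial>lborel \<partial>lborel) = 1" for p
    by (simp add: h_def nn_integral_cmult nn_integral_multc \<eta>_shift)
  have w_int: "(\<integral>\<^sup>+x. \<integral>\<^sup>+y. w x y \<partial>lborel \<partial>lborel) = ennreal (card D / N\<^sup>2)"
  proof -
    have "(\<integral>\<^sup>+x. \<integral>\<^sup>+y. w x y \<partial>lborel \<partial>lborel) = ennreal (1 / N\<^sup>2) * (\<Sum>p\<in>D. \<integral>\<^sup>+x. \<integral>\<^sup>+y. h p x y \<partial>lborel \<partial>lborel)"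
      by (simp add: w_def nn_integral_cmult nn_integral_sum)
    also have "\<dots> = ennreal (1 / N\<^sup>2) * ennreal (card D)"
      by (simp add: h_int ennreal_of_nat_eq_real_of_nat)
    also have "\<dots> = ennreal (card D / N\<^sup>2)"
      by (simp flip: ennreal_mult)
    finally show ?thesis .
  qed
  have w_C: "w x y \<le> ennreal C" for x y
    using C(2)[of x y] by (simp add: w_def h_def case_prod_beta)
  have h_supp: "x \<in> K \<and> y \<in> K \<and> norm (q (fst p) - x) \<le> \<delta> \<and> norm (q (snd p) - y) \<le> \<delta>"
    if "p \<in> D" "h p x y \<noteq> 0" for p x y
  proof -
    have "norm (x - q (fst p)) \<le> \<delta>" "norm (y - q (snd p)) \<le> \<delta>"
      using that \<eta>_supp by (auto simp: h_def)
    moreover have "cball (q (fst p)) \<delta> \<subseteq> K" "cball (q (snd p)) \<delta> \<subseteq> K"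
      using D_K[of "fst p" "snd p"] that by auto
    ultimately show ?thesis
      by (auto simp: dist_norm norm_minus_commute)
  qed
  have q_R: "norm (q (fst p)) \<le> R \<and> norm (q (snd p)) \<le> R" if "p \<in> D" for p
  proof -
    have "q (fst p) \<in> cball (q (fst p)) \<delta>" "q (snd p) \<in> cball (q (snd p)) \<delta>"
      using \<open>\<delta> \<ge> 0\<close> by simp_all
    then show ?thesis
      using D_K[of "fst p" "snd p"] that K(3) by (metis prod.collapse subsetD)
  qed
  have w_supp: "x \<in> K \<and> y \<in> K" if "w x y \<noteq> 0" for x y
  proof -
    have "(\<Sum>p\<in>D. h p x y) \<noteq> 0"
      using that unfolding w_def by (metis mult_zero_right)
    then obtain p where "p \<in> D" "h p x y \<noteq> 0"
      by (rule sum.not_neutral_contains_not_neutral)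
    then show ?thesis using h_supp by blast
  qed
  have "bounded K"
    using K(3) unfolding bounded_iff by blast
  have ww: "w x x' * w y y' = ennreal (1 / N ^ 4) * (\<Sum>p\<in>D. \<Sum>r\<in>D. h p x x' * h r y y')" for x x' y y'
  proof -
    have "ennreal (1 / N\<^sup>2) * ennreal (1 / N\<^sup>2) = ennreal (1 / N ^ 4)"
      by (simp add: power2_eq_square power4_eq_xxxx mult.assoc flip: ennreal_mult)
    moreover have "(\<Sum>p\<in>D. h p x x') * (\<Sum>r\<in>D. h r y y') = (\<Sum>p\<in>D. \<Sum>r\<in>D. h p x x' * h r y y')"
      by (rule sum_product)
    moreover have "w x x' * w y y' = (ennreal (1 / N\<^sup>2) * ennreal (1 / N\<^sup>2)) *
        ((\<Sum>p\<in>D. h p x x') * (\<Sum>r\<in>D. h r y y'))"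
      by (simp only: w_def mult_ac)
    ultimately show ?thesis
      by simp
  qed
  \<comment> \<open>The contribution of pairs of edges that cross before smearing. The crossing
    condition on the smeared points is dropped, which only enlarges it and lets each pair of bumps
    integrate to 1.\<close>
  define Q where "Q x x' y y' = ennreal (1 / N ^ 4) * (\<Sum>p\<in>D. \<Sum>r\<in>D. (if S p r then 1 else 0) * (h p x x' * h r y y'))" for x x' y y'
  have pt: "w x x' * w y y' * (if seg_cross x (x' - x) y (y' - y) then 1 else 0)
      \<le> Q x x' y y' + ennreal (C\<^sup>2) * B x x' y y'" for x x' y y'
  proof (cases "seg_cross x (x' - x) y (y' - y) \<and> w x x' * w y y' \<noteq> 0")
    case False
    then show ?thesis by auto
  next
    case True
    then have "w x x' \<noteq> 0" "w y y' \<noteq> 0" by auto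
    then have inK: "x \<in> K" "x' \<in> K" "y \<in> K" "y' \<in> K"
      using w_supp by blast+
    then have le_R: "norm x \<le> R" "norm x' \<le> R" "norm y \<le> R" "norm y' \<le> R"
      using K(3) by blast+
    show ?thesis
    proof (cases "16 * R * \<delta> < \<bar>orient x x' y\<bar> \<and> 16 * R * \<delta> < \<bar>orient x x' y'\<bar> \<and>
        16 * R * \<delta> < \<bar>orient y y' x\<bar> \<and> 16 * R * \<delta> < \<bar>orient y y' x'\<bar>")
      case nd: True
      \<comment> \<open>Away from near-collinear triples, every pair of edges that contributes at
        this quadruple crosses strictly, so \<open>Q\<close> keeps the whole product.\<close>
      have "(if S p r then 1 else 0) * (h p x x' * h r y y') = h p x x' * h r y y'" if "p \<in> D" "r \<in> D" for p r
      proof (cases "h p x x' * h r y y' = 0")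
        case False
        then have "S p r"
          unfolding S_def using nd True h_supp[OF that(1), of x x'] h_supp[OF that(2), of y y']
            q_R[OF that(1)] q_R[OF that(2)] le_R
          by (intro strict_cross_of_perturbed[of x x' y y' _ \<delta> _ _ _ R]) auto
        then show ?thesis by simp
      qed auto
      then have "Q x x' y y' = w x x' * w y y'"
        by (simp add: Q_def ww)
      then show ?thesis by simp
    next
      case nd: False
      \<comment> \<open>On the bad set the edges are not examined: the bound \<open>C\<close> on
        each factor is enough, because the set has small measure.\<close>
      have "1 \<le> B x x' y y'"
        using nd inK by (auto simp: B_def near_collinear_def not_less intro: order_trans[OF _ add_increasing2])
      have "w x x' * w y y' \<le> ennreal C * ennreal C"
        by (intro mult_mono w_C) auto
      also have "\<dots> = ennreal (C\<^sup>2) * 1"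
        using C(1) by (simp add: power2_eq_square ennreal_mult)
      also have "\<dots> \<le> ennreal (C\<^sup>2) * B x x' y y'"
        using \<open>1 \<le> B x x' y y'\<close> by (intro mult_left_mono) auto
      finally show ?thesis
        using True by (auto intro: add_increasing)
    qed
  qed
  have B_int: "(\<integral>\<^sup>+x. \<integral>\<^sup>+x'. \<integral>\<^sup>+y. \<integral>\<^sup>+y'. B x x' y y' \<partial>lborel \<partial>lborel \<partial>lborel \<partial>lborel)
      = 4 * (near_collinear_mass K (16 * R * \<delta>) * ennreal A)"
    unfolding B_def by (subst near_collinear_quadruple_mass) (simp_all add: K)
  let ?S = "{((a, a'), (b, b')). (a, a') \<in> D \<and> (b, b') \<in> D \<and> strict_cross (q a) (q a') (q b) (q b')}"
  have Q_int: "(\<integral>\<^sup>+x. \<integral>\<^sup>+x'. \<integral>\<^sup>+y. \<integral>\<^sup>+y'. Q x x' y y' \<partial>lborel \<partial>lborel \<partial>lborel \<partial>lborel) = ennreal (card ?S / N ^ 4)"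
  proof -
    have "(\<integral>\<^sup>+x. \<integral>\<^sup>+x'. \<integral>\<^sup>+y. \<integral>\<^sup>+y'. Q x x' y y' \<partial>lborel \<partial>lborel \<partial>lborel \<partial>lborel)
      = ennreal (1 / N ^ 4) * (\<Sum>p\<in>D. \<Sum>r\<in>D. (if S p r then 1 else 0) *
          ((\<integral>\<^sup>+x. \<integral>\<^sup>+x'. h p x x' \<partial>lborel \<partial>lborel) * (\<integral>\<^sup>+y. \<integral>\<^sup>+y'. h r y y' \<partial>lborel \<partial>lborel)))"
      by (simp add: Q_def nn_integral_cmult nn_integral_multc nn_integral_sum)
    also have "(\<Sum>p\<in>D. \<Sum>r\<in>D. (if S p r then 1 else 0) *
          ((\<integral>\<^sup>+x. \<integral>\<^sup>+x'. h p x x' \<partial>lborel \<partial>lborel) * (\<integral>\<^sup>+y. \<integral>\<^sup>+y'. h r y y' \<partial>lborel \<partial>lborel)))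
        = (\<Sum>z\<in>D \<times> D. if S (fst z) (snd z) then 1 else 0 :: ennreal)"
      by (simp add: h_int sum.cartesian_product case_prod_beta)
    also have "\<dots> = of_nat (card {z \<in> D \<times> D. S (fst z) (snd z)})"
      using fin by (simp add: sum.If_cases Int_def)
    also have "{z \<in> D \<times> D. S (fst z) (snd z)} = ?S"
      by (auto simp: S_def)
    finally show ?thesis
      using N by (simp add: ennreal_of_nat_eq_real_of_nat flip: ennreal_mult)
  qed
  have "crossing_energy w \<le> (\<integral>\<^sup>+x. \<integral>\<^sup>+x'. \<integral>\<^sup>+y. \<integral>\<^sup>+y'. Q x x' y y' + ennreal (C\<^sup>2) * B x x' y y' \<partial>lborel \<partial>lborel \<partial>lborel \<partial>lborel)"
    unfolding crossing_energy_def by (intro nn_integral_mono pt)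
  also have "\<dots> = (\<integral>\<^sup>+x. \<integral>\<^sup>+x'. \<integral>\<^sup>+y. \<integral>\<^sup>+y'. Q x x' y y' \<partial>lborel \<partial>lborel \<partial>lborel \<partial>lborel)
      + ennreal (C\<^sup>2) * (\<integral>\<^sup>+x. \<integral>\<^sup>+x'. \<integral>\<^sup>+y. \<integral>\<^sup>+y'. B x x' y y' \<partial>lborel \<partial>lborel \<partial>lborel \<partial>lborel)"
  proof -
    have [measurable (raw)]: "(\<lambda>i. Q (f i) (g i) (f' i) (g' i)) \<in> borel_measurable M"
      if [measurable]: "f \<in> borel_measurable M" "g \<in> borel_measurable M"
        "f' \<in> borel_measurable M" "g' \<in> borel_measurable M" for f g f' g' and M :: "'c measure"
      unfolding Q_def by measurable
    show ?thesis
      by (simp add: nn_integral_add nn_integral_cmult)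
  qed
  finally have CE: "crossing_energy w \<le> ennreal (card ?S / N ^ 4)
      + ennreal (C\<^sup>2) * (4 * (near_collinear_mass K (16 * R * \<delta>) * ennreal A))"
    unfolding Q_int B_int .
  have "ennreal (8 / (9 * pi\<^sup>2) * (card D / N\<^sup>2) ^ 3)
      = ennreal (8 / (9 * pi\<^sup>2)) * (\<integral>\<^sup>+x. \<integral>\<^sup>+y. w x y \<partial>lborel \<partial>lborel) ^ 3"
    unfolding w_int by (simp add: ennreal_power flip: ennreal_mult)
  also have "\<dots> \<le> ennreal (A\<^sup>2 * C) * crossing_energy w"
    by (rule crossing_energy_lower_bound_scaled[OF w_meas K(1,2) \<open>bounded K\<close> K(4,5) w_C C(1) w_supp])
  also have "\<dots> \<le> ennreal (A\<^sup>2 * C) * (ennreal (card ?S / N ^ 4)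
      + ennreal (C\<^sup>2) * (4 * (near_collinear_mass K (16 * R * \<delta>) * ennreal A)))"
    by (intro mult_left_mono CE) simp
  finally show ?thesis .
qed

section \<open>Degenerate triples, neighbourhoods, mollifiers and equidistribution\<close>

lemma orient_zero_null:
  assumes "x \<noteq> y"
  shows "emeasure lborel {z. orient x y z = 0} = 0"
proof -
  define a where "a = (- snd (y - x), fst (y - x))"
  have "a \<noteq> 0"
    using assms by (auto simp: a_def prod_eq_iff)
  have eq: "{z. orient x y z = 0} = {z. a \<bullet> z = a \<bullet> x}"
    by (auto simp: a_def orient_def det2_def inner_prod_def algebra_simps)
  have "negligible {z. a \<bullet> z = a \<bullet> x}"
    using \<open>a \<noteq> 0\<close> by (intro negligible_hyperplane) simp
  moreover have "closed {z. a \<bullet> z = a \<bullet> x}"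
    by (rule closed_hyperplane)
  ultimately show ?thesis
    unfolding eq by (simp add: negligible_iff_null_sets null_sets_def emeasure_completion)
qed

text \<open>For \<open>y \<noteq> x\<close> the exceptional \<open>z\<close> form a line, and
  \<open>y = x\<close> is a single point.\<close>

lemma near_collinear_mass_0:
  assumes [measurable]: "K \<in> sets borel"
  shows "near_collinear_mass K 0 = 0"
proof -
  have "(\<integral>\<^sup>+y. \<integral>\<^sup>+z. near_collinear K 0 x y z \<partial>lborel \<partial>lborel) = 0" for x
  proof -
    have "AE y in lborel. (\<integral>\<^sup>+z. near_collinear K 0 x y z \<partial>lborel) = 0"
      using AE_lborel_singleton[of x]
    proof eventually_elim
      case (elim y)
      have "(\<integral>\<^sup>+z. near_collinear K 0 x y z \<partial>lborel) \<le> (\<integral>\<^sup>+z. indicator {z. orient x y z = 0} z \<partial>lborel)"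
        by (intro nn_integral_mono) (auto simp: near_collinear_def)
      also have "\<dots> = emeasure lborel {z. orient x y z = 0}"
        by (rule nn_integral_indicator) simp
      finally show ?case
        using orient_zero_null[of x y] elim by simp
    qed
    then show ?thesis
      by (simp add: nn_integral_0_iff_AE)
  qed
  then show ?thesis
    by (simp add: near_collinear_mass_def)
qed

text \<open>Allows a set that varies with \<delta> to be replaced by one fixed ball before \<delta>
  tends to 0.\<close>

lemma near_collinear_mass_mono:
  "K \<subseteq> K' \<Longrightarrow> near_collinear_mass K \<epsilon> \<le> near_collinear_mass K' \<epsilon>"
  unfolding near_collinear_mass_def
  by (intro nn_integral_mono) (auto simp: near_collinear_def)

text \<open>The triples form compact sets in the product of three planes that decrease to the
  exactly collinear triples. Compactness gives the finite measure that continuity from above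
  requires.\<close>

lemma near_collinear_mass_tendsto_0:
  assumes K: "compact K" and \<epsilon>: "decseq \<epsilon>" "\<epsilon> \<longlonglongrightarrow> 0"
  shows "(\<lambda>k. near_collinear_mass K (\<epsilon> k)) \<longlonglongrightarrow> 0"
proof -
  have [measurable]: "K \<in> sets borel"
    using K by (simp add: compact_imp_closed)
  define F where "F e = {((x, y), z). x \<in> K \<and> y \<in> K \<and> z \<in> K \<and> \<bar>orient x y z\<bar> \<le> e}" for e
  have F_eq: "F e = ((K \<times> K) \<times> K) \<inter> {p. \<bar>orient (fst (fst p)) (snd (fst p)) (snd p)\<bar> \<le> e}" for e
    by (auto simp: F_def)
  have closed: "closed {p :: ((real \<times> real) \<times> (real \<times> real)) \<times> (real \<times> real). \<bar>orient (fst (fst p)) (snd (fst p)) (snd p)\<bar> \<le> e}" for e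
    unfolding orient_def det2_def by (intro closed_Collect_le continuous_intros)
  have cpt: "compact (F e)" for e
    unfolding F_eq by (intro compact_Int_closed compact_Times K closed)
  then have meas [measurable]: "F e \<in> sets borel" for e
    by (simp add: compact_imp_closed)
  have mass: "near_collinear_mass K e = emeasure lborel (F e)" for e
  proof -
    define f where "f p z = near_collinear K e (fst p) (snd p) z" for p :: "(real \<times> real) \<times> (real \<times> real)" and z
    have [measurable]: "case_prod f \<in> borel_measurable (borel \<Otimes>\<^sub>M borel)"
    proof -
      have [measurable]: "fst \<in> borel_measurable (borel :: ((real \<times> real) \<times> (real \<times> real)) measure)"
        "snd \<in> borel_measurable (borel :: ((real \<times> real) \<times> (real \<times> real)) measure)"
        by (intro borel_measurable_continuous_onI continuous_intros)+
      show ?thesis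
        unfolding f_def by measurable
    qed
    have "near_collinear_mass K e = (\<integral>\<^sup>+x. \<integral>\<^sup>+y. \<integral>\<^sup>+z. f (x, y) z \<partial>lborel \<partial>lborel \<partial>lborel)"
      by (simp add: near_collinear_mass_def f_def)
    also have "\<dots> = (\<integral>\<^sup>+p. \<integral>\<^sup>+z. f p z \<partial>lborel \<partial>(lborel \<Otimes>\<^sub>M lborel))"
      by (rule lborel.nn_integral_fst[of "\<lambda>p. \<integral>\<^sup>+z. f p z \<partial>lborel"]) (simp add: lborel_prod)
    also have "\<dots> = (\<integral>\<^sup>+p. \<integral>\<^sup>+z. (\<lambda>(p, z). f p z) (p, z) \<partial>lborel \<partial>lborel)"
      by (simp add: lborel_prod)
    also have "\<dots> = (\<integral>\<^sup>+p. (\<lambda>(p, z). f p z) p \<partial>(lborel \<Otimes>\<^sub>M lborel))"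
      by (rule lborel.nn_integral_fst) simp
    also have "\<dots> = (\<integral>\<^sup>+p. indicator (F e) p \<partial>(lborel \<Otimes>\<^sub>M lborel))"
      by (intro nn_integral_cong) (auto simp: f_def F_def near_collinear_def indicator_def split: if_splits)
    also have "\<dots> = emeasure lborel (F e)"
      unfolding lborel_prod by (rule nn_integral_indicator) simp
    finally show ?thesis .
  qed
  have "(\<lambda>k. emeasure lborel (F (\<epsilon> k))) \<longlonglongrightarrow> emeasure lborel (\<Inter>k. F (\<epsilon> k))"
  proof (rule Lim_emeasure_decseq)
    show "range (\<lambda>k. F (\<epsilon> k)) \<subseteq> sets lborel" by auto
    show "decseq (\<lambda>k. F (\<epsilon> k))"
      using \<epsilon>(1) by (force simp: decseq_def F_def)
    show "emeasure lborel (F (\<epsilon> k)) \<noteq> \<infinity>" for k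
      using emeasure_compact_finite[OF cpt, of "\<epsilon> k"] by simp
  qed
  moreover have "(\<Inter>k. F (\<epsilon> k)) = F 0"
  proof
    show "(\<Inter>k. F (\<epsilon> k)) \<subseteq> F 0"
    proof
      fix p assume p: "p \<in> (\<Inter>k. F (\<epsilon> k))"
      obtain x y z where xyz: "p = ((x, y), z)" by (cases p) auto
      have "\<bar>orient x y z\<bar> \<le> 0"
        using p xyz by (intro LIMSEQ_le_const[OF \<epsilon>(2)]) (auto simp: F_def)
      with p xyz show "p \<in> F 0" by (auto simp: F_def)
    qed
    show "F 0 \<subseteq> (\<Inter>k. F (\<epsilon> k))"
      using decseq_ge[OF \<epsilon>] by (auto simp: F_def)
  qed
  ultimately show ?thesis
    using near_collinear_mass_0[of K] by (simp add: mass)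
qed

section \<open>Closed neighbourhoods of a compact set\<close>

definition nbhd :: "(real \<times> real) set \<Rightarrow> real \<Rightarrow> (real \<times> real) set" where
  "nbhd S d = {x. infdist x S \<le> d}"

lemma closed_nbhd: "closed (nbhd S d)"
  unfolding nbhd_def by (intro closed_Collect_le continuous_intros)

context
  fixes S :: "(real \<times> real) set"
  assumes S: "compact S" "S \<noteq> {}"
begin

lemma nbhd_iff: "x \<in> nbhd S d \<longleftrightarrow> (\<exists>a\<in>S. dist x a \<le> d)"
proof
  assume "x \<in> nbhd S d"
  moreover obtain a where "a \<in> S" "infdist x S = dist x a"
    using infdist_attains_inf[of S x] S by (auto simp: compact_imp_closed)
  ultimately show "\<exists>a\<in>S. dist x a \<le> d"
    by (auto simp: nbhd_def)
next
  assume "\<exists>a\<in>S. dist x a \<le> d"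
  then show "x \<in> nbhd S d"
    by (auto simp: nbhd_def intro: order_trans[OF infdist_le])
qed

lemma convex_nbhd:
  assumes "convex S"
  shows "convex (nbhd S d)"
proof (rule convexI)
  fix x y :: "real \<times> real" and u v :: real
  assume xy: "x \<in> nbhd S d" "y \<in> nbhd S d" and uv: "0 \<le> u" "0 \<le> v" "u + v = 1"
  obtain a b where ab: "a \<in> S" "dist x a \<le> d" "b \<in> S" "dist y b \<le> d"
    using xy by (auto simp: nbhd_iff)
  have "dist (u *\<^sub>R x + v *\<^sub>R y) (u *\<^sub>R a + v *\<^sub>R b) = norm (u *\<^sub>R (x - a) + v *\<^sub>R (y - b))"
    by (simp add: dist_norm algebra_simps)
  also have "\<dots> \<le> u * dist x a + v * dist y b"
    using uv by (intro order_trans[OF norm_triangle_ineq]) (simp add: dist_norm)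
  also have "\<dots> \<le> u * d + v * d"
    using ab uv by (intro add_mono mult_left_mono) auto
  also have "\<dots> = d"
    using uv by (simp flip: distrib_right)
  finally have "dist (u *\<^sub>R x + v *\<^sub>R y) (u *\<^sub>R a + v *\<^sub>R b) \<le> d" .
  moreover have "u *\<^sub>R a + v *\<^sub>R b \<in> S"
    using assms ab uv by (intro convexD) auto
  ultimately show "u *\<^sub>R x + v *\<^sub>R y \<in> nbhd S d"
    by (auto simp: nbhd_iff)
qed

lemma nbhd_norm_le:
  assumes "\<And>a. a \<in> S \<Longrightarrow> norm a \<le> B" "x \<in> nbhd S d"
  shows "norm x \<le> B + d"
proof -
  obtain a where "a \<in> S" "dist x a \<le> d"
    using assms by (auto simp: nbhd_iff)
  then show ?thesis
    using assms(1)[of a] norm_triangle_sub[of x a] by (simp add: dist_norm)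
qed

lemma compact_nbhd: "compact (nbhd S d)"
proof -
  obtain B where "\<And>a. a \<in> S \<Longrightarrow> norm a \<le> B"
    using compact_imp_bounded[OF S(1)] by (auto simp: bounded_iff)
  then have "bounded (nbhd S d)"
    using nbhd_norm_le[of B] unfolding bounded_iff by blast
  then show ?thesis
    using closed_nbhd by (simp add: compact_eq_bounded_closed)
qed

lemma cball_subset_nbhd: "x \<in> nbhd S d \<Longrightarrow> cball x d' \<subseteq> nbhd S (d + d')"
proof
  fix y assume "x \<in> nbhd S d" "y \<in> cball x d'"
  then show "y \<in> nbhd S (d + d')"
    using infdist_triangle[of y S x] by (auto simp: nbhd_def dist_commute)
qed

lemma subset_nbhd: "d \<ge> 0 \<Longrightarrow> S \<subseteq> nbhd S d"
  by (auto simp: nbhd_def)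

lemma measure_nbhd_tendsto:
  assumes \<epsilon>: "decseq \<epsilon>" "\<epsilon> \<longlonglongrightarrow> 0"
  shows "(\<lambda>k. measure lborel (nbhd S (\<epsilon> k))) \<longlonglongrightarrow> measure lborel S"
proof -
  have "(\<lambda>k. measure lborel (nbhd S (\<epsilon> k))) \<longlonglongrightarrow> measure lborel (\<Inter>k. nbhd S (\<epsilon> k))"
  proof (rule Lim_measure_decseq)
    show "range (\<lambda>k. nbhd S (\<epsilon> k)) \<subseteq> sets lborel"
      using closed_nbhd by auto
    show "decseq (\<lambda>k. nbhd S (\<epsilon> k))"
      using \<epsilon>(1) by (force simp: decseq_def nbhd_def)
    show "emeasure lborel (nbhd S (\<epsilon> k)) \<noteq> \<infinity>" for k
      using emeasure_compact_finite[OF compact_nbhd, of "\<epsilon> k"] by simp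
  qed
  moreover have "(\<Inter>k. nbhd S (\<epsilon> k)) = S"
  proof
    show "(\<Inter>k. nbhd S (\<epsilon> k)) \<subseteq> S"
    proof
      fix x assume "x \<in> (\<Inter>k. nbhd S (\<epsilon> k))"
      then have "infdist x S \<le> 0"
        by (intro LIMSEQ_le_const[OF \<epsilon>(2)]) (auto simp: nbhd_def)
      then have "infdist x S = 0"
        using infdist_nonneg[of x S] by linarith
      then show "x \<in> S"
        using S in_closed_iff_infdist_zero[of S x] by (simp add: compact_imp_closed)
    qed
    show "S \<subseteq> (\<Inter>k. nbhd S (\<epsilon> k))"
      using subset_nbhd decseq_ge[OF \<epsilon>] by blast
  qed
  ultimately show ?thesis by simp
qed

end

text \<open>A cone of height 1 over the disc of radius \<delta>, divided by its volume
  \<open>Z\<close>. The Lipschitz bound later extends estimates from a finite net to all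
  points.\<close>

lemma mollifier_exists:
  assumes "\<delta> > 0"
  obtains \<eta> :: "real \<times> real \<Rightarrow> real" and L :: real where "\<And>x. \<eta> x \<ge> 0" "L \<ge> 0"
    "\<And>x y. \<bar>\<eta> x - \<eta> y\<bar> \<le> L * norm (x - y)" "\<And>x. \<eta> x \<noteq> 0 \<Longrightarrow> norm x \<le> \<delta>"
    "(\<integral>\<^sup>+x. ennreal (\<eta> x) \<partial>lborel) = 1" "continuous_on UNIV \<eta>" "\<And>x. \<eta> x \<le> \<eta> 0"
proof -
  define t where "t x = max 0 (1 - norm x / \<delta>)" for x :: "real \<times> real"
  have cont: "continuous_on UNIV t"
    unfolding t_def using assms by (intro continuous_intros) auto
  have [measurable]: "t \<in> borel_measurable borel"
    using cont by (rule borel_measurable_continuous_onI)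
  have t: "0 \<le> t x" "t x \<le> 1" "t x \<noteq> 0 \<Longrightarrow> norm x \<le> \<delta>" for x
    using assms by (auto simp: t_def max_def field_simps split: if_splits)
  have "(\<integral>\<^sup>+x. ennreal (t x) \<partial>lborel) \<le> (\<integral>\<^sup>+x. indicator (cball (0 :: real \<times> real) \<delta>) x \<partial>lborel)"
  proof (rule nn_integral_mono)
    fix x
    show "ennreal (t x) \<le> indicator (cball 0 \<delta>) x"
      using t(2,3)[of x] by (cases "t x = 0") auto
  qed
  also have "\<dots> = emeasure lborel (cball (0 :: real \<times> real) \<delta>)"
    by simp
  also have "\<dots> < \<infinity>"
    by (rule emeasure_compact_finite) simp
  finally obtain Z where Z: "(\<integral>\<^sup>+x. ennreal (t x) \<partial>lborel) = ennreal Z" "Z \<ge> 0"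
    by (cases "\<integral>\<^sup>+x. ennreal (t x) \<partial>lborel") auto
  have "Z \<noteq> 0"
  proof
    assume "Z = 0"
    then have "AE x in lborel. t x = 0"
      using Z t by (simp add: nn_integral_0_iff_AE)
    then have "AE x in lborel. x \<notin> ball (0 :: real \<times> real) \<delta>"
      by eventually_elim (use assms in \<open>auto simp: t_def max_def field_simps split: if_splits\<close>)
    then have "ball (0 :: real \<times> real) \<delta> \<in> null_sets lborel"
      by (subst (asm) AE_iff_null_sets[symmetric]) auto
    then have "negligible (ball (0 :: real \<times> real) \<delta>)"
      by (simp add: negligible_iff_null_sets null_sets_completionI)
    then show False
      using open_not_negligible[of "ball (0 :: real \<times> real) \<delta>"] assms by auto
  qed
  with Z have "Z > 0" by simp
  show ?thesis
  proof (rule that[of "\<lambda>x. t x / Z" "1 / (\<delta> * Z)"])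
    show "\<bar>t x / Z - t y / Z\<bar> \<le> 1 / (\<delta> * Z) * norm (x - y)" for x y
    proof -
      have "\<bar>t x - t y\<bar> \<le> \<bar>norm x / \<delta> - norm y / \<delta>\<bar>"
        unfolding t_def by (auto simp: max_def)
      also have "\<dots> = \<bar>norm x - norm y\<bar> / \<delta>"
        using assms by (simp flip: diff_divide_distrib)
      also have "\<dots> \<le> norm (x - y) / \<delta>"
        using assms by (intro divide_right_mono norm_triangle_ineq3) auto
      finally show ?thesis
        using \<open>Z > 0\<close> by (simp add: field_simps flip: diff_divide_distrib)
    qed
    have "(\<integral>\<^sup>+x. ennreal (t x / Z) \<partial>lborel) = (\<integral>\<^sup>+x. ennreal (1 / Z) * ennreal (t x) \<partial>lborel)"
      using t \<open>Z > 0\<close> by (intro nn_integral_cong) (simp flip: ennreal_mult)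
    also have "\<dots> = ennreal (1 / Z) * ennreal Z"
      by (simp add: nn_integral_cmult Z)
    also have "\<dots> = 1"
      using \<open>Z > 0\<close> by (simp flip: ennreal_mult)
    finally show "(\<integral>\<^sup>+x. ennreal (t x / Z) \<partial>lborel) = 1" .
    show "continuous_on UNIV (\<lambda>x. t x / Z)"
      using \<open>Z > 0\<close> by (intro continuous_intros cont) auto
    show "t x / Z \<le> t 0 / Z" for x
      using t(2)[of x] \<open>Z > 0\<close> by (intro divide_right_mono) (auto simp: t_def)
    show "norm x \<le> \<delta>" if "t x / Z \<noteq> 0" for x
      using t(3)[of x] that by (metis div_0)
    show "0 \<le> t x / Z" for x
      using t(1)[of x] \<open>Z > 0\<close> by simp
  qed (use \<open>Z > 0\<close> assms in auto)
qed

text \<open>Collects the properties of the limit measure that drive the estimates: it is carried by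
  \<open>S\<close>, it has density at most \<open>1 / \<alpha>\<close> (stated as a domination of
  integrals), and vertex averages converge to it.\<close>

locale equidistributed =
  fixes S :: "(real \<times> real) set" and \<alpha> :: real and \<Lambda> :: "(real \<times> real) measure"
    and V :: "nat \<Rightarrow> 'a set" and q :: "nat \<Rightarrow> 'a \<Rightarrow> real \<times> real"
  assumes S: "compact S" "S \<noteq> {}" "convex S" and \<alpha>: "measure lborel S = \<alpha>" "\<alpha> > 0"
    and prob: "prob_space \<Lambda>" and sets_\<Lambda> [measurable_cong]: "sets \<Lambda> = sets borel"
    and \<Lambda>_S: "AE x in \<Lambda>. x \<in> S"
    and \<Lambda>_le: "\<And>f. f \<in> borel_measurable borel \<Longrightarrow> (\<integral>\<^sup>+x. f x \<partial>\<Lambda>) \<le> ennreal (1 / \<alpha>) * (\<integral>\<^sup>+x. f x \<partial>lborel)"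
    and V: "\<And>n. n \<ge> 1 \<Longrightarrow> finite (V n) \<and> card (V n) = n"
    and conv: "\<And>f :: real \<times> real \<Rightarrow> real. continuous_on UNIV f \<Longrightarrow> bounded (range f) \<Longrightarrow>
        (\<lambda>n. (\<Sum>v\<in>V n. f (q n v)) / real n) \<longlonglongrightarrow> (\<integral>x. f x \<partial>\<Lambda>)"
begin

text \<open>The test function is 1 on \<open>S\<close>, which carries the limit measure, and 0 off
  the neighbourhood. Its vertex averages tend to 1, which leaves no room for a positive fraction
  outside.\<close>

lemma outside_fraction_tendsto_0:
  assumes "\<delta> > 0"
  shows "(\<lambda>n. card {v \<in> V n. q n v \<notin> nbhd S \<delta>} / real n) \<longlonglongrightarrow> 0"
proof -
  interpret prob_space \<Lambda> by (rule prob)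
  define f where "f x = max 0 (1 - infdist x S / \<delta>)" for x
  have f01: "0 \<le> f x" "f x \<le> 1" for x
    using assms infdist_nonneg[of x S] by (auto simp: f_def)
  have cont: "continuous_on UNIV f"
    unfolding f_def using assms by (intro continuous_intros) auto
  moreover have "bounded (range f)"
  proof (rule boundedI)
    fix y assume "y \<in> range f"
    then obtain x where "y = f x" by blast
    then show "norm y \<le> 1" using f01[of x] by simp
  qed
  ultimately have "(\<lambda>n. (\<Sum>v\<in>V n. f (q n v)) / real n) \<longlonglongrightarrow> (\<integral>x. f x \<partial>\<Lambda>)"
    by (rule conv)
  also have "(\<integral>x. f x \<partial>\<Lambda>) = (\<integral>x. 1 \<partial>\<Lambda>)"
  proof (rule integral_cong_AE)
    show "f \<in> borel_measurable \<Lambda>"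
      using borel_measurable_continuous_onI[OF cont] by measurable
    show "AE x in \<Lambda>. f x = 1"
      using \<Lambda>_S by eventually_elim (auto simp: f_def)
  qed simp
  also have "\<dots> = 1"
    by (simp add: prob_space)
  finally have "(\<lambda>n. 1 - (\<Sum>v\<in>V n. f (q n v)) / real n) \<longlonglongrightarrow> 1 - 1"
    by (intro tendsto_intros)
  then have lim: "(\<lambda>n. 1 - (\<Sum>v\<in>V n. f (q n v)) / real n) \<longlonglongrightarrow> 0"
    by simp
  show ?thesis
  proof (rule tendsto_sandwich[OF _ _ tendsto_const lim])
    show "\<forall>\<^sub>F n in sequentially. card {v \<in> V n. q n v \<notin> nbhd S \<delta>} / real n
        \<le> 1 - (\<Sum>v\<in>V n. f (q n v)) / real n"
      using eventually_ge_at_top[of 1]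
    proof eventually_elim
      case (elim n)
      have "(\<Sum>v\<in>V n. f (q n v)) \<le> (\<Sum>v\<in>V n. 1 - (if q n v \<notin> nbhd S \<delta> then 1 else 0))"
      proof (rule sum_mono)
        fix v
        show "f (q n v) \<le> 1 - (if q n v \<notin> nbhd S \<delta> then 1 else 0)"
          using f01[of "q n v"] assms by (auto simp: f_def nbhd_def)
      qed
      also have "\<dots> = real n - card {v \<in> V n. q n v \<notin> nbhd S \<delta>}"
        using V[OF elim] by (simp add: sum_subtractf sum.If_cases Int_def)
      finally show ?case
        using elim by (simp add: field_simps)
    qed
  qed simp
qed

text \<open>Weak convergence bounds the smeared density at each fixed \<open>x\<close>, hence on a
  finite net for all large \<open>n\<close>, and the Lipschitz constant covers the gaps. Restricting
  to vertices near \<open>S\<close> makes the density vanish off a fixed ball, so that a finite net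
  is enough.\<close>

lemma eventually_density_le:
  fixes \<eta> :: "real \<times> real \<Rightarrow> real"
  assumes \<eta>: "\<And>x. \<eta> x \<ge> 0" "L \<ge> 0" "\<And>x y. \<bar>\<eta> x - \<eta> y\<bar> \<le> L * norm (x - y)"
      "\<And>x. \<eta> x \<noteq> 0 \<Longrightarrow> norm x \<le> \<delta>" "(\<integral>\<^sup>+x. ennreal (\<eta> x) \<partial>lborel) = 1"
      "continuous_on UNIV \<eta>" "\<And>x. \<eta> x \<le> \<eta> 0"
    and c: "c > 1 / \<alpha>"
  shows "\<forall>\<^sub>F n in sequentially. \<forall>x. (\<Sum>v\<in>{v \<in> V n. q n v \<in> nbhd S d}. \<eta> (x - q n v)) / n \<le> c"
proof -
  interpret prob_space \<Lambda> by (rule prob)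
  \<comment> \<open>Half of the slack goes to the limit at the net points, half to the gaps between
    them.\<close>
  define g where "g = (c - 1 / \<alpha>) / 2"
  have g: "g > 0" "1 / \<alpha> + g + g = c"
    using c by (auto simp: g_def field_simps)
  \<comment> \<open>Net spacing with \<open>L * \<tau> \<le> g\<close>; the \<open>+ 1\<close>
    guards against \<open>L = 0\<close>.\<close>
  define \<tau> where "\<tau> = g / (L + 1)"
  have \<tau>: "\<tau> > 0" "L * \<tau> \<le> g"
    using g \<eta>(2) by (auto simp: \<tau>_def field_simps)
  have [measurable]: "\<eta> \<in> borel_measurable borel"
    using \<eta>(6) by (rule borel_measurable_continuous_onI)
  have avg: "\<forall>\<^sub>F n in sequentially. (\<Sum>v\<in>V n. \<eta> (x - q n v)) / n < 1 / \<alpha> + g" for x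
  proof -
    have cont: "continuous_on UNIV (\<lambda>y. \<eta> (x - y))"
      by (intro continuous_on_compose2[OF \<eta>(6)] continuous_intros) auto
    have bdd: "\<bar>\<eta> (x - y)\<bar> \<le> \<eta> 0" for y
      using \<eta>(1,7) by simp
    have lim: "(\<lambda>n. (\<Sum>v\<in>V n. \<eta> (x - q n v)) / real n) \<longlonglongrightarrow> (\<integral>y. \<eta> (x - y) \<partial>\<Lambda>)"
      using bdd by (intro conv cont boundedI[of _ "\<eta> 0"]) auto
    have int: "integrable \<Lambda> (\<lambda>y. \<eta> (x - y))"
      using bdd by (intro integrable_const_bound[of _ "\<eta> 0"]) auto
    have "ennreal (\<integral>y. \<eta> (x - y) \<partial>\<Lambda>) = (\<integral>\<^sup>+y. ennreal (\<eta> (x - y)) \<partial>\<Lambda>)"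
      using int \<eta>(1) by (intro nn_integral_eq_integral[symmetric]) auto
    also have "\<dots> \<le> ennreal (1 / \<alpha>) * (\<integral>\<^sup>+y. ennreal (\<eta> (x - y)) \<partial>lborel)"
      by (rule \<Lambda>_le) measurable
    also have "(\<integral>\<^sup>+y. ennreal (\<eta> (x - y)) \<partial>lborel) = (\<integral>\<^sup>+y. ennreal (\<eta> y) \<partial>lborel)"
    proof -
      have "lborel = distr lborel borel (\<lambda>y :: real \<times> real. x + (-1) *\<^sub>R y)"
        by (subst lborel_affine[of "-1" x]) (auto simp: density_1)
      then have "(\<integral>\<^sup>+y. ennreal (\<eta> y) \<partial>lborel) = (\<integral>\<^sup>+y. ennreal (\<eta> y) \<partial>distr lborel borel (\<lambda>y. x + (-1) *\<^sub>R y))"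
        by simp
      also have "\<dots> = (\<integral>\<^sup>+y. ennreal (\<eta> (x - y)) \<partial>lborel)"
        by (subst nn_integral_distr) auto
      finally show ?thesis ..
    qed
    finally have "(\<integral>y. \<eta> (x - y) \<partial>\<Lambda>) \<le> 1 / \<alpha>"
      using \<alpha> \<eta>(5) by simp
    then show ?thesis
      using g by (intro order_tendstoD[OF lim]) auto
  qed
  obtain R where R: "\<And>x. x \<in> nbhd S (d + \<delta>) \<Longrightarrow> norm x \<le> R"
    using compact_imp_bounded[OF compact_nbhd[OF S(1,2)]] unfolding bounded_iff by blast
  have "compact (cball (0 :: real \<times> real) R)"
    by simp
  then obtain F where F: "finite F" "cball (0 :: real \<times> real) R \<subseteq> (\<Union>x\<in>F. ball x \<tau>)"
    using \<tau>(1) unfolding compact_eq_totally_bounded by auto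
  have "\<forall>\<^sub>F n in sequentially. \<forall>x\<in>F. (\<Sum>v\<in>V n. \<eta> (x - q n v)) / n < 1 / \<alpha> + g"
    using F(1) avg by (simp add: eventually_ball_finite)
  then show ?thesis
    using eventually_ge_at_top[of 1]
  proof eventually_elim
    case (elim n)
    let ?V = "{v \<in> V n. q n v \<in> nbhd S d}"
    have fin: "finite (V n)" and card: "card (V n) = n"
      using V elim by auto
    show ?case
    proof
      fix x
      show "(\<Sum>v\<in>?V. \<eta> (x - q n v)) / n \<le> c"
      proof (cases "norm x \<le> R")
        case True
        then have "x \<in> cball 0 R"
          by simp
        with F(2) have "x \<in> (\<Union>y\<in>F. ball y \<tau>)"
          by (rule subsetD)
        then obtain y where y: "y \<in> F" "dist y x < \<tau>"
          unfolding UN_iff mem_ball by blast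
        have "(\<Sum>v\<in>?V. \<eta> (x - q n v)) \<le> (\<Sum>v\<in>V n. \<eta> (x - q n v))"
          using fin \<eta>(1) by (intro sum_mono2) auto
        also have "\<dots> \<le> (\<Sum>v\<in>V n. \<eta> (y - q n v) + g)"
        proof (rule sum_mono)
          fix v
          have "\<bar>\<eta> (x - q n v) - \<eta> (y - q n v)\<bar> \<le> L * norm (x - y)"
            using \<eta>(3)[of "x - q n v" "y - q n v"] by simp
          also have "\<dots> \<le> L * \<tau>"
            using y \<eta>(2) by (intro mult_left_mono) (auto simp: dist_norm norm_minus_commute)
          finally show "\<eta> (x - q n v) \<le> \<eta> (y - q n v) + g"
            using \<tau>(2) by linarith
        qed
        also have "\<dots> = (\<Sum>v\<in>V n. \<eta> (y - q n v)) + n * g"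
          by (simp add: sum.distrib card)
        also have "\<dots> \<le> n * c"
          using elim(1)[rule_format, OF y(1)] elim(2) by (simp add: g(2)[symmetric] field_simps)
        finally show ?thesis
          using elim(2) by (simp add: field_simps)
      next
        case False
        have "\<eta> (x - q n v) = 0" if "v \<in> ?V" for v
        proof (rule ccontr)
          assume "\<eta> (x - q n v) \<noteq> 0"
          then have "x \<in> cball (q n v) \<delta>"
            using \<eta>(4) by (auto simp: dist_norm norm_minus_commute)
          then have "x \<in> nbhd S (d + \<delta>)"
            using that cball_subset_nbhd[OF S(1,2), of "q n v" d \<delta>] by auto
          then show False
            using R False by blast
        qed
        then have "(\<Sum>v\<in>?V. \<eta> (x - q n v)) = 0"
          by (intro sum.neutral) auto
        moreover have "0 \<le> c"
          using c \<alpha> by (auto intro: order_trans[of 0 "1 / \<alpha>"])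
        ultimately show ?thesis by simp
      qed
    qed
  qed
qed

end

context equidistributed
begin

text \<open>A discarded pair has an end point outside the neighbourhood, so at most
  \<open>2 n\<close> times the number of such vertices are lost, which is o(n^2).\<close>

lemma restricted_pairs_tendsto:
  assumes D: "\<And>n. n \<ge> 1 \<Longrightarrow> D n \<subseteq> V n \<times> V n" and m: "(\<lambda>n. card (D n) / (real n)\<^sup>2) \<longlonglongrightarrow> m"
    and "\<delta> > 0"
  shows "(\<lambda>n. card {(a, b) \<in> D n. q n a \<in> nbhd S \<delta> \<and> q n b \<in> nbhd S \<delta>} / (real n)\<^sup>2) \<longlonglongrightarrow> m"
    (is "(\<lambda>n. card (?D n) / _) \<longlonglongrightarrow> _")
proof -
  let ?o = "\<lambda>n. {v \<in> V n. q n v \<notin> nbhd S \<delta>}"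
  have "(\<lambda>n. card (D n) / (real n)\<^sup>2 - 2 * (card (?o n) / real n)) \<longlonglongrightarrow> m - 2 * 0"
    by (intro tendsto_intros m outside_fraction_tendsto_0 assms)
  then have lim: "(\<lambda>n. card (D n) / (real n)\<^sup>2 - 2 * (card (?o n) / real n)) \<longlonglongrightarrow> m"
    by simp
  show ?thesis
  proof (rule tendsto_sandwich[OF _ _ lim m])
    have fin: "finite (D n)" if "n \<ge> 1" for n
      using D[OF that] V[OF that] by (meson finite_SigmaI finite_subset)
    show "\<forall>\<^sub>F n in sequentially. card (?D n) / (real n)\<^sup>2 \<le> card (D n) / (real n)\<^sup>2"
      using eventually_ge_at_top[of 1]
      by eventually_elim (auto intro!: divide_right_mono card_mono fin)
    show "\<forall>\<^sub>F n in sequentially. card (D n) / (real n)\<^sup>2 - 2 * (card (?o n) / real n) \<le> card (?D n) / (real n)\<^sup>2"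
      using eventually_ge_at_top[of 1]
    proof eventually_elim
      case (elim n)
      have finV: "finite (V n)" and cardV: "card (V n) = n"
        using V[OF elim] by auto
      have "D n \<subseteq> ?D n \<union> (?o n \<times> V n \<union> V n \<times> ?o n)"
        using D[OF elim] by auto
      then have "card (D n) \<le> card (?D n \<union> (?o n \<times> V n \<union> V n \<times> ?o n))"
        using finV finite_subset[OF _ fin[OF elim], of "?D n"] by (intro card_mono) auto
      also have "\<dots> \<le> card (?D n) + (card (?o n \<times> V n) + card (V n \<times> ?o n))"
        by (intro order_trans[OF card_Un_le] add_left_mono card_Un_le)
      also have "\<dots> = card (?D n) + 2 * n * card (?o n)"
        by (simp add: card_cartesian_product cardV)
      finally have "real (card (D n)) \<le> real (card (?D n) + 2 * n * card (?o n))"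
        by (rule of_nat_mono)
      then have "real (card (D n)) \<le> real (card (?D n)) + 2 * real n * real (card (?o n))"
        by (simp only: of_nat_add of_nat_mult of_nat_numeral)
      then have "(real (card (D n)) - 2 * real n * real (card (?o n))) / (real n)\<^sup>2 \<le> card (?D n) / (real n)\<^sup>2"
        by (intro divide_right_mono) auto
      also have "(real (card (D n)) - 2 * real n * real (card (?o n))) / (real n)\<^sup>2
          = card (D n) / (real n)\<^sup>2 - 2 * (card (?o n) / real n)"
        using elim by (simp add: field_simps power2_eq_square)
      finally show ?case .
    qed
  qed
qed

text \<open>The case of \<open>mollified_energy\<close> at a fixed scale and large \<open>n\<close>.
  A kept vertex is within \<delta> of \<open>S\<close> and is smeared by another \<delta>, hence the
  neighbourhood of width \<open>2 * \<delta>\<close> and, as \<open>\<delta> \<le> 1\<close>, the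
  radius \<open>B + 2\<close>.\<close>

lemma strict_crossings_mollified_bound:
  assumes D: "\<And>n. n \<ge> 1 \<Longrightarrow> D n \<subseteq> V n \<times> V n"
    and \<delta>: "0 < \<delta>" "\<delta> \<le> 1" and c: "c > 1 / \<alpha>" and B: "\<And>a. a \<in> S \<Longrightarrow> norm a \<le> B" and R: "R = B + 2"
    and T: "near_collinear_mass (cball 0 R) (16 * R * \<delta>) = ennreal T" "T \<ge> 0"
    and A: "A = measure lborel (nbhd S (2 * \<delta>))"
  shows "\<forall>\<^sub>F n in sequentially.
    8 / (9 * pi\<^sup>2) * (card {(a, b) \<in> D n. q n a \<in> nbhd S \<delta> \<and> q n b \<in> nbhd S \<delta>} / (real n)\<^sup>2) ^ 3
    \<le> A\<^sup>2 * c\<^sup>2 * (card {((a, a'), (b, b')). (a, a') \<in> D n \<and> (b, b') \<in> D n \<and>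
          strict_cross (q n a) (q n a') (q n b) (q n b')} / real n ^ 4 + (c\<^sup>2)\<^sup>2 * (4 * (T * A)))"
proof -
  obtain \<eta> :: "real \<times> real \<Rightarrow> real" and L where \<eta>: "\<And>x. \<eta> x \<ge> 0" "L \<ge> 0"
    "\<And>x y. \<bar>\<eta> x - \<eta> y\<bar> \<le> L * norm (x - y)" "\<And>x. \<eta> x \<noteq> 0 \<Longrightarrow> norm x \<le> \<delta>"
    "(\<integral>\<^sup>+x. ennreal (\<eta> x) \<partial>lborel) = 1" "continuous_on UNIV \<eta>" "\<And>x. \<eta> x \<le> \<eta> 0"
    using mollifier_exists[OF \<delta>(1)] by metis
  have [measurable]: "\<eta> \<in> borel_measurable borel"
    using \<eta>(6) by (rule borel_measurable_continuous_onI)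
  have "c > 0"
    using c \<alpha> by (auto intro: less_trans[of 0 "1 / \<alpha>"])
  define K where "K = nbhd S (2 * \<delta>)"
  have cptK: "compact K"
    unfolding K_def by (rule compact_nbhd[OF S(1,2)])
  have eA: "emeasure lborel K = ennreal A"
    using emeasure_compact_finite[OF cptK] by (simp add: A K_def emeasure_eq_ennreal_measure)
  have A_pos: "A > 0"
  proof -
    have "emeasure lborel S \<le> emeasure lborel K"
      using subset_nbhd[OF S(1,2), of "2 * \<delta>"] \<delta> closed_nbhd by (intro emeasure_mono) (auto simp: K_def)
    then have "measure lborel S \<le> A"
      using emeasure_compact_finite[OF S(1)] by (simp add: eA emeasure_eq_ennreal_measure A)
    then show ?thesis using \<alpha> by simp
  qed
  have K_R: "norm x \<le> R" if "x \<in> K" for x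
    using nbhd_norm_le[OF S(1,2) B, of x "2 * \<delta>"] that \<delta> by (simp add: R K_def)
  have T': "near_collinear_mass K (16 * R * \<delta>) \<le> ennreal T"
    unfolding T(1)[symmetric] using K_R by (intro near_collinear_mass_mono) auto
  have "\<forall>\<^sub>F n in sequentially. \<forall>x. (\<Sum>v\<in>{v \<in> V n. q n v \<in> nbhd S \<delta>}. \<eta> (x - q n v)) / n \<le> c"
    by (rule eventually_density_le[OF \<eta>(1-3) _ \<eta>(5-7) c]) (rule \<eta>(4))
  then show ?thesis
    using eventually_ge_at_top[of 1]
  proof eventually_elim
    case (elim n)
    let ?V = "{v \<in> V n. q n v \<in> nbhd S \<delta>}"
    let ?D = "{(a, b) \<in> D n. q n a \<in> nbhd S \<delta> \<and> q n b \<in> nbhd S \<delta>}"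
    let ?S = "\<lambda>D. {((a, a'), (b, b')). (a, a') \<in> D \<and> (b, b') \<in> D \<and> strict_cross (q n a) (q n a') (q n b) (q n b')}"
    have finD: "finite (D n)"
      using D[OF elim(2)] V[OF elim(2)] by (meson finite_SigmaI finite_subset)
    have fin: "finite ?D"
      using finD by (rule rev_finite_subset) auto
    have finV: "finite ?V"
      using V[OF elim(2)] by simp
    have "ennreal (8 / (9 * pi\<^sup>2) * (card ?D / (real n)\<^sup>2) ^ 3) \<le> ennreal (A\<^sup>2 * c\<^sup>2) *
      (ennreal (card (?S ?D) / real n ^ 4)
        + ennreal ((c\<^sup>2)\<^sup>2) * (4 * (near_collinear_mass K (16 * R * \<delta>) * ennreal A)))"
    proof (rule mollified_energy[where \<eta> = "\<lambda>x. ennreal (\<eta> x)"])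
      show "convex K"
        unfolding K_def by (rule convex_nbhd[OF S])
      show "K \<in> sets borel"
        unfolding K_def using closed_nbhd by auto
      show "cball (q n a) \<delta> \<subseteq> K \<and> cball (q n b) \<delta> \<subseteq> K" if "(a, b) \<in> ?D" for a b
        using that cball_subset_nbhd[OF S(1,2), of _ \<delta> \<delta>] by (simp add: K_def)
      show "ennreal (1 / (real n)\<^sup>2) * (\<Sum>(a, b)\<in>?D. ennreal (\<eta> (x - q n a)) * ennreal (\<eta> (y - q n b))) \<le> ennreal (c\<^sup>2)" for x y
      proof -
        have density: "(\<Sum>a\<in>?V. \<eta> (z - q n a)) \<le> n * c" for z
          using elim(1)[rule_format, of z] elim(2) by (simp add: field_simps)
        \<comment> \<open>Adding the nonnegative terms of the missing pairs makes the sum factor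
          into two vertex sums, each at most \<open>n * c\<close>.\<close>
        have "(\<Sum>(a, b)\<in>?D. \<eta> (x - q n a) * \<eta> (y - q n b)) \<le> (\<Sum>(a, b)\<in>?V \<times> ?V. \<eta> (x - q n a) * \<eta> (y - q n b))"
          using D[OF elim(2)] finV by (intro sum_mono2) (auto intro!: mult_nonneg_nonneg \<eta>(1))
        also have "\<dots> = (\<Sum>a\<in>?V. \<eta> (x - q n a)) * (\<Sum>b\<in>?V. \<eta> (y - q n b))"
          by (simp add: sum_product sum.cartesian_product)
        also have "\<dots> \<le> (n * c) * (n * c)"
          using \<open>c > 0\<close> by (intro mult_mono sum_nonneg \<eta>(1) density) simp
        finally have "1 / (real n)\<^sup>2 * (\<Sum>(a, b)\<in>?D. \<eta> (x - q n a) * \<eta> (y - q n b)) \<le> c\<^sup>2"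
          using elim(2) by (simp add: field_simps power2_eq_square)
        then have "ennreal (1 / (real n)\<^sup>2 * (\<Sum>(a, b)\<in>?D. \<eta> (x - q n a) * \<eta> (y - q n b))) \<le> ennreal (c\<^sup>2)"
          by (rule ennreal_leI)
        moreover have "(\<Sum>(a, b)\<in>?D. ennreal (\<eta> (x - q n a)) * ennreal (\<eta> (y - q n b)))
            = ennreal (\<Sum>(a, b)\<in>?D. \<eta> (x - q n a) * \<eta> (y - q n b))"
          by (subst sum_ennreal[symmetric])
            (auto simp: case_prod_beta ennreal_mult[OF \<eta>(1) \<eta>(1)] intro!: mult_nonneg_nonneg \<eta>(1))
        moreover have "ennreal (1 / (real n)\<^sup>2 * (\<Sum>(a, b)\<in>?D. \<eta> (x - q n a) * \<eta> (y - q n b)))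
            = ennreal (1 / (real n)\<^sup>2) * ennreal (\<Sum>(a, b)\<in>?D. \<eta> (x - q n a) * \<eta> (y - q n b))"
          by (intro ennreal_mult sum_nonneg) (auto intro!: mult_nonneg_nonneg \<eta>(1))
        ultimately show ?thesis
          by (simp only:)
      qed
      show "\<And>x. x \<in> K \<Longrightarrow> norm x \<le> R"
        by (rule K_R)
      show "\<And>x. ennreal (\<eta> x) \<noteq> 0 \<Longrightarrow> norm x \<le> \<delta>"
        by (rule \<eta>(4)) auto
    qed (use fin elim \<eta>(5) eA A_pos \<open>c > 0\<close> \<delta> in auto)
    also have "\<dots> \<le> ennreal (A\<^sup>2 * c\<^sup>2) * (ennreal (card (?S (D n)) / real n ^ 4) + ennreal ((c\<^sup>2)\<^sup>2) * (4 * (ennreal T * ennreal A)))"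
    proof (intro mult_left_mono add_mono mult_right_mono T')
      have "?S ?D \<subseteq> ?S (D n)"
        by auto
      moreover have "finite (?S (D n))"
        by (rule finite_subset[of _ "D n \<times> D n"]) (use finD in auto)
      ultimately show "ennreal (card (?S ?D) / real n ^ 4) \<le> ennreal (card (?S (D n)) / real n ^ 4)"
        by (intro ennreal_leI divide_right_mono) (auto intro: card_mono)
    qed auto
    also have "\<dots> = ennreal (A\<^sup>2 * c\<^sup>2 * (card (?S (D n)) / real n ^ 4 + (c\<^sup>2)\<^sup>2 * (4 * (T * A))))"
    proof -
      have "4 * (ennreal T * ennreal A) = ennreal (4 * (T * A))"
        using T(2) A_pos by (simp add: ennreal_mult)
      have distrib: "ennreal u * (ennreal s + ennreal v * ennreal w) = ennreal (u * (s + v * w))"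
        if "u \<ge> 0" "s \<ge> 0" "v \<ge> 0" "w \<ge> 0" for u s v w
        using that by (simp add: ennreal_mult)
      show ?thesis
        unfolding \<open>4 * (ennreal T * ennreal A) = ennreal (4 * (T * A))\<close>
        by (rule distrib) (use T(2) A_pos in simp_all)
    qed
    finally have "ennreal (8 / (9 * pi\<^sup>2) * (card ?D / (real n)\<^sup>2) ^ 3)
      \<le> ennreal (A\<^sup>2 * c\<^sup>2 * (card (?S (D n)) / real n ^ 4 + (c\<^sup>2)\<^sup>2 * (4 * (T * A))))" .
    moreover have "0 \<le> A\<^sup>2 * c\<^sup>2 * (card (?S (D n)) / real n ^ 4 + (c\<^sup>2)\<^sup>2 * (4 * (T * A)))"
    proof -
      have nonneg: "0 \<le> A\<^sup>2 * c\<^sup>2 * (s + (c\<^sup>2)\<^sup>2 * (4 * (T * A)))" if "s \<ge> 0" for s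
        using that T(2) A_pos by simp
      show ?thesis
        by (rule nonneg) (intro divide_nonneg_nonneg zero_le_power of_nat_0_le_iff)
    qed
    ultimately show ?case
      by (simp only: ennreal_le_iff)
  qed
qed

text \<open>At scale \<open>d k\<close> the bound obtained for large \<open>n\<close> is governed by
  \<open>f k m\<close>, which tends to the target as \<open>k\<close> grows. A \<open>k\<close> that
  loses less than \<gamma> is fixed first, and only then does \<open>n\<close> tend to
  infinity.\<close>

lemma eventually_strict_crossings:
  assumes D: "\<And>n. n \<ge> 1 \<Longrightarrow> D n \<subseteq> V n \<times> V n" and m: "(\<lambda>n. card (D n) / (real n)\<^sup>2) \<longlonglongrightarrow> m"
    and "\<gamma> > 0"
  shows "\<forall>\<^sub>F n in sequentially. 8 / (9 * pi\<^sup>2) * m ^ 3 - \<gamma>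
    \<le> card {((a, a'), (b, b')). (a, a') \<in> D n \<and> (b, b') \<in> D n \<and>
          strict_cross (q n a) (q n a') (q n b) (q n b')} / real n ^ 4"
proof -
  obtain B where B: "\<And>a. a \<in> S \<Longrightarrow> norm a \<le> B"
    using compact_imp_bounded[OF S(1)] unfolding bounded_iff by blast
  have "B \<ge> 0"
    using B S(2) norm_ge_zero order_trans by blast
  define R where "R = B + 2"
  define d where "d k = 1 / real (Suc k)" for k
  have d: "d k > 0" "d k \<le> 1" for k
    by (auto simp: d_def)
  have d_lim: "d \<longlonglongrightarrow> 0"
    unfolding d_def using LIMSEQ_inverse_real_of_nat by (simp add: inverse_eq_divide)
  have dec: "decseq (\<lambda>k. r * d k)" if "r \<ge> 0" for r
    using that unfolding d_def decseq_def by (auto intro!: mult_left_mono divide_left_mono)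
  have d_lim': "(\<lambda>k. r * d k) \<longlonglongrightarrow> 0" for r
    using tendsto_mult_left[OF d_lim, of r] by simp
  define A where "A k = measure lborel (nbhd S (2 * d k))" for k
  define c where "c k = (1 + d k) / \<alpha>" for k
  define T where "T k = near_collinear_mass (cball 0 R) (16 * R * d k)" for k
  have A_lim: "A \<longlonglongrightarrow> \<alpha>"
    unfolding A_def \<alpha>(1)[symmetric] by (rule measure_nbhd_tendsto[OF S(1,2) dec d_lim']) simp
  have c_lim: "c \<longlonglongrightarrow> (1 + 0) / \<alpha>"
    unfolding c_def using \<alpha> by (intro tendsto_intros d_lim) auto
  have T_lim: "T \<longlonglongrightarrow> 0"
    unfolding T_def using \<open>B \<ge> 0\<close>
    by (intro near_collinear_mass_tendsto_0 dec d_lim') (auto simp: R_def)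
  have t_lim: "(\<lambda>k. enn2real (T k)) \<longlonglongrightarrow> 0"
    using tendsto_enn2real[OF T_lim[folded ennreal_0]] by simp
  define f where "f k x = 8 / (9 * pi\<^sup>2) * x ^ 3 / ((A k)\<^sup>2 * (c k)\<^sup>2)
    - ((c k)\<^sup>2)\<^sup>2 * (4 * (enn2real (T k) * A k))" for k x
  \<comment> \<open>\<open>A k * c k\<close> tends to \<open>\<alpha> * (1 / \<alpha>)\<close>,
    which is 1, and the near-collinear mass to 0, so the area disappears from the limit.\<close>
  have "(\<lambda>k. f k m) \<longlonglongrightarrow> 8 / (9 * pi\<^sup>2) * m ^ 3 / (\<alpha>\<^sup>2 * ((1 + 0) / \<alpha>)\<^sup>2) - (((1 + 0) / \<alpha>)\<^sup>2)\<^sup>2 * (4 * (0 * \<alpha>))"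
    unfolding f_def using \<alpha>(2) by (intro tendsto_intros A_lim c_lim t_lim) auto
  also have "8 / (9 * pi\<^sup>2) * m ^ 3 / (\<alpha>\<^sup>2 * ((1 + 0) / \<alpha>)\<^sup>2) - (((1 + 0) / \<alpha>)\<^sup>2)\<^sup>2 * (4 * (0 * \<alpha>)) = 8 / (9 * pi\<^sup>2) * m ^ 3"
    using \<alpha>(2) by (simp add: field_simps)
  finally have "\<forall>\<^sub>F k in sequentially. 8 / (9 * pi\<^sup>2) * m ^ 3 - \<gamma> < f k m"
    using \<open>\<gamma> > 0\<close> by (intro order_tendstoD) auto
  \<comment> \<open>Serves to make \<open>T k\<close> finite, so that \<open>enn2real\<close>
    returns its true value.\<close>
  moreover have "\<forall>\<^sub>F k in sequentially. T k < 1"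
    using order_tendstoD(2)[OF T_lim, of 1] by simp
  moreover have "\<forall>\<^sub>F k in sequentially. 0 < A k"
    using order_tendstoD(1)[OF A_lim \<alpha>(2)] .
  ultimately have "\<forall>\<^sub>F k in sequentially. 8 / (9 * pi\<^sup>2) * m ^ 3 - \<gamma> < f k m \<and> T k < 1 \<and> 0 < A k"
    by eventually_elim auto
  then obtain k where k: "8 / (9 * pi\<^sup>2) * m ^ 3 - \<gamma> < f k m" "T k < 1" "0 < A k"
    by (auto simp: eventually_sequentially)
  have c: "c k > 1 / \<alpha>"
    using \<alpha>(2) d[of k] by (auto simp: c_def field_simps)
  then have "c k > 0"
    using \<alpha>(2) by (auto intro: less_trans[of 0 "1 / \<alpha>"])
  have T: "near_collinear_mass (cball 0 R) (16 * R * d k) = ennreal (enn2real (T k))"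
    using order.strict_trans[OF k(2) ennreal_one_less_top] by (simp add: T_def)
  let ?m = "\<lambda>n. card {(a, b) \<in> D n. q n a \<in> nbhd S (d k) \<and> q n b \<in> nbhd S (d k)} / (real n)\<^sup>2"
  have "(\<lambda>n. f k (?m n)) \<longlonglongrightarrow> f k m"
    unfolding f_def using \<open>c k > 0\<close> k(3) D
    by (intro tendsto_intros restricted_pairs_tendsto m d) auto
  then have "\<forall>\<^sub>F n in sequentially. 8 / (9 * pi\<^sup>2) * m ^ 3 - \<gamma> < f k (?m n)"
    using k(1) by (rule order_tendstoD)
  moreover have "\<forall>\<^sub>F n in sequentially. 8 / (9 * pi\<^sup>2) * ?m n ^ 3
      \<le> (A k)\<^sup>2 * (c k)\<^sup>2 * (card {((a, a'), (b, b')). (a, a') \<in> D n \<and> (b, b') \<in> D n \<and>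
          strict_cross (q n a) (q n a') (q n b) (q n b')} / real n ^ 4 + ((c k)\<^sup>2)\<^sup>2 * (4 * (enn2real (T k) * A k)))"
    by (rule strict_crossings_mollified_bound[OF _ d c _ R_def T enn2real_nonneg A_def]) (fact D, fact B)
  ultimately show ?thesis
  proof eventually_elim
    case (elim n)
    have pos: "(A k)\<^sup>2 * (c k)\<^sup>2 > 0"
      using k(3) \<open>c k > 0\<close> by simp
    from elim(2) have "8 / (9 * pi\<^sup>2) * ?m n ^ 3 / ((A k)\<^sup>2 * (c k)\<^sup>2)
        \<le> card {((a, a'), (b, b')). (a, a') \<in> D n \<and> (b, b') \<in> D n \<and>
          strict_cross (q n a) (q n a') (q n b) (q n b')} / real n ^ 4 + ((c k)\<^sup>2)\<^sup>2 * (4 * (enn2real (T k) * A k))"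
      by (subst pos_divide_le_eq[OF pos]) (simp only: mult.commute)
    with elim(1) show ?case
      unfolding f_def by linarith
  qed
qed

end

section \<open>Straight-line drawings\<close>

text \<open>The theorem is stated in \<open>real^2\<close>, the integrals are computed in
  \<open>real \<times> real\<close>, where Lebesgue measure is a product. This linear bijection
  preserves Lebesgue measure and maps segments to segments.\<close>

definition coords :: "real^2 \<Rightarrow> real \<times> real" where
  "coords x = (x $ 1, x $ 2)"

lemma linear_coords: "linear coords"
  by (auto simp: coords_def linear_iff)

lemma inj_coords: "inj coords"
  by (auto simp: inj_def coords_def vec_eq_iff forall_2)

lemma continuous_on_coords: "continuous_on A coords"
  unfolding coords_def by (intro continuous_intros)

lemma measurable_coords [measurable]: "coords \<in> borel_measurable borel"
  by (rule borel_measurable_continuous_onI) (rule continuous_on_coords)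

lemma distr_lborel_coords: "distr lborel borel coords = lborel"
proof (rule lborel_eqI[symmetric])
  fix l u :: "real \<times> real"
  assume le: "\<And>b. b \<in> Basis \<Longrightarrow> l \<bullet> b \<le> u \<bullet> b"
  obtain l1 l2 u1 u2 where lu: "l = (l1, l2)" "u = (u1, u2)"
    by (cases l, cases u)
  have "l1 \<le> u1" "l2 \<le> u2"
    using le[of "(1, 0)"] le[of "(0, 1)"] by (auto simp: lu Basis_prod_def)
  have basis: "(Basis :: (real^2) set) = {axis 1 1, axis 2 1}"
    by (auto simp: Basis_vec_def UNIV_2)
  have ne: "axis 1 (1 :: real) \<noteq> (axis 2 1 :: real^2)"
    by (simp add: axis_eq_axis)
  have "coords -` box l u \<inter> space lborel = box (vector [l1, l2]) (vector [u1, u2])"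
    by (auto simp: coords_def lu mem_box_cart forall_2 mem_box Basis_prod_def)
  moreover have "emeasure lborel (box (vector [l1, l2]) (vector [u1, u2] :: real^2)) = ennreal ((u1 - l1) * (u2 - l2))"
    using \<open>l1 \<le> u1\<close> \<open>l2 \<le> u2\<close> ne
    by (subst emeasure_lborel_box) (auto simp: basis inner_axis)
  moreover have "(\<Prod>b\<in>Basis. (u - l) \<bullet> b) = (u1 - l1) * (u2 - l2)"
    by (simp add: lu Basis_prod_def)
  ultimately show "emeasure (distr lborel borel coords) (box l u) = (\<Prod>b\<in>Basis. (u - l) \<bullet> b)"
    by (subst emeasure_distr) auto
qed simp

text \<open>A nonempty interior makes the area positive, so the uniform measure is a probability
  measure. Its density is \<open>1 / \<alpha>\<close> on the set and 0 elsewhere; dropping the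
  indicator gives the domination of integrals.\<close>

lemma equidistributed_coords:
  fixes \<Omega> :: "(real^2) set" and V :: "nat \<Rightarrow> 'a set"
  assumes \<Omega>: "compact \<Omega>" "convex \<Omega>" "interior \<Omega> \<noteq> {}"
    and V: "\<And>n. n \<ge> 1 \<Longrightarrow> finite (V n) \<and> card (V n) = n" and unif: "uniform_in \<Omega> V p"
  shows "equidistributed (coords ` \<Omega>) (measure lborel (coords ` \<Omega>))
    (distr (uniform_measure lborel \<Omega>) borel coords) V (\<lambda>n v. coords (p n v))"
proof -
  let ?S = "coords ` \<Omega>" and ?U = "uniform_measure lborel \<Omega>"
  define \<alpha> where "\<alpha> = measure lborel ?S"
  have [measurable]: "\<Omega> \<in> sets borel"
    using \<Omega>(1) by (simp add: compact_imp_closed)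
  have cptS: "compact ?S"
    using \<Omega>(1) continuous_on_coords by (rule compact_continuous_image[rotated])
  have "coords -` ?S = \<Omega>"
    by (rule inj_vimage_image_eq[OF inj_coords])
  moreover have "emeasure lborel ?S = emeasure (distr lborel borel coords) ?S"
    by (simp add: distr_lborel_coords)
  ultimately have "emeasure lborel \<Omega> = emeasure lborel ?S"
    using cptS by (subst (asm) emeasure_distr) (auto simp: compact_imp_closed)
  also have "\<dots> = ennreal \<alpha>"
    using emeasure_compact_finite[OF cptS] by (simp add: \<alpha>_def emeasure_eq_ennreal_measure)
  finally have \<alpha>: "emeasure lborel \<Omega> = ennreal \<alpha>" .
  have "emeasure lborel \<Omega> \<noteq> 0"
  proof
    assume "emeasure lborel \<Omega> = 0"
    then have "\<Omega> \<in> null_sets lborel"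
      by (simp add: null_sets_def)
    then have "negligible \<Omega>"
      by (simp add: negligible_iff_null_sets null_sets_completionI)
    then have "negligible (interior \<Omega>)"
      by (rule negligible_subset) (rule interior_subset)
    then show False
      using open_not_negligible[OF open_interior \<Omega>(3)] by simp
  qed
  then have "\<alpha> > 0"
    using \<alpha> by (cases "\<alpha> > 0") (simp_all add: ennreal_neg)
  have prob: "prob_space ?U"
    using \<open>\<alpha> > 0\<close> by (intro prob_space_uniform_measure) (auto simp: \<alpha>)
  have [measurable]: "coords \<in> measurable ?U borel"
    by simp
  have "equidistributed ?S \<alpha> (distr ?U borel coords) V (\<lambda>n v. coords (p n v))"
  proof (rule equidistributed.intro)
    show "compact ?S" by (rule cptS)
    show "?S \<noteq> {}" using \<Omega>(3) interior_subset by auto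
    show "convex ?S" using \<Omega>(2) linear_coords by (rule convex_linear_image[rotated])
    show "measure lborel ?S = \<alpha>" "\<alpha> > 0" by (simp_all add: \<alpha>_def[symmetric] \<open>\<alpha> > 0\<close>)
    show "prob_space (distr ?U borel coords)"
      by (rule prob_space.prob_space_distr[OF prob]) simp
    show "sets (distr ?U borel coords) = sets borel" by simp
    show "AE x in distr ?U borel coords. x \<in> ?S"
    proof (subst AE_distr_iff)
      show "AE x in ?U. coords x \<in> ?S"
        by (rule AE_uniform_measureI) auto
    qed (use cptS in \<open>auto simp: compact_imp_closed\<close>)
    show "(\<integral>\<^sup>+x. f x \<partial>distr ?U borel coords) \<le> ennreal (1 / \<alpha>) * (\<integral>\<^sup>+x. f x \<partial>lborel)"
      if [measurable]: "f \<in> borel_measurable borel" for f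
    proof -
      have "(\<integral>\<^sup>+x. f x \<partial>distr ?U borel coords) = (\<integral>\<^sup>+x. f (coords x) \<partial>?U)"
        by (subst nn_integral_distr) auto
      also have "\<dots> = (\<integral>\<^sup>+x. f (coords x) * indicator \<Omega> x \<partial>lborel) / emeasure lborel \<Omega>"
        by (subst nn_integral_uniform_measure) auto
      also have "\<dots> \<le> (\<integral>\<^sup>+x. f (coords x) \<partial>lborel) / emeasure lborel \<Omega>"
        by (intro divide_right_mono_ennreal nn_integral_mono) (auto simp: indicator_def)
      also have "(\<integral>\<^sup>+x. f (coords x) \<partial>lborel) = (\<integral>\<^sup>+x. f x \<partial>distr lborel borel coords)"
        by (subst nn_integral_distr) auto
      also have "\<dots> = (\<integral>\<^sup>+x. f x \<partial>lborel)"
        by (simp add: distr_lborel_coords)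
      also have "\<dots> / emeasure lborel \<Omega> = ennreal (1 / \<alpha>) * \<dots>"
        using \<open>\<alpha> > 0\<close> by (simp add: \<alpha> divide_ennreal_def inverse_ennreal mult.commute inverse_eq_divide)
      finally show ?thesis .
    qed
    show "n \<ge> 1 \<Longrightarrow> finite (V n) \<and> card (V n) = n" for n
      by (rule V)
    show "(\<lambda>n. (\<Sum>v\<in>V n. f (coords (p n v))) / real n) \<longlonglongrightarrow> (\<integral>x. f x \<partial>distr ?U borel coords)"
      if f: "continuous_on UNIV f" "bounded (range f)" for f :: "real \<times> real \<Rightarrow> real"
    proof -
      have "continuous_on UNIV (\<lambda>x. f (coords x))"
        by (rule continuous_on_compose2[OF f(1) continuous_on_coords]) auto
      moreover have "bounded (range (\<lambda>x. f (coords x)))"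
        by (rule bounded_subset[OF f(2)]) auto
      ultimately have "(\<lambda>n. (\<Sum>v\<in>V n. f (coords (p n v))) / real n) \<longlonglongrightarrow> (\<integral>x. f (coords x) \<partial>?U)"
        using unif unfolding uniform_in_def by blast
      also have "(\<integral>x. f (coords x) \<partial>?U) = (\<integral>x. f x \<partial>distr ?U borel coords)"
        using borel_measurable_continuous_onI[OF f(1)] by (subst integral_distr) auto
      finally show ?thesis .
    qed
  qed
  then show ?thesis
    by (simp add: \<alpha>_def)
qed

section \<open>Counting crossings with multiplicity\<close>

lemma card_le_mult_fibres:
  assumes "finite B" "f ` A \<subseteq> B" "\<And>b. b \<in> B \<Longrightarrow> card {a \<in> A. f a = b} \<le> k"
  shows "card A \<le> k * card B"
proof -
  have "A = (\<Union>b\<in>B. {a \<in> A. f a = b})"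
    using assms(2) by auto
  then have "card A \<le> (\<Sum>b\<in>B. card {a \<in> A. f a = b})"
    using card_UN_le[OF assms(1), of "\<lambda>b. {a \<in> A. f a = b}"] by simp
  also have "\<dots> \<le> (\<Sum>b\<in>B. k)"
    by (intro sum_mono assms)
  finally show ?thesis by (simp add: mult.commute)
qed

lemma ordered_pairs_of_edge:
  assumes "card e = 2"
  shows "finite {(a, b). {a, b} = e}" "card {(a, b). {a, b} = e} = 2"
proof -
  obtain u v where uv: "e = {u, v}" "u \<noteq> v"
    using assms by (auto simp: card_2_iff)
  have "{(a, b). {a, b} = e} = {(u, v), (v, u)}"
    by (auto simp: uv doubleton_eq_iff)
  then show "finite {(a, b). {a, b} = e}" "card {(a, b). {a, b} = e} = 2"
    using uv(2) by auto
qed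

lemma card_ordered_edges:
  assumes "simple_graph V E"
  shows "card {(a, b). {a, b} \<in> E} = 2 * card E"
proof -
  have "finite E"
    using assms by (auto simp: simple_graph_def intro: finite_subset[of _ "Pow V"])
  have "{(a, b). {a, b} \<in> E} = (\<Union>e\<in>E. {(a, b). {a, b} = e})"
    by auto
  also have "card \<dots> = (\<Sum>e\<in>E. card {(a, b). {a, b} = e})"
    using \<open>finite E\<close> assms
    by (intro card_UN_disjoint) (auto simp: simple_graph_def intro: ordered_pairs_of_edge)
  also have "\<dots> = (\<Sum>e\<in>E. 2)"
    using assms by (intro sum.cong) (auto simp: simple_graph_def ordered_pairs_of_edge)
  finally show ?thesis by simp
qed

text \<open>A shared end point makes one of the four orientations vanish.\<close>

lemma strict_cross_distinct:
  assumes "strict_cross (f a) (f a') (f b) (f b')"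
  shows "{a, a'} \<inter> {b, b'} = {}"
  using assms by (auto simp: strict_cross_def orient_def det2_def)

context
  fixes V :: "'a set" and E :: "'a set set" and p :: "'a \<Rightarrow> real^2"
  assumes straight: "straight_line_drawing V E p"
begin

lemma straight_simple_graph: "simple_graph V E"
  using straight by (simp add: straight_line_drawing_def good_drawing_def drawing_def)

lemma straight_finite_Int:
  assumes "e \<in> E" "f \<in> E" "e \<noteq> f"
  shows "finite (line_segments p e \<inter> line_segments p f)"
proof -
  have "\<forall>e\<in>E. \<forall>f\<in>E. e \<noteq> f \<longrightarrow> finite (line_segments p e \<inter> line_segments p f) \<and>
      (\<forall>x \<in> edge_interior p (line_segments p) e \<inter> edge_interior p (line_segments p) f.
        cross_at (line_segments p e) (line_segments p f) x)"
    using straight unfolding straight_line_drawing_def good_drawing_def by (elim conjE)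
  from conjunct1[OF this[rule_format, OF assms]] show ?thesis .
qed

lemma straight_no_triple:
  assumes "e \<in> E" "f \<in> E" "g \<in> E" "e \<noteq> f" "e \<noteq> g" "f \<noteq> g"
  shows "edge_interior p (line_segments p) e \<inter> edge_interior p (line_segments p) f \<inter>
    edge_interior p (line_segments p) g = {}"
proof -
  have "\<forall>e\<in>E. \<forall>f\<in>E. \<forall>g\<in>E. e \<noteq> f \<and> e \<noteq> g \<and> f \<noteq> g \<longrightarrow>
      edge_interior p (line_segments p) e \<inter> edge_interior p (line_segments p) f \<inter>
      edge_interior p (line_segments p) g = {}"
    using straight unfolding straight_line_drawing_def good_drawing_def by (elim conjE)
  then show ?thesis
    using assms by simp
qed

lemma finite_crossings: "finite (crossings V E p (line_segments p))"
proof (rule finite_subset)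
  have "finite E"
    using straight_simple_graph by (auto simp: simple_graph_def intro: finite_subset[of _ "Pow V"])
  then show "finite (\<Union>e\<in>E. \<Union>f\<in>E - {e}. line_segments p e \<inter> line_segments p f)"
    by (intro finite_UN_I finite_Diff straight_finite_Int) auto
  show "crossings V E p (line_segments p) \<subseteq> (\<Union>e\<in>E. \<Union>f\<in>E - {e}. line_segments p e \<inter> line_segments p f)"
    by (auto simp: crossings_def)
qed

text \<open>Each pair is sent to a chosen common point that is not a vertex. No third edge passes
  through it, so only \<open>(e, f)\<close> and \<open>(f, e)\<close> can be sent to the same point,
  which accounts for the 2.\<close>

lemma card_crossing_edge_pairs:
  "card {(e, f). e \<in> E \<and> f \<in> E \<and> e \<noteq> f \<and> line_segments p e \<inter> line_segments p f - p ` V \<noteq> {}}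
    \<le> 2 * cr V E p (line_segments p)" (is "card ?P \<le> _")
proof -
  let ?L = "line_segments p"
  define pt where "pt = (\<lambda>(e, f). SOME x. x \<in> ?L e \<inter> ?L f - p ` V)"
  have pt: "pt z \<in> ?L (fst z) \<inter> ?L (snd z) - p ` V" if "z \<in> ?P" for z
  proof -
    have "\<exists>x. x \<in> ?L (fst z) \<inter> ?L (snd z) - p ` V"
      using that by auto
    then show ?thesis
      unfolding pt_def case_prod_beta by (rule someI_ex)
  qed
  have sub: "e \<subseteq> V" if "e \<in> E" for e
    using that straight_simple_graph by (simp add: simple_graph_def)
  have int: "x \<in> edge_interior p ?L e" if "e \<in> E" "x \<in> ?L e" "x \<notin> p ` V" for e x
    using that sub[of e] by (auto simp: edge_interior_def)
  have no3: "g = e \<or> g = f" if "e \<in> E" "f \<in> E" "g \<in> E" "e \<noteq> f"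
    "x \<in> ?L e" "x \<in> ?L f" "x \<in> ?L g" "x \<notin> p ` V" for e f g x
  proof (rule ccontr)
    assume "\<not> (g = e \<or> g = f)"
    then have "edge_interior p ?L e \<inter> edge_interior p ?L f \<inter> edge_interior p ?L g = {}"
      using that by (intro straight_no_triple) auto
    moreover have "x \<in> edge_interior p ?L e" "x \<in> edge_interior p ?L f" "x \<in> edge_interior p ?L g"
      using that by (simp_all add: int)
    ultimately show False
      by auto
  qed
  show ?thesis
    unfolding cr_def
  proof (rule card_le_mult_fibres[where f = pt])
    show "finite (crossings V E p ?L)"
      by (rule finite_crossings)
    show "pt ` ?P \<subseteq> crossings V E p ?L"
    proof
      fix x assume "x \<in> pt ` ?P"
      then obtain z where z: "x = pt z" "z \<in> ?P"
        by (rule imageE)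
      obtain e f where "z = (e, f)"
        by (cases z)
      with z have ef: "(e, f) \<in> ?P" "x = pt (e, f)"
        by simp_all
      then have "e \<in> E" "f \<in> E" "e \<noteq> f" "x \<in> ?L e" "x \<in> ?L f" "x \<notin> p ` V"
        using pt[OF ef(1)] by auto
      then show "x \<in> crossings V E p ?L"
        unfolding crossings_def by auto
    qed
    show "card {z \<in> ?P. pt z = x} \<le> 2" for x
    proof (cases "{z \<in> ?P. pt z = x} = {}")
      case True
      show ?thesis
        unfolding True by simp
    next
      case False
      then obtain e f where ef: "(e, f) \<in> ?P" "pt (e, f) = x"
        by auto
      have "{z \<in> ?P. pt z = x} \<subseteq> {(e, f), (f, e)}"
      proof
        fix z assume z: "z \<in> {z \<in> ?P. pt z = x}"
        obtain g h where gh: "z = (g, h)" by (cases z)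
        have "x \<in> ?L e" "x \<in> ?L f" "x \<in> ?L g" "x \<in> ?L h" "x \<notin> p ` V"
          using pt[of z] pt[OF ef(1)] z gh ef(2) by auto
        moreover have "g \<in> E" "h \<in> E" "g \<noteq> h" "e \<in> E" "f \<in> E" "e \<noteq> f"
          using z gh ef by auto
        ultimately have "g = e \<or> g = f" "h = e \<or> h = f"
          by (simp_all add: no3[of e f _ x])
        then show "z \<in> {(e, f), (f, e)}"
          using gh \<open>g \<noteq> h\<close> by auto
      qed
      then have "card {z \<in> ?P. pt z = x} \<le> card {(e, f), (f, e)}"
        by (rule card_mono[rotated]) (rule finite.intros finite.insertI)+
      also have "\<dots> \<le> 2"
        by (rule card_insert_le_m1) simp_all
      finally show ?thesis .
    qed
  qed
qed

text \<open>The 8 is 4 times 2: two orientations for each of the two edges, and at most two ordered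
  pairs of edges for each crossing point.\<close>

lemma card_strict_crossings_le:
  assumes D_def: "D = {(a, b). {a, b} \<in> E}"
  shows "card {((a, a'), (b, b')). (a, a') \<in> D \<and> (b, b') \<in> D \<and>
      strict_cross (coords (p a)) (coords (p a')) (coords (p b)) (coords (p b'))}
    \<le> 8 * cr V E p (line_segments p)" (is "card ?S \<le> _")
proof -
  let ?L = "line_segments p"
  let ?P = "{(e, f). e \<in> E \<and> f \<in> E \<and> e \<noteq> f \<and> ?L e \<inter> ?L f - p ` V \<noteq> {}}"
  have graph: "e \<subseteq> V" "card e = 2" if "e \<in> E" for e
    using that straight_simple_graph by (auto simp: simple_graph_def)
  have inj: "inj_on p V"
    using straight by (simp add: straight_line_drawing_def good_drawing_def drawing_def)
  have endpoint: "v \<in> e" if "e \<in> E" "v \<in> V" "p v \<in> ?L e" for e v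
  proof -
    have "p v \<notin> edge_interior p ?L e"
      using straight that by (simp add: straight_line_drawing_def good_drawing_def)
    then have "p v \<in> p ` e"
      using that by (simp add: edge_interior_def)
    then show ?thesis
      using inj_on_image_mem_iff[OF inj that(2) graph(1)[OF that(1)]] by simp
  qed
  define F where "F = (\<lambda>((a :: 'a, a'), (b :: 'a, b')). ({a, a'}, {b, b'}))"
  have "card ?S \<le> 4 * card ?P"
  proof (rule card_le_mult_fibres[where f = F])
    have "finite E"
      using straight_simple_graph by (auto simp: simple_graph_def intro: finite_subset[of _ "Pow V"])
    then show "finite ?P"
      by (intro finite_subset[of ?P "E \<times> E"]) auto
    show "F ` ?S \<subseteq> ?P"
    proof
      fix r assume "r \<in> F ` ?S"
      then obtain a a' b b' where r: "r = ({a, a'}, {b, b'})" and E: "{a, a'} \<in> E" "{b, b'} \<in> E"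
        and cross: "strict_cross (coords (p a)) (coords (p a')) (coords (p b)) (coords (p b'))"
        by (auto simp: D_def F_def)
      have disj: "{a, a'} \<inter> {b, b'} = {}"
        using strict_cross_distinct[of "\<lambda>v. coords (p v)"] cross by blast
      have "closed_segment (coords (p a)) (coords (p a')) \<inter> closed_segment (coords (p b)) (coords (p b')) \<noteq> {}"
        by (rule strict_cross_imp_segments_meet[OF cross])
      then have "coords ` closed_segment (p a) (p a') \<inter> coords ` closed_segment (p b) (p b') \<noteq> {}"
        by (simp add: closed_segment_linear_image[OF linear_coords])
      then obtain x where x: "x \<in> closed_segment (p a) (p a')" "x \<in> closed_segment (p b) (p b')"
        unfolding image_Int[OF inj_coords, symmetric] by blast
      then have x: "x \<in> ?L {a, a'}" "x \<in> ?L {b, b'}"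
        by (simp_all add: line_segments_def segment_convex_hull)
      \<comment> \<open>In a good drawing a vertex lying on both edges is an end point of both,
        whereas a strict crossing has disjoint pairs of end points.\<close>
      have "x \<notin> p ` V"
      proof
        assume "x \<in> p ` V"
        then obtain v where "v \<in> V" "x = p v" by auto
        then have "v \<in> {a, a'}" "v \<in> {b, b'}"
          using endpoint[OF E(1), of v] endpoint[OF E(2), of v] x by simp_all
        then show False using disj by auto
      qed
      with x have "?L {a, a'} \<inter> ?L {b, b'} - p ` V \<noteq> {}"
        by blast
      moreover have "{a, a'} \<noteq> {b, b'}"
        using disj by auto
      ultimately show "r \<in> ?P"
        using E by (simp add: r)
    qed
    show "card {z \<in> ?S. F z = r} \<le> 4" if "r \<in> ?P" for r
    proof -
      let ?O = "\<lambda>e. {(a, b). {a, b} = e}"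
      obtain e f where r: "r = (e, f)" by (cases r)
      have e: "card e = 2" and f: "card f = 2"
        using that graph(2) r by auto
      have "card {z \<in> ?S. F z = r} \<le> card (?O e \<times> ?O f)"
        using ordered_pairs_of_edge(1)[OF e] ordered_pairs_of_edge(1)[OF f]
        by (intro card_mono finite_cartesian_product) (auto simp: r F_def)
      also have "\<dots> = 4"
        by (simp add: card_cartesian_product ordered_pairs_of_edge(2)[OF e] ordered_pairs_of_edge(2)[OF f])
      finally show ?thesis .
    qed
  qed
  also have "\<dots> \<le> 4 * (2 * cr V E p ?L)"
    by (intro mult_left_mono card_crossing_edge_pairs) simp
  finally show ?thesis by simp
qed

end

theorem theorem1p8:
  fixes \<Omega> :: "(real^2) set"
    and V :: "nat \<Rightarrow> 'a set" and E :: "nat \<Rightarrow> 'a set set" and p :: "nat \<Rightarrow> 'a \<Rightarrow> real^2"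
    and e :: real
  assumes "compact \<Omega>" and "convex \<Omega>" and "interior \<Omega> \<noteq> {}"
    and "\<And>n. n \<ge> 1 \<Longrightarrow> straight_line_drawing (V n) (E n) (p n)"
    and "\<And>n. n \<ge> 1 \<Longrightarrow> card (V n) = n"
    and "uniform_in \<Omega> V p"
    and "(\<lambda>n. real (card (E n)) / real n ^ 2) \<longlonglongrightarrow> e"
  shows "\<exists>r :: nat \<Rightarrow> real. r \<in> o(\<lambda>n. real n ^ 4) \<and>
           (\<forall>n\<ge>1. real (cr (V n) (E n) (p n) (line_segments (p n)))
                     \<ge> 8 * real n ^ 4 / (9 * pi\<^sup>2) * e ^ 3 - r n)"
proof -
  let ?cr = "\<lambda>n. cr (V n) (E n) (p n) (line_segments (p n))"
  define D where "D n = {(a, b). {a, b} \<in> E n}" for n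
  define N where "N n = card {((a, a'), (b, b')). (a, a') \<in> D n \<and> (b, b') \<in> D n \<and>
      strict_cross (coords (p n a)) (coords (p n a')) (coords (p n b)) (coords (p n b'))}" for n
  \<comment> \<open>The deficit cut off at 0: the required inequality then holds by definition, and
    only the growth of \<open>r\<close> is left to prove.\<close>
  define r where "r n = max 0 (8 * real n ^ 4 / (9 * pi\<^sup>2) * e ^ 3 - ?cr n)" for n
  have graph: "simple_graph (V n) (E n)" if "n \<ge> 1" for n
    using straight_simple_graph[OF assms(4)[OF that]] .
  interpret equidistributed "coords ` \<Omega>" "measure lborel (coords ` \<Omega>)"
    "distr (uniform_measure lborel \<Omega>) borel coords" V "\<lambda>n v. coords (p n v)"
    using graph assms(1-3,5,6)
    by (intro equidistributed_coords) (auto simp: simple_graph_def)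
  have D_sub: "D n \<subseteq> V n \<times> V n" if "n \<ge> 1" for n
    using graph[OF that] by (auto simp: D_def simple_graph_def)
  have D_lim: "(\<lambda>n. card (D n) / (real n)\<^sup>2) \<longlonglongrightarrow> 2 * e"
  proof (rule Lim_transform_eventually)
    show "(\<lambda>n. 2 * (real (card (E n)) / real n ^ 2)) \<longlonglongrightarrow> 2 * e"
      by (intro tendsto_intros assms)
    show "\<forall>\<^sub>F n in sequentially. 2 * (real (card (E n)) / real n ^ 2) = card (D n) / (real n)\<^sup>2"
      using eventually_ge_at_top[of 1]
      by eventually_elim (simp add: D_def card_ordered_edges[OF graph])
  qed
  have ev: "\<forall>\<^sub>F n in sequentially. r n / real n ^ 4 < \<gamma>" if "\<gamma> > 0" for \<gamma>
  proof -
    have "\<forall>\<^sub>F n in sequentially. 8 / (9 * pi\<^sup>2) * (2 * e) ^ 3 - \<gamma> \<le> N n / real n ^ 4"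
      unfolding N_def by (rule eventually_strict_crossings[OF D_sub D_lim that])
    then show ?thesis
      using eventually_ge_at_top[of 1]
    proof eventually_elim
      case (elim n)
      have "real (N n) \<le> real (8 * ?cr n)"
        unfolding N_def
        by (rule of_nat_mono, rule card_strict_crossings_le[OF assms(4)[OF elim(2)]]) (rule D_def)
      then have "N n / real n ^ 4 \<le> real (8 * ?cr n) / real n ^ 4"
        by (rule divide_right_mono) simp
      \<comment> \<open>The cube of the limit \<open>2 * e\<close> supplies the 8 that balances the
        multiplicity in \<open>8 * ?cr n\<close>.\<close>
      with elim(1) have "8 * (8 / (9 * pi\<^sup>2) * e ^ 3) - \<gamma> \<le> 8 * (real (?cr n) / real n ^ 4)"
        by (simp add: power_mult_distrib)
      then have "8 / (9 * pi\<^sup>2) * e ^ 3 - real (?cr n) / real n ^ 4 < \<gamma>"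
        using that by linarith
      moreover have "(8 * real n ^ 4 / (9 * pi\<^sup>2) * e ^ 3 - real (?cr n)) / real n ^ 4
          = 8 / (9 * pi\<^sup>2) * e ^ 3 - real (?cr n) / real n ^ 4"
        using elim(2) by (simp add: field_simps)
      ultimately show ?case
        using that by (simp add: r_def max_def)
    qed
  qed
  have "(\<lambda>n. r n / real n ^ 4) \<longlonglongrightarrow> 0"
  proof (rule order_tendstoI)
    show "\<forall>\<^sub>F n in sequentially. a < r n / real n ^ 4" if "a < 0" for a
      using that by (intro always_eventually allI less_le_trans[OF that]) (simp add: r_def)
  qed (rule ev)
  moreover have "\<forall>\<^sub>F n in sequentially. real n ^ 4 \<noteq> 0"
    using eventually_gt_at_top[of 0] by eventually_elim simp
  ultimately have "r \<in> o(\<lambda>n. real n ^ 4)"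
    by (intro smalloI_tendsto)
  then show ?thesis
    by (intro exI[of _ r]) (auto simp: r_def)
qed

end
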